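(* Let $L,H>0$ and $D=\mathbb T_L\times(0,H)$. Suppose that $\bar\psi\in C^2(\bar D)$ satisfies, for some $g\in C^1(\mathbb R)$ and some $\lambda\in\mathbb R$, $$-\Delta\bar\psi=g(\bar\psi-\lambda x_2)\ \text{ in } D,\qquad \bar\psi \text{ is constant on each of } \{x_2=0\} \text{ and } \{x_2=H\}.$$ Denote $\bar\omega:=-\Delta\bar\psi$ and fix $1<p<\infty$. If $$0\le \min_{\bar D}g'(\bar\psi-\lambda x_2)\le\max_{\bar D}g'(\bar\psi-\lambda x_2)<\Lambda_1,$$ then: (i) $\bar\psi$ depends only on $x_2$; and (ii) the associated steady flow is stable in the following sense: for any $\varepsilon>0$ there exists $\delta>0$ such that for any sufficiently smooth Euler flow in $D$ with vorticity $\omega(t,\mathbf x)$, $$\|\omega(0,\cdot)-\bar\omega\|_{L^p(D)}<\delta\quad\Longrightarrow\quad\|\omega(t,\cdot)-\bar\omega\|_{L^p(D)}<\varepsilon\quad\forall\,t\in\mathbb R.$$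
   Context: $\mathbb T_L=\mathbb R/L\mathbb Z$, $D=\mathbb T_L\times(0,H)$ is a periodic channel with coordinates $\mathbf x=(x_1,x_2)$, $\bar D=\mathbb T_L\times[0,H]$. Euler flow: a solution, defined for all $t\in\mathbb R$, of $\partial_t\mathbf v+(\mathbf v\cdot\nabla)\mathbf v=-\nabla P$, $\nabla\cdot\mathbf v=0$ in $D$, with $v_2=0$ on $\{x_2=0\}\cup\{x_2=H\}$, where $\mathbf v=(v_1,v_2)$ and $P$ are functions on $\mathbb R\times D$ (so periodic in $x_1$). "Sufficiently smooth" means a classical solution, e.g. $\mathbf v\in C^2(\mathbb R\times\bar D)$, $P\in C^1(\mathbb R\times\bar D)$. Its vorticity is $\omega=\partial_{x_1}v_2-\partial_{x_2}v_1$. The flux $Q=\int_0^Hv_1\,dx_2$ of the flow is arbitrary. The flow associated with the stream function $\bar\psi$ is $\mathbf v=\nabla^\perp\psi$, $\nabla^\perp=(\partial_{x_2},-\partial_{x_1})$, $\psi(t,x_1,x_2)=\bar\psi(x_1-\lambda t,x_2)$; it is steady if $\lambda=0$ or $\bar\psi$ depends only on $x_2$. $\Lambda_1$ is the first (smallest) eigenvalue of the problem $$-\Delta u=\Lambda u\ \text{ in } D,\qquad u|_{x_2=0}=u|_{x_2=H}=\text{constant},\qquad \int_Du\,d\mathbf x=0$$ (the constant is not prescribed but is the same on both boundary components). Explicitly, $\Lambda_1=\min\{\frac{4\pi^2}{H^2},\frac{4\pi^2}{L^2}+\frac{\pi^2}{H^2}\}$. *)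

theory Defs
  imports "HOL-Analysis.Analysis"
begin

text \<open>
  A function on \<open>\<T>\<^sub>L \<times> [0,H]\<close> is represented by a function \<open>f x y\<close> of two real variables that is
  \<open>L\<close>-periodic in \<open>x\<close> for \<open>y \<in> [0,H]\<close>; its values for \<open>y\<close> outside \<open>[0,H]\<close> are irrelevant.
\<close>

definition channel_periodic :: "real \<Rightarrow> real \<Rightarrow> (real \<Rightarrow> real \<Rightarrow> real) \<Rightarrow> bool" where
  "channel_periodic L H f \<longleftrightarrow> (\<forall>x. \<forall>y\<in>{0..H}. f (x + L) y = f x y)"

text \<open>
  \<open>C\<^sup>k\<close> regularity up to the boundary. It is only used for closed convex sets \<open>S\<close> with nonempty
  interior, where the derivative within \<open>S\<close> is unique and the notion agrees with having
  derivatives in the interior that extend continuously to \<open>S\<close>.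
\<close>

primrec Ck_on :: "nat \<Rightarrow> 'a::euclidean_space set \<Rightarrow> ('a \<Rightarrow> real) \<Rightarrow> bool" where
  "Ck_on 0 S f \<longleftrightarrow> continuous_on S f"
| "Ck_on (Suc k) S f \<longleftrightarrow>
     (\<exists>f'. (\<forall>x\<in>S. (f has_derivative f' x) (at x within S)) \<and> (\<forall>v. Ck_on k S (\<lambda>x. f' x v)))"

definition Ck_channel :: "nat \<Rightarrow> real \<Rightarrow> real \<Rightarrow> (real \<Rightarrow> real \<Rightarrow> real) \<Rightarrow> bool" where
  "Ck_channel k L H f \<longleftrightarrow>
     channel_periodic L H f \<and> Ck_on k (UNIV \<times> {0..H}) (\<lambda>(x, y). f x y)"

definition Ck_time_channel ::
    "nat \<Rightarrow> real \<Rightarrow> real \<Rightarrow> (real \<Rightarrow> real \<Rightarrow> real \<Rightarrow> real) \<Rightarrow> bool" where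
  "Ck_time_channel k L H f \<longleftrightarrow>
     (\<forall>t. channel_periodic L H (f t)) \<and>
     Ck_on k (UNIV \<times> UNIV \<times> {0..H}) (\<lambda>(t, x, y). f t x y)"

text \<open>The operators below are only meaningful, and only used, at interior points \<open>0 < y < H\<close>.\<close>

definition laplacian :: "(real \<Rightarrow> real \<Rightarrow> real) \<Rightarrow> real \<Rightarrow> real \<Rightarrow> real" where
  "laplacian f x y = deriv (deriv (\<lambda>s. f s y)) x + deriv (deriv (\<lambda>s. f x s)) y"

definition vorticity ::
    "(real \<Rightarrow> real \<Rightarrow> real) \<Rightarrow> (real \<Rightarrow> real \<Rightarrow> real) \<Rightarrow> real \<Rightarrow> real \<Rightarrow> real" where
  "vorticity v1 v2 x y = deriv (\<lambda>s. v2 s y) x - deriv (\<lambda>s. v1 x s) y"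

definition channel_integral :: "real \<Rightarrow> real \<Rightarrow> (real \<Rightarrow> real \<Rightarrow> real) \<Rightarrow> real" where
  "channel_integral L H f = (LINT z : {0<..<L} \<times> {0<..<H} | lborel. f (fst z) (snd z))"

definition channel_Lp_norm :: "real \<Rightarrow> real \<Rightarrow> real \<Rightarrow> (real \<Rightarrow> real \<Rightarrow> real) \<Rightarrow> real" where
  "channel_Lp_norm L H p f = channel_integral L H (\<lambda>x y. \<bar>f x y\<bar> powr p) powr (1 / p)"

definition channel_eigenvalue :: "real \<Rightarrow> real \<Rightarrow> real \<Rightarrow> bool" where
  "channel_eigenvalue L H \<Lambda> \<longleftrightarrow>
     (\<exists>u. Ck_channel 2 L H u \<and>
          (\<exists>x. \<exists>y\<in>{0..H}. u x y \<noteq> 0) \<and>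
          (\<forall>x. \<forall>y\<in>{0<..<H}. - laplacian u x y = \<Lambda> * u x y) \<and>
          (\<exists>c. \<forall>x. u x 0 = c \<and> u x H = c) \<and>
          channel_integral L H u = 0)"

definition first_eigenvalue :: "real \<Rightarrow> real \<Rightarrow> real" where
  "first_eigenvalue L H = (LEAST \<Lambda>. channel_eigenvalue L H \<Lambda>)"

text \<open>Classical solutions of the Euler equations, defined for all times, with arbitrary flux.\<close>

definition euler_flow ::
    "real \<Rightarrow> real \<Rightarrow> (real \<Rightarrow> real \<Rightarrow> real \<Rightarrow> real) \<Rightarrow> (real \<Rightarrow> real \<Rightarrow> real \<Rightarrow> real) \<Rightarrow>
     (real \<Rightarrow> real \<Rightarrow> real \<Rightarrow> real) \<Rightarrow> bool" where
  "euler_flow L H v1 v2 P \<longleftrightarrow>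
     Ck_time_channel 2 L H v1 \<and> Ck_time_channel 2 L H v2 \<and> Ck_time_channel 1 L H P \<and>
     (\<forall>t x. \<forall>y\<in>{0<..<H}.
        deriv (\<lambda>s. v1 s x y) t + v1 t x y * deriv (\<lambda>s. v1 t s y) x + v2 t x y * deriv (\<lambda>s. v1 t x s) y
          = - deriv (\<lambda>s. P t s y) x \<and>
        deriv (\<lambda>s. v2 s x y) t + v1 t x y * deriv (\<lambda>s. v2 t s y) x + v2 t x y * deriv (\<lambda>s. v2 t x s) y
          = - deriv (\<lambda>s. P t x s) y \<and>
        deriv (\<lambda>s. v1 t s y) x + deriv (\<lambda>s. v2 t x s) y = 0) \<and>
     (\<forall>t x. v2 t x 0 = 0 \<and> v2 t x H = 0)"

definition vorticity_Lp_stable ::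
    "real \<Rightarrow> real \<Rightarrow> real \<Rightarrow> (real \<Rightarrow> real \<Rightarrow> real) \<Rightarrow> bool" where
  "vorticity_Lp_stable L H p \<omega>b \<longleftrightarrow>
     (\<forall>\<epsilon>>0. \<exists>\<delta>>0. \<forall>v1 v2 P. euler_flow L H v1 v2 P \<longrightarrow>
        channel_Lp_norm L H p (\<lambda>x y. vorticity (v1 0) (v2 0) x y - \<omega>b x y) < \<delta> \<longrightarrow>
        (\<forall>t. channel_Lp_norm L H p (\<lambda>x y. vorticity (v1 t) (v2 t) x y - \<omega>b x y) < \<epsilon>))"

end

theory Submission
  imports Defs
begin

text \<open>
  Rigidity: the translates \<open>\<psi>(\<cdot> + \<tau>, \<cdot>)\<close> solve the same equation with the same boundary values, so
  \<open>d = \<psi>(\<cdot> + \<tau>, \<cdot>) - \<psi>\<close> has mean zero, vanishes on the boundary and satisfies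
  \<open>\<integral>|\<nabla>d|\<^sup>2 \<le> sup g' \<integral>d\<^sup>2\<close>. The Poincare inequality with constant \<open>\<Lambda>\<^sub>1\<close> forces \<open>d = 0\<close>.

  Stability: this is Arnold's second theorem with a truncation. Put \<open>\<Psi> = \<psi> - c y\<close>, let \<open>F\<close> be the convex
  conjugate of a primitive of (an extension of) \<open>g\<close>, let \<open>T\<close> truncate to an interval containing the steady
  vorticity \<open>\<omega>b = g(\<Psi>)\<close>, and let \<open>\<phi>\<close> be the stream function of the perturbation, after removal of the
  conserved flux. Up to the small tail \<open>\<omega> - T\<omega>\<close>, whose \<open>L\<^sup>p\<close> norm is conserved, the quantity
  \<open>\<integral>F(T\<omega>) - F(\<omega>b) - \<Psi>(T\<omega> - \<omega>b) - |\<nabla>\<phi>|\<^sup>2/2\<close> is a constant of motion. Duality bounds its first three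
  terms below by \<open>\<integral>s(T\<omega> - \<omega>b) - \<Lambda>s\<^sup>2/2\<close> for every \<open>s\<close>, where \<open>\<Lambda> < \<Lambda>\<^sub>1\<close> bounds \<open>g'\<close>. Taking for \<open>s\<close> the
  mean-free part of \<open>\<phi>\<close> controls \<open>\<nabla>\<phi>\<close>; then \<open>s = (T\<omega> - \<omega>b)/\<Lambda>\<close> controls \<open>T\<omega> - \<omega>b\<close> in \<open>L\<^sup>2\<close>, and
  boundedness turns this into \<open>L\<^sup>p\<close>. The tail is paired with \<open>\<phi>\<close> through the two-dimensional Sobolev
  inequality, which is why any \<open>p > 1\<close> is enough.
\<close>

section \<open>Integrals of continuous functions over the channel\<close>

text \<open>Two obstacles of regularity shape the argument. \<open>\<psi>\<close> is only C^2, so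
  its equation cannot be differentiated in \<open>x\<close>, and finite translates take the place of
  \<open>\<psi>x\<close>. And \<open>g'\<close> may vanish on the range of \<open>\<Psi>\<close>, so
  the classical Casimir function, a primitive of the inverse of \<open>g\<close>, is replaced by a
  conjugate, whose convexity of strength \<open>1/\<Lambda>\<close> comes from
  \<open>g' \<le> \<Lambda>\<close>. The vorticity of the perturbed flow has no a priori bound and
  \<open>F\<close> grows quadratically, so for \<open>p < 2\<close> smallness in L^p at time 0 says
  nothing about \<open>F(\<omega>)\<close>. On the truncated range \<open>F\<close> is Lipschitz,
  and the initial value is bounded by an L^1 distance. The mean of \<open>\<phi>\<close> is of the
  order of the root of its Dirichlet energy, too large to be absorbed by itself; but it meets only
  the total of \<open>T\<omega> - \<omega>b\<close>, which is small because total vorticity is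
  conserved. The strict gap between \<open>\<Lambda>\<close> and the first eigenvalue leaves a
  positive multiple of the energy that absorbs all such mixed terms.\<close>

definition cont_ch :: "real \<Rightarrow> (real \<Rightarrow> real \<Rightarrow> real) \<Rightarrow> bool" where
  "cont_ch H f \<longleftrightarrow> continuous_on (UNIV \<times> {0..H}) (\<lambda>z. f (fst z) (snd z))"

text \<open>The gauge integral over the closed box gives direct access to the fundamental theorem of
  calculus and to differentiation under the integral; \<open>channel_integral_eq\<close> links it to
  the Lebesgue integral of the statement.\<close>

definition rect_int :: "real \<Rightarrow> real \<Rightarrow> (real \<Rightarrow> real \<Rightarrow> real) \<Rightarrow> real" where
  "rect_int L H f = integral (cbox (0, 0) (L, H)) (\<lambda>z. f (fst z) (snd z))"

named_theorems cont_ch_intros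

lemma cont_ch_add [cont_ch_intros]: "cont_ch H f \<Longrightarrow> cont_ch H g \<Longrightarrow> cont_ch H (\<lambda>x y. f x y + g x y)"
  and cont_ch_diff [cont_ch_intros]: "cont_ch H f \<Longrightarrow> cont_ch H g \<Longrightarrow> cont_ch H (\<lambda>x y. f x y - g x y)"
  and cont_ch_mult [cont_ch_intros]: "cont_ch H f \<Longrightarrow> cont_ch H g \<Longrightarrow> cont_ch H (\<lambda>x y. f x y * g x y)"
  and cont_ch_minus [cont_ch_intros]: "cont_ch H f \<Longrightarrow> cont_ch H (\<lambda>x y. - f x y)"
  and cont_ch_abs [cont_ch_intros]: "cont_ch H f \<Longrightarrow> cont_ch H (\<lambda>x y. \<bar>f x y\<bar>)"
  and cont_ch_power [cont_ch_intros]: "cont_ch H f \<Longrightarrow> cont_ch H (\<lambda>x y. f x y ^ n)"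
  and cont_ch_const [cont_ch_intros]: "cont_ch H (\<lambda>x y. k)"
  unfolding cont_ch_def by (auto intro!: continuous_intros)

lemma cont_ch_divide [cont_ch_intros]: "cont_ch H f \<Longrightarrow> cont_ch H (\<lambda>x y. f x y / k)"
  unfolding divide_inverse by (intro cont_ch_intros)

lemma cont_ch_powr [cont_ch_intros]:
  assumes "cont_ch H f" "p > 0"
  shows "cont_ch H (\<lambda>x y. \<bar>f x y\<bar> powr p)"
  using assms unfolding cont_ch_def by (intro continuous_on_powr' continuous_intros) auto

lemma box_pair_eq: "box (a, c) (b, d) = box a b \<times> box c d"
  by (auto simp: mem_box Basis_prod_def ball_Un)

lemma cont_ch_compose:
  assumes "cont_ch H f" "continuous_on UNIV h"
  shows "cont_ch H (\<lambda>x y. h (f x y))"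
  using assms unfolding cont_ch_def
  by (auto intro: continuous_on_compose2[of UNIV h])

lemma cont_ch_snd:
  assumes "continuous_on {0..H} b"
  shows "cont_ch H (\<lambda>x y. b y)"
  unfolding cont_ch_def
  by (rule continuous_on_compose2[OF assms continuous_on_snd[OF continuous_on_id]]) auto

lemma cont_ch_shift:
  assumes "cont_ch H f"
  shows "cont_ch H (\<lambda>x y. f (x + k) y)"
  unfolding cont_ch_def
  by (rule continuous_on_compose2[OF assms[unfolded cont_ch_def], of _ "\<lambda>z. (fst z + k, snd z)", simplified])
     (auto intro!: continuous_intros)

lemma cont_ch_imp_x:
  assumes "cont_ch H f" "y \<in> {0..H}"
  shows "continuous_on A (\<lambda>x. f x y)"
  by (rule continuous_on_compose2[OF assms(1)[unfolded cont_ch_def], of _ "\<lambda>x. (x, y)", simplified])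
     (use assms(2) in \<open>auto intro!: continuous_intros\<close>)

lemma cont_ch_imp_y:
  assumes "cont_ch H f" "A \<subseteq> {0..H}"
  shows "continuous_on A (\<lambda>y. f x y)"
  by (rule continuous_on_compose2[OF assms(1)[unfolded cont_ch_def], of _ "\<lambda>y. (x, y)", simplified])
     (use assms(2) in \<open>auto intro!: continuous_intros\<close>)

lemma cont_ch_imp_cbox:
  assumes "cont_ch H f"
  shows "continuous_on (cbox (0, 0) (L, H)) (\<lambda>z. f (fst z) (snd z))"
  using assms unfolding cont_ch_def cbox_Pair_eq
  by (rule continuous_on_subset) auto

lemma cont_ch_integrable:
  assumes "cont_ch H f"
  shows "(\<lambda>z. f (fst z) (snd z)) integrable_on (cbox (0, 0) (L, H))"
  by (rule integrable_continuous[OF cont_ch_imp_cbox[OF assms]])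

text \<open>The differential equations are given in the open channel, while integration by parts,
  the wall circulations and the shear profile use them up to the walls. Density of the open interval
  and continuity of both sides close the gap.\<close>

lemma cont_ch_eq_closed:
  assumes "cont_ch H f" "cont_ch H g" "H > 0" "\<And>x y. 0 < y \<Longrightarrow> y < H \<Longrightarrow> f x y = g x y" "y \<in> {0..H}"
  shows "f x y = g x y"
proof -
  have "continuous_on {0..H} (\<lambda>y. f x y - g x y)"
    by (intro continuous_intros cont_ch_imp_y[of H] assms) auto
  then have "continuous_on (closure {0<..<H}) (\<lambda>y. f x y - g x y)"
    using \<open>H > 0\<close> by simp
  moreover have "y \<in> closure {0<..<H}" using assms(3,5) by simp
  ultimately have "f x y - g x y = 0"
    using continuous_constant_on_closure[of "{0<..<H}" "\<lambda>y. f x y - g x y" 0 y] assms(4) by simp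
  then show ?thesis by simp
qed

lemma cont_ch_bounded:
  assumes "cont_ch H f"
  obtains B where "B > 0" "\<And>x y. x \<in> {0..L} \<Longrightarrow> y \<in> {0..H} \<Longrightarrow> \<bar>f x y\<bar> \<le> B"
proof -
  have "compact ((\<lambda>z. f (fst z) (snd z)) ` cbox (0, 0) (L, H))"
    by (rule compact_continuous_image[OF cont_ch_imp_cbox[OF assms] compact_cbox])
  then have "bounded ((\<lambda>z. f (fst z) (snd z)) ` cbox (0, 0) (L, H))"
    by (rule compact_imp_bounded)
  then obtain B where B: "B > 0" "\<forall>v \<in> (\<lambda>z. f (fst z) (snd z)) ` cbox (0, 0) (L, H). norm v \<le> B"
    unfolding bounded_pos by blast
  show ?thesis
  proof (rule that[OF B(1)])
    fix x y assume "x \<in> {0..L}" "y \<in> {0..H}"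
    then have "(x, y) \<in> cbox (0, 0) (L, H)" by (simp add: cbox_Pair_eq)
    with B(2) show "\<bar>f x y\<bar> \<le> B" by force
  qed
qed

lemma rect_int_cong:
  assumes "\<And>x y. x \<in> {0..L} \<Longrightarrow> y \<in> {0..H} \<Longrightarrow> f x y = g x y"
  shows "rect_int L H f = rect_int L H g"
  unfolding rect_int_def by (rule integral_cong) (use assms in \<open>auto simp: cbox_Pair_eq\<close>)

lemma rect_int_add: "cont_ch H f \<Longrightarrow> cont_ch H g \<Longrightarrow> rect_int L H (\<lambda>x y. f x y + g x y) = rect_int L H f + rect_int L H g"
  unfolding rect_int_def by (rule integral_add) (auto intro: cont_ch_integrable)

lemma rect_int_diff: "cont_ch H f \<Longrightarrow> cont_ch H g \<Longrightarrow> rect_int L H (\<lambda>x y. f x y - g x y) = rect_int L H f - rect_int L H g"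
  unfolding rect_int_def by (rule integral_diff) (auto intro: cont_ch_integrable)

lemma rect_int_cmult: "rect_int L H (\<lambda>x y. k * f x y) = k * rect_int L H f"
  unfolding rect_int_def by simp

lemma rect_int_divide: "rect_int L H (\<lambda>x y. f x y / k) = rect_int L H f / k"
  unfolding rect_int_def by simp

lemma rect_int_minus: "rect_int L H (\<lambda>x y. - f x y) = - rect_int L H f"
  unfolding rect_int_def by simp

lemma rect_int_const: "0 \<le> L \<Longrightarrow> 0 \<le> H \<Longrightarrow> rect_int L H (\<lambda>x y. k) = k * (L * H)"
  unfolding rect_int_def by (simp add: content_Pair mult.commute)

lemma rect_int_mono:
  assumes "cont_ch H f" "cont_ch H g" "\<And>x y. x \<in> {0..L} \<Longrightarrow> y \<in> {0..H} \<Longrightarrow> f x y \<le> g x y"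
  shows "rect_int L H f \<le> rect_int L H g"
  unfolding rect_int_def
  by (rule integral_le[OF cont_ch_integrable[OF assms(1)] cont_ch_integrable[OF assms(2)]]) (use assms(3) in \<open>auto simp: cbox_Pair_eq\<close>)

lemma rect_int_nonneg:
  assumes "cont_ch H f" "\<And>x y. x \<in> {0..L} \<Longrightarrow> y \<in> {0..H} \<Longrightarrow> 0 \<le> f x y"
  shows "0 \<le> rect_int L H f"
  unfolding rect_int_def
  by (rule integral_nonneg[OF cont_ch_integrable[OF assms(1)]]) (use assms(2) in \<open>auto simp: cbox_Pair_eq\<close>)

lemma rect_int_abs_le:
  assumes "cont_ch H f"
  shows "\<bar>rect_int L H f\<bar> \<le> rect_int L H (\<lambda>x y. \<bar>f x y\<bar>)"
proof -
  have "rect_int L H f \<le> rect_int L H (\<lambda>x y. \<bar>f x y\<bar>)" "rect_int L H (\<lambda>x y. - f x y) \<le> rect_int L H (\<lambda>x y. \<bar>f x y\<bar>)"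
    by (intro rect_int_mono cont_ch_intros assms; simp)+
  then show ?thesis by (simp add: rect_int_minus)
qed

lemma rect_int_eq_0D:
  assumes "cont_ch H f" "L > 0" "H > 0" "\<And>x y. x \<in> {0..L} \<Longrightarrow> y \<in> {0..H} \<Longrightarrow> 0 \<le> f x y"
    "rect_int L H f \<le> 0" "x \<in> {0..L}" "y \<in> {0..H}"
  shows "f x y = 0"
proof -
  have "0 \<le> rect_int L H f" by (rule rect_int_nonneg[OF assms(1)]) (rule assms(4))
  then have "rect_int L H f = 0" using assms(5) by linarith
  moreover have "box (0, 0) (L, H) \<noteq> {}" using assms(2,3) by (simp add: box_pair_eq box_real)
  ultimately have "\<forall>z\<in>cbox (0, 0) (L, H). f (fst z) (snd z) = 0"
    unfolding rect_int_def using assms(4) cont_ch_imp_cbox[OF assms(1), of L]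
    by (subst (asm) integral_cbox_eq_0_iff) (auto simp: cbox_Pair_eq)
  then show ?thesis using assms(6,7) by (auto simp: cbox_Pair_eq)
qed

lemma rect_int_iterated:
  assumes "cont_ch H f"
  shows "rect_int L H f = integral {0..L} (\<lambda>x. integral {0..H} (f x))"
  unfolding rect_int_def using integral_prod_continuous[OF cont_ch_imp_cbox[OF assms, of L]]
  by (simp add: cbox_interval)

lemma rect_int_iterated':
  assumes "cont_ch H f"
  shows "rect_int L H f = integral {0..H} (\<lambda>y. integral {0..L} (\<lambda>x. f x y))"
proof -
  have "continuous_on (cbox (0, 0) (L, H)) (\<lambda>(x, y). f x y)"
    using cont_ch_imp_cbox[OF assms, of L] by (simp add: case_prod_beta')
  from integral_swap_continuous[OF this] show ?thesis
    by (simp add: rect_int_iterated[OF assms] cbox_interval)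
qed

lemma cont_ch_integral_y:
  assumes "cont_ch H f"
  shows "continuous_on A (\<lambda>x. integral {0..H} (f x))"
proof -
  have "continuous_on (UNIV \<times> cbox 0 H) (\<lambda>(x, y). f x y)"
    using assms by (simp add: cont_ch_def case_prod_beta' cbox_interval)
  from integral_continuous_on_param[OF this] show ?thesis
    by (auto simp: cbox_interval intro: continuous_on_subset)
qed

lemma cont_ch_integral_x:
  assumes "cont_ch H f"
  shows "continuous_on {0..H} (\<lambda>y. integral {0..L} (\<lambda>x. f x y))"
proof -
  have "continuous_on ({0..H} \<times> cbox 0 L) (\<lambda>(y, x). f x y)"
    unfolding case_prod_beta'
    by (rule continuous_on_compose2[OF assms[unfolded cont_ch_def], of _ "\<lambda>z. (snd z, fst z)", simplified])
     (auto intro!: continuous_intros simp: cbox_interval)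
  from integral_continuous_on_param[OF this] show ?thesis
    by (auto simp: cbox_interval)
qed

lemma rect_int_Cauchy_Schwarz:
  assumes "cont_ch H f" "cont_ch H g"
  shows "(rect_int L H (\<lambda>x y. f x y * g x y))\<^sup>2 \<le> rect_int L H (\<lambda>x y. (f x y)\<^sup>2) * rect_int L H (\<lambda>x y. (g x y)\<^sup>2)"
proof -
  let ?A = "rect_int L H (\<lambda>x y. (f x y)\<^sup>2)" and ?B = "rect_int L H (\<lambda>x y. f x y * g x y)"
    and ?C = "rect_int L H (\<lambda>x y. (g x y)\<^sup>2)"
  have q: "0 \<le> s\<^sup>2 * ?A + 2 * s * ?B + ?C" for s
  proof -
    have "0 \<le> rect_int L H (\<lambda>x y. (s * f x y + g x y)\<^sup>2)"
      by (intro rect_int_nonneg cont_ch_intros assms) simp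
    also have "\<dots> = rect_int L H (\<lambda>x y. s\<^sup>2 * (f x y)\<^sup>2 + ((2 * s) * (f x y * g x y) + (g x y)\<^sup>2))"
      by (rule rect_int_cong) (simp add: power2_eq_square algebra_simps)
    also have "\<dots> = s\<^sup>2 * ?A + (2 * s * ?B + ?C)"
      using assms by (simp add: rect_int_add rect_int_cmult cont_ch_intros)
    finally show ?thesis by simp
  qed
  have A0: "?A \<ge> 0" by (intro rect_int_nonneg cont_ch_intros assms) simp
  show ?thesis
  proof (cases "?A = 0")
    case True
    have "?B = 0"
    proof (rule ccontr)
      assume "?B \<noteq> 0"
      \<comment> \<open>With \<open>?A = 0\<close> the quadratic is affine in \<open>s\<close>; this
        \<open>s\<close> would give it the value -1.\<close>
      have "0 \<le> 2 * (- (?C + 1) / (2 * ?B)) * ?B + ?C" using q[of "- (?C + 1) / (2 * ?B)"] True by simp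
      then show False using \<open>?B \<noteq> 0\<close> by (simp add: field_simps)
    qed
    then show ?thesis using True by simp
  next
    case False
    then have Ap: "?A > 0" using A0 by simp
    \<comment> \<open>The minimiser \<open>s = - ?B / ?A\<close> turns nonnegativity of the
      quadratic into the claim.\<close>
    have "0 \<le> (?B / ?A)\<^sup>2 * ?A + 2 * (- (?B / ?A)) * ?B + ?C" using q[of "- (?B / ?A)"] by simp
    also have "\<dots> = ?C - ?B\<^sup>2 / ?A" using Ap by (simp add: field_simps power2_eq_square)
    finally show ?thesis using Ap by (simp add: field_simps)
  qed
qed

text \<open>\<open>h\<close> is typically built from \<open>deriv\<close>, whose values on the walls
  are arbitrary; the open rectangle of \<open>channel_integral\<close> never sees them, and passing
  to the closed box only adds a null set.\<close>

lemma channel_integral_eq: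
  assumes "cont_ch H f" "\<And>x y. 0 < y \<Longrightarrow> y < H \<Longrightarrow> h x y = f x y"
  shows "channel_integral L H h = rect_int L H f"
proof -
  have box: "{0<..<L} \<times> {0<..<H} = box (0, 0) (L, H)" by (simp add: box_pair_eq box_real)
  let ?f = "\<lambda>z. f (fst z) (snd z)"
  have "channel_integral L H h = (LINT z : box (0, 0) (L, H) | lborel. ?f z)"
    unfolding channel_integral_def box
    by (rule set_lebesgue_integral_cong) (simp, auto simp: box_pair_eq box_real assms(2))
  also have "set_integrable lborel (cbox (0, 0) (L, H)) ?f"
    unfolding set_integrable_def by (rule borel_integrable_compact[OF compact_cbox cont_ch_imp_cbox[OF assms(1)]])
  then have "set_integrable lborel (box (0, 0) (L, H)) ?f"
    by (rule set_integrable_subset) (simp, rule box_subset_cbox)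
  then have "(LINT z : box (0, 0) (L, H) | lborel. ?f z) = integral (box (0, 0) (L, H)) ?f"
    by (rule set_borel_integral_eq_integral)
  also have "\<dots> = rect_int L H f" unfolding rect_int_def by (rule integral_open_interval)
  finally show ?thesis .
qed

lemma rect_int_x_derivative:
  assumes "\<And>x y. y \<in> {0..H} \<Longrightarrow> ((\<lambda>s. f s y) has_real_derivative fx x y) (at x)"
    and "cont_ch H fx" "L \<ge> 0" "\<And>y. y \<in> {0..H} \<Longrightarrow> f L y = f 0 y"
  shows "rect_int L H fx = 0"
proof -
  have "integral {0..L} (\<lambda>x. fx x y) = 0" if "y \<in> {0..H}" for y
  proof -
    have "((\<lambda>x. fx x y) has_integral (f L y - f 0 y)) {0..L}"
      using assms(1)[OF that] \<open>L \<ge> 0\<close>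
      by (intro fundamental_theorem_of_calculus)
         (auto simp: has_real_derivative_iff_has_vector_derivative[symmetric] intro: has_field_derivative_at_within)
    then show ?thesis using assms(4)[OF that] by (simp add: integral_unique)
  qed
  then have "integral {0..H} (\<lambda>y. integral {0..L} (\<lambda>x. fx x y)) = integral {0..H} (\<lambda>y. 0)"
    by (intro integral_cong) auto
  then show ?thesis by (simp add: rect_int_iterated'[OF assms(2)])
qed

lemma rect_int_y_derivative:
  assumes "\<And>x y. y \<in> {0..H} \<Longrightarrow> ((\<lambda>s. f x s) has_real_derivative fy x y) (at y within {0..H})"
    and "cont_ch H fy" "H \<ge> 0"
  shows "rect_int L H fy = integral {0..L} (\<lambda>x. f x H - f x 0)"
proof -
  have "integral {0..H} (fy x) = f x H - f x 0" for x
    using assms(1) \<open>H \<ge> 0\<close>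
      by (intro integral_unique fundamental_theorem_of_calculus)
         (auto simp: has_real_derivative_iff_has_vector_derivative[symmetric])
  then show ?thesis by (simp add: rect_int_iterated[OF assms(2)])
qed

text \<open>By periodicity the end pieces \<open>{0..k}\<close> and \<open>{L..L+k}\<close> (or
  their mirror images for negative \<open>k\<close>) carry equal integrals, whatever the size of
  \<open>k\<close> relative to \<open>L\<close>.\<close>

lemma rect_int_shift:
  assumes "cont_ch H f" "L \<ge> 0" "channel_periodic L H f"
  shows "rect_int L H (\<lambda>x y. f (x + k) y) = rect_int L H f"
proof -
  have "integral {0..L} (\<lambda>x. f (x + k) y) = integral {0..L} (\<lambda>x. f x y)" if y: "y \<in> {0..H}" for y
  proof -
    define h :: "real \<Rightarrow> real" where "h = (\<lambda>x. f x y)"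
    have hc: "continuous_on A h" for A unfolding h_def by (rule cont_ch_imp_x[OF assms(1) y])
    have hp: "h (x + L) = h x" for x using assms(3) y by (simp add: channel_periodic_def h_def)
    have shift: "integral {0..L} (\<lambda>x. h (x + k)) = integral {k..L+k} h"
      using integral_shift_cbox[of k k "L+k" h] by (simp add: cbox_interval)
    have hi: "h integrable_on {u..v}" for u v by (rule integrable_continuous_real[OF hc])
    have sh2: "integral {u..v} h = integral {u+L..v+L} h" for u v
      using integral_shift_cbox[of "u+L" L "v+L" h] hp by (simp add: cbox_interval)
    have "integral {k..L+k} h = integral {0..L} h"
    proof (cases "k \<ge> 0")
      case True
      have 1: "integral {0..k} h + integral {k..L+k} h = integral {0..L+k} h"
        using True assms(2) by (intro Henstock_Kurzweil_Integration.integral_combine hi) auto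
      have 2: "integral {0..L} h + integral {L..L+k} h = integral {0..L+k} h"
        using True assms(2) by (intro Henstock_Kurzweil_Integration.integral_combine hi) auto
      show ?thesis using 1 2 sh2[of 0 k] by (simp add: add.commute[of k])
    next
      case False
      have 1: "integral {k..0} h + integral {0..L} h = integral {k..L} h"
        using False assms(2) by (intro Henstock_Kurzweil_Integration.integral_combine hi) auto
      have 2: "integral {k..L+k} h + integral {L+k..L} h = integral {k..L} h"
        using False assms(2) by (intro Henstock_Kurzweil_Integration.integral_combine hi) auto
      show ?thesis using 1 2 sh2[of k 0] by (simp add: add.commute[of k])
    qed
    with shift show ?thesis by (simp add: h_def)
  qed
  then show ?thesis
    unfolding rect_int_iterated'[OF assms(1)] rect_int_iterated'[OF cont_ch_shift[OF assms(1)]]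
    by (rule integral_cong)
qed

section \<open>Wirtinger and Poincare inequalities\<close>

text \<open>The \<open>y\<close>-derivative is one-sided at the walls, the
  \<open>x\<close>-derivative two-sided. Continuous first partials are what the integrations by
  parts ask for, and they can be verified for functions defined by integrals, such as stream
  functions.\<close>

definition has_partials ::
    "real \<Rightarrow> (real \<Rightarrow> real \<Rightarrow> real) \<Rightarrow> (real \<Rightarrow> real \<Rightarrow> real) \<Rightarrow> (real \<Rightarrow> real \<Rightarrow> real) \<Rightarrow> bool" where
  "has_partials H f fx fy \<longleftrightarrow> cont_ch H f \<and> cont_ch H fx \<and> cont_ch H fy \<and>
     (\<forall>x. \<forall>y\<in>{0..H}. ((\<lambda>s. f s y) has_real_derivative fx x y) (at x) \<and>
        ((\<lambda>s. f x s) has_real_derivative fy x y) (at y within {0..H}))"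

lemma rect_int_mono_x:
  assumes "cont_ch H f" "cont_ch H g"
    "\<And>y. y \<in> {0..H} \<Longrightarrow> integral {0..L} (\<lambda>x. f x y) \<le> integral {0..L} (\<lambda>x. g x y)"
  shows "rect_int L H f \<le> rect_int L H g"
  unfolding rect_int_iterated'[OF assms(1)] rect_int_iterated'[OF assms(2)]
  by (rule integral_le) (use assms in \<open>auto intro!: integrable_continuous_real cont_ch_integral_x\<close>)

lemma rect_int_mono_y:
  assumes "cont_ch H f" "cont_ch H g"
    "\<And>x. integral {0..H} (f x) \<le> integral {0..H} (g x)"
  shows "rect_int L H f \<le> rect_int L H g"
  unfolding rect_int_iterated[OF assms(1)] rect_int_iterated[OF assms(2)]
  by (rule integral_le) (use assms in \<open>auto intro!: integrable_continuous_real cont_ch_integral_y\<close>)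

text \<open>
  The integrand \<open>f'\<^sup>2 - k\<^sup>2 f\<^sup>2\<close> is the perfect square \<open>(f' + k tan(k(x - m)) f)\<^sup>2\<close> minus the derivative of
  \<open>k tan(k(x - m)) f\<^sup>2\<close>.
\<close>

lemma wirtinger_with_boundary:
  fixes f f' :: "real \<Rightarrow> real"
  assumes "p \<le> q" and k: "\<And>x. x \<in> {p..q} \<Longrightarrow> \<bar>k * (x - m)\<bar> < pi / 2"
    and f: "\<And>x. x \<in> {p..q} \<Longrightarrow> (f has_real_derivative f' x) (at x within {p..q})"
    and f': "continuous_on {p..q} f'"
  shows "k\<^sup>2 * integral {p..q} (\<lambda>x. (f x)\<^sup>2) + k * tan (k * (p - m)) * (f p)\<^sup>2
     \<le> integral {p..q} (\<lambda>x. (f' x)\<^sup>2) + k * tan (k * (q - m)) * (f q)\<^sup>2"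
proof -
  have cpos: "cos (k * (x - m)) > 0" if "x \<in> {p..q}" for x
    using k[OF that] by (intro cos_gt_zero_pi) auto
  have fc: "continuous_on {p..q} f" using f by (rule DERIV_continuous_on)
  define G where "G = (\<lambda>x. k * tan (k * (x - m)) * (f x)\<^sup>2)"
  define G' where "G' = (\<lambda>x. k\<^sup>2 * (1 + (tan (k * (x - m)))\<^sup>2) * (f x)\<^sup>2 + 2 * k * tan (k * (x - m)) * f x * f' x)"
  have "(G has_real_derivative G' x) (at x within {p..q})" if x: "x \<in> {p..q}" for x
  proof -
    have c: "cos (k * (x - m)) \<noteq> 0" using cpos[OF x] by simp
    have "inverse ((cos (k * (x - m)))\<^sup>2) = 1 + (tan (k * (x - m)))\<^sup>2"
      using tan_sec[OF c] by (simp add: power_inverse)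
    with c show ?thesis unfolding G_def G'_def
      by (auto intro!: derivative_eq_intros f x simp: power2_eq_square algebra_simps)
  qed
  then have "(G' has_integral (G q - G p)) {p..q}"
    using \<open>p \<le> q\<close> by (intro fundamental_theorem_of_calculus)
       (auto simp: has_real_derivative_iff_has_vector_derivative[symmetric])
  moreover have "((\<lambda>x. (f' x)\<^sup>2) has_integral integral {p..q} (\<lambda>x. (f' x)\<^sup>2)) {p..q}"
    by (intro integrable_integral integrable_continuous_real continuous_intros f')
  moreover have "((\<lambda>x. (f x)\<^sup>2) has_integral integral {p..q} (\<lambda>x. (f x)\<^sup>2)) {p..q}"
    by (intro integrable_integral integrable_continuous_real continuous_intros fc)
  ultimately have "((\<lambda>x. ((f' x)\<^sup>2 - k\<^sup>2 * (f x)\<^sup>2) + G' x) has_integral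
      ((integral {p..q} (\<lambda>x. (f' x)\<^sup>2) - k\<^sup>2 * integral {p..q} (\<lambda>x. (f x)\<^sup>2)) + (G q - G p))) {p..q}"
    by (intro has_integral_add has_integral_diff has_integral_mult_right)
  moreover have "(\<lambda>x. ((f' x)\<^sup>2 - k\<^sup>2 * (f x)\<^sup>2) + G' x) = (\<lambda>x. (f' x + k * tan (k * (x - m)) * f x)\<^sup>2)"
    by (simp add: G'_def power2_eq_square algebra_simps)
  ultimately have "((\<lambda>x. (f' x + k * tan (k * (x - m)) * f x)\<^sup>2) has_integral
      ((integral {p..q} (\<lambda>x. (f' x)\<^sup>2) - k\<^sup>2 * integral {p..q} (\<lambda>x. (f x)\<^sup>2)) + (G q - G p))) {p..q}"
    by simp
  then have "0 \<le> (integral {p..q} (\<lambda>x. (f' x)\<^sup>2) - k\<^sup>2 * integral {p..q} (\<lambda>x. (f x)\<^sup>2)) + (G q - G p)"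
    by (rule has_integral_nonneg) simp
  then show ?thesis by (simp add: G_def algebra_simps)
qed

text \<open>At the critical \<open>k\<close> the tangent in \<open>wirtinger_with_boundary\<close>
  becomes infinite at the end points, so the sharp constants are reached as limits of smaller
  ones.\<close>

lemma square_bound_limit:
  fixes K A B :: real
  assumes "K > 0" "\<And>k. 0 < k \<Longrightarrow> k < K \<Longrightarrow> k\<^sup>2 * A \<le> B"
  shows "K\<^sup>2 * A \<le> B"
proof (rule field_le_mult_one_interval)
  fix z :: real assume z: "0 < z" "z < 1"
  have "(sqrt z * K)\<^sup>2 * A \<le> B"
  proof (rule assms(2))
    show "0 < sqrt z * K" using z assms(1) by simp
    have "sqrt z < 1" using z by (simp add: real_sqrt_lt_1_iff)
    then show "sqrt z * K < K" using assms(1) by simp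
  qed
  then show "z * (K\<^sup>2 * A) \<le> B" using z by (simp add: power_mult_distrib algebra_simps)
qed

text \<open>Centring the tangent at the midpoint keeps its argument strictly between
  \<open>- pi / 2\<close> and \<open>pi / 2\<close> for each \<open>k < pi / (b - a)\<close>, and
  the boundary terms vanish with \<open>f\<close>.\<close>

lemma wirtinger_dirichlet:
  fixes f f' :: "real \<Rightarrow> real"
  assumes "a < b" and f: "\<And>x. x \<in> {a..b} \<Longrightarrow> (f has_real_derivative f' x) (at x within {a..b})"
    and f': "continuous_on {a..b} f'" and "f a = 0" "f b = 0"
  shows "(pi / (b - a))\<^sup>2 * integral {a..b} (\<lambda>x. (f x)\<^sup>2) \<le> integral {a..b} (\<lambda>x. (f' x)\<^sup>2)"
proof (rule square_bound_limit)
  show "pi / (b - a) > 0" using \<open>a < b\<close> by simp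
  fix k assume k: "0 < k" "k < pi / (b - a)"
  have "\<bar>k * (x - (a + b) / 2)\<bar> < pi / 2" if "x \<in> {a..b}" for x
  proof -
    have "\<bar>x - (a + b) / 2\<bar> \<le> (b - a) / 2" using that by (auto simp: abs_le_iff field_simps)
    then have "\<bar>k * (x - (a + b) / 2)\<bar> \<le> k * ((b - a) / 2)"
      using k by (simp add: abs_mult)
    also have "\<dots> < pi / 2" using k \<open>a < b\<close> by (simp add: field_simps)
    finally show ?thesis .
  qed
  from wirtinger_with_boundary[OF _ this f f'] show "k\<^sup>2 * integral {a..b} (\<lambda>x. (f x)\<^sup>2) \<le> integral {a..b} (\<lambda>x. (f' x)\<^sup>2)"
    using assms by simp
qed

text \<open>
  Some \<open>a\<close> satisfies \<open>f(a) = f(a + T/2)\<close>, so \<open>f - f(a)\<close> vanishes at the ends of two half periods. Only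
  \<open>f(0) = f(T)\<close> is assumed, so the half period that wraps around \<open>T\<close> is split into two intervals, whose
  boundary terms cancel.
\<close>

lemma wirtinger_periodic:
  fixes f f' :: "real \<Rightarrow> real"
  assumes "T > 0" and f: "\<And>x. x \<in> {0..T} \<Longrightarrow> (f has_real_derivative f' x) (at x within {0..T})"
    and f': "continuous_on {0..T} f'" and per: "f T = f 0" and mean: "integral {0..T} f = 0"
  shows "(2 * pi / T)\<^sup>2 * integral {0..T} (\<lambda>x. (f x)\<^sup>2) \<le> integral {0..T} (\<lambda>x. (f' x)\<^sup>2)"
proof -
  have fc: "continuous_on {0..T} f" using f by (rule DERIV_continuous_on)
  have "\<exists>a\<in>{0..T/2}. f (a + T/2) - f a = 0"
  proof -
    let ?g = "\<lambda>a. f (a + T/2) - f a"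
    have gc: "continuous_on {0..T/2} ?g"
      using \<open>T > 0\<close>
      by (intro continuous_intros continuous_on_compose2[OF fc, of _ "\<lambda>a. a + T/2"] continuous_on_subset[OF fc]) auto
    \<comment> \<open>Moving on by half a period flips the sign of \<open>?g\<close>, which provides
      the sign change for the intermediate value theorem.\<close>
    have gg: "?g (T/2) = - ?g 0" using per by (simp add: field_simps)
    consider "?g 0 \<le> 0" | "?g 0 \<ge> 0" by linarith
    then show ?thesis
    proof cases
      case 1
      then have "?g 0 \<le> 0" "0 \<le> ?g (T/2)" using gg by linarith+
      from IVT'[OF this _ gc] \<open>T > 0\<close> show ?thesis by auto
    next
      case 2
      then have "?g (T/2) \<le> 0" "0 \<le> ?g 0" using gg by linarith+
      from IVT2'[OF this _ gc] \<open>T > 0\<close> show ?thesis by auto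
    qed
  qed
  then obtain a where a: "0 \<le> a" "a \<le> T/2" "f (a + T/2) = f a" by auto
  define h where "h = (\<lambda>x. f x - f a)"
  have h: "(h has_real_derivative f' x) (at x within S)" if "x \<in> S" "S \<subseteq> {0..T}" for x S
  proof -
    have "(f has_real_derivative f' x) (at x within S)"
      using f that by (meson DERIV_subset subsetD)
    then show ?thesis unfolding h_def by (auto intro!: derivative_eq_intros)
  qed
  have hc: "continuous_on {0..T} h" unfolding h_def by (intro continuous_intros fc)
  let ?I = "\<lambda>u v. integral {u..v} (\<lambda>x. (h x)\<^sup>2)" and ?J = "\<lambda>u v. integral {u..v} (\<lambda>x. (f' x)\<^sup>2)"
  have split: "integral {0..T} F = integral {0..a} F + integral {a..a+T/2} F + integral {a+T/2..T} F"
    if "continuous_on {0..T} F" for F :: "real \<Rightarrow> real"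
  proof -
    have i: "F integrable_on {u..v}" if "u \<ge> 0" "v \<le> T" for u v
      by (rule integrable_continuous_real) (rule continuous_on_subset[OF \<open>continuous_on {0..T} F\<close>], use that in auto)
    have "integral {0..a} F + integral {a..T} F = integral {0..T} F"
      using a by (intro Henstock_Kurzweil_Integration.integral_combine i) auto
    moreover have "integral {a..a+T/2} F + integral {a+T/2..T} F = integral {a..T} F"
      using a \<open>T > 0\<close> by (intro Henstock_Kurzweil_Integration.integral_combine i) auto
    ultimately show ?thesis by simp
  qed
  have "(2 * pi / T)\<^sup>2 * ?I 0 T \<le> ?J 0 T"
  proof (rule square_bound_limit)
    show "2 * pi / T > 0" using \<open>T > 0\<close> by simp
    fix k assume k: "0 < k" "k < 2 * pi / T"
    have kb: "\<bar>k * z\<bar> < pi / 2" if "- (T / 4) \<le> z" "z \<le> T / 4" for z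
    proof -
      have "\<bar>k * z\<bar> \<le> k * (T / 4)" using k that by (simp add: abs_mult abs_le_iff)
      also have "\<dots> < pi / 2" using k \<open>T > 0\<close> by (simp add: field_simps)
      finally show ?thesis .
    qed
    \<comment> \<open>The tangents on the three pieces are centred at the midpoints
      \<open>a - T/4\<close>, \<open>a + T/4\<close>, \<open>a + 3*T/4\<close> of half periods. The
      first and last centres differ by the period, so the terms at \<open>0\<close> and
      \<open>T\<close> coincide, and \<open>h\<close> vanishes at the inner end points.\<close>
    have ha: "h a = 0" "h (a + T/2) = 0" "h T = h 0" using a per by (auto simp: h_def)
    have "k\<^sup>2 * ?I 0 a + k * tan (k * (0 - (a - T/4))) * (h 0)\<^sup>2
        \<le> ?J 0 a + k * tan (k * (a - (a - T/4))) * (h a)\<^sup>2"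
      using a \<open>T > 0\<close>
      by (intro wirtinger_with_boundary kb h continuous_on_subset[OF f']) (auto simp: field_simps)
    moreover have "k\<^sup>2 * ?I a (a+T/2) + k * tan (k * (a - (a + T/4))) * (h a)\<^sup>2
        \<le> ?J a (a+T/2) + k * tan (k * ((a+T/2) - (a + T/4))) * (h (a+T/2))\<^sup>2"
      using a \<open>T > 0\<close>
      by (intro wirtinger_with_boundary kb h continuous_on_subset[OF f']) (auto simp: field_simps)
    moreover have "k\<^sup>2 * ?I (a+T/2) T + k * tan (k * ((a+T/2) - (a + 3*T/4))) * (h (a+T/2))\<^sup>2
        \<le> ?J (a+T/2) T + k * tan (k * (T - (a + 3*T/4))) * (h T)\<^sup>2"
      using a \<open>T > 0\<close>
      by (intro wirtinger_with_boundary kb h continuous_on_subset[OF f']) (auto simp: field_simps)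
    moreover have "T - (a + 3*T/4) = 0 - (a - T/4)" by (simp add: field_simps)
    moreover have "?I 0 T = ?I 0 a + ?I a (a+T/2) + ?I (a+T/2) T"
      by (intro split continuous_intros hc)
    moreover have "?J 0 T = ?J 0 a + ?J a (a+T/2) + ?J (a+T/2) T"
      by (intro split continuous_intros f')
    ultimately show "k\<^sup>2 * ?I 0 T \<le> ?J 0 T" using ha by (simp add: distrib_left)
  qed
  \<comment> \<open>Subtracting a constant from a mean-free function can only increase its square
    integral.\<close>
  moreover have "?I 0 T \<ge> integral {0..T} (\<lambda>x. (f x)\<^sup>2)"
  proof -
    have "?I 0 T = integral {0..T} (\<lambda>x. (f x)\<^sup>2 - 2 * f a * f x + (f a)\<^sup>2)"
      by (rule integral_cong) (simp add: h_def power2_eq_square algebra_simps)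
    also have "\<dots> = integral {0..T} (\<lambda>x. (f x)\<^sup>2) - 2 * f a * integral {0..T} f + (f a)\<^sup>2 * T"
      using \<open>T > 0\<close>
      by (simp add: integral_add integral_diff integrable_continuous_real continuous_intros fc)
    finally show ?thesis using mean \<open>T > 0\<close> by simp
  qed
  then have "(2 * pi / T)\<^sup>2 * integral {0..T} (\<lambda>x. (f x)\<^sup>2) \<le> (2 * pi / T)\<^sup>2 * ?I 0 T"
    by (intro mult_left_mono) auto
  ultimately show ?thesis by linarith
qed

lemma leibniz_y:
  assumes "has_partials H f fx fy" "y \<in> {0..H}"
  shows "((\<lambda>y. integral {0..L} (\<lambda>x. f x y)) has_real_derivative integral {0..L} (\<lambda>x. fy x y)) (at y within {0..H})"
proof -
  have c: "cont_ch H f" "cont_ch H fy" using assms by (auto simp: has_partials_def)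
  have "continuous_on ({0..H} \<times> cbox 0 L) (\<lambda>(y, x). fy x y)"
    unfolding case_prod_beta'
    by (rule continuous_on_compose2[OF c(2)[unfolded cont_ch_def], of _ "\<lambda>z. (snd z, fst z)", simplified])
     (auto intro!: continuous_intros simp: cbox_interval)
  moreover have "(\<lambda>x. f x y) integrable_on cbox 0 L" if "y \<in> {0..H}" for y
    using integrable_continuous_real[OF cont_ch_imp_x[OF c(1) that]] by (simp add: cbox_interval)
  ultimately show ?thesis
    using leibniz_rule_field_derivative[of "{0..H}" 0 L "\<lambda>y x. f x y" "\<lambda>y x. fy x y" y] assms
    by (auto simp: has_partials_def cbox_interval)
qed

text \<open>This is \<open>\<Lambda>\<^sub>1\<close> in closed form, as
  \<open>first_eigenvalue_eq\<close> confirms. The first entry belongs to functions of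
  \<open>y\<close> alone, the second to the first Fourier mode in \<open>x\<close> combined with a
  half sine wave in \<open>y\<close>.\<close>

definition poincare_const :: "real \<Rightarrow> real \<Rightarrow> real" where
  "poincare_const L H = min ((2 * pi / H)\<^sup>2) ((2 * pi / L)\<^sup>2 + (pi / H)\<^sup>2)"

text \<open>The row average \<open>m\<close> and the rest \<open>f - m\<close> are orthogonal, and
  so are their \<open>y\<close>-derivatives. The rest has mean zero in each row and vanishes on the
  walls, where \<open>f\<close> and \<open>m\<close> both equal \<open>c\<close>, so it obeys both
  one-dimensional inequalities; \<open>m\<close> is mean-free with equal end values, so it obeys the
  periodic inequality on \<open>{0..H}\<close>.\<close>

lemma poincare_channel:
  assumes LH: "L > 0" "H > 0" and p: "has_partials H f fx fy" and per: "channel_periodic L H f"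
    and bd: "\<And>x. f x 0 = c" "\<And>x. f x H = c" and mean: "rect_int L H f = 0"
  shows "poincare_const L H * rect_int L H (\<lambda>x y. (f x y)\<^sup>2) \<le> rect_int L H (\<lambda>x y. (fx x y)\<^sup>2 + (fy x y)\<^sup>2)"
proof -
  have [cont_ch_intros]: "cont_ch H f" "cont_ch H fx" "cont_ch H fy" using p by (auto simp: has_partials_def)
  define m where "m = (\<lambda>y. integral {0..L} (\<lambda>x. f x y) / L)"
  define m' where "m' = (\<lambda>y. integral {0..L} (\<lambda>x. fy x y) / L)"
  have dm: "(m has_real_derivative m' y) (at y within {0..H})" if "y \<in> {0..H}" for y
    unfolding m_def m'_def by (intro DERIV_cdivide leibniz_y[OF p that])
  have mc: "continuous_on {0..H} m" "continuous_on {0..H} m'"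
    unfolding m_def m'_def using LH by (auto intro!: continuous_intros cont_ch_integral_x cont_ch_intros)
  have [cont_ch_intros]: "cont_ch H (\<lambda>x y. m y)" "cont_ch H (\<lambda>x y. m' y)" by (rule cont_ch_snd mc)+
  have rm: "rect_int L H (\<lambda>x y. b y) = L * integral {0..H} b" if "continuous_on {0..H} b" for b
    using LH by (simp add: rect_int_iterated[OF cont_ch_snd[OF that]])
  have orth: "rect_int L H (\<lambda>x y. (g x y - n y) * b y) = 0"
    if g: "cont_ch H g" and b: "continuous_on {0..H} b" and nd: "n = (\<lambda>y. integral {0..L} (\<lambda>x. g x y) / L)"
      and nc: "continuous_on {0..H} n" for g n b
  proof -
    have "integral {0..L} (\<lambda>x. (g x y - n y) * b y) = 0" if y: "y \<in> {0..H}" for y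
    proof -
      have "integral {0..L} (\<lambda>x. g x y - n y) = integral {0..L} (\<lambda>x. g x y) - L * n y"
        using LH by (subst integral_diff) (auto intro!: integrable_continuous_real cont_ch_imp_x[OF g y])
      then show ?thesis using LH by (simp add: nd)
    qed
    then have "integral {0..H} (\<lambda>y. integral {0..L} (\<lambda>x. (g x y - n y) * b y)) = integral {0..H} (\<lambda>y. 0)"
      by (intro integral_cong)
    then show ?thesis
      by (subst rect_int_iterated') (auto intro!: cont_ch_intros cont_ch_snd g b nc)
  qed
  have dec: "rect_int L H (\<lambda>x y. (g x y)\<^sup>2) = rect_int L H (\<lambda>x y. (g x y - n y)\<^sup>2) + rect_int L H (\<lambda>x y. (n y)\<^sup>2)"
    if g: "cont_ch H g" and nd: "n = (\<lambda>y. integral {0..L} (\<lambda>x. g x y) / L)"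
      and nc: "continuous_on {0..H} n" for g n
  proof -
    have [cont_ch_intros]: "cont_ch H g" "cont_ch H (\<lambda>x y. n y)" by (rule g cont_ch_snd nc)+
    have "rect_int L H (\<lambda>x y. (g x y)\<^sup>2) = rect_int L H (\<lambda>x y. (g x y - n y)\<^sup>2 + (n y)\<^sup>2 + 2 * ((g x y - n y) * n y))"
      by (rule rect_int_cong) (simp add: power2_eq_square algebra_simps)
    also have "\<dots> = rect_int L H (\<lambda>x y. (g x y - n y)\<^sup>2) + rect_int L H (\<lambda>x y. (n y)\<^sup>2) + 2 * rect_int L H (\<lambda>x y. (g x y - n y) * n y)"
      by (simp add: rect_int_add rect_int_cmult cont_ch_intros)
    finally show ?thesis using orth[OF g nc nd nc] by simp
  qed
  let ?R = "rect_int L H (\<lambda>x y. (f x y - m y)\<^sup>2)" and ?M = "rect_int L H (\<lambda>x y. (m y)\<^sup>2)"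
  have x1: "(2 * pi / L)\<^sup>2 * ?R \<le> rect_int L H (\<lambda>x y. (fx x y)\<^sup>2)"
    unfolding rect_int_cmult[symmetric]
  proof (rule rect_int_mono_x, goal_cases)
    case (3 y)
    have "integral {0..L} (\<lambda>x. f x y - m y) = 0"
      using LH by (subst integral_diff)
        (auto intro!: integrable_continuous_real cont_ch_imp_x[OF \<open>cont_ch H f\<close> 3] simp: m_def)
    moreover have "((\<lambda>x. f x y - m y) has_real_derivative fx x y) (at x within {0..L})" for x
    proof -
      have "((\<lambda>s. f s y) has_real_derivative fx x y) (at x)" using p 3 by (auto simp: has_partials_def)
      from DERIV_diff[OF this DERIV_const[of "m y"]] show ?thesis by (simp add: has_field_derivative_at_within)
    qed
    moreover have "f L y = f 0 y" using per 3 by (auto simp: channel_periodic_def dest: spec[of _ 0])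
    ultimately show ?case
      using wirtinger_periodic[of L "\<lambda>x. f x y - m y" "\<lambda>x. fx x y"] LH cont_ch_imp_x[OF \<open>cont_ch H fx\<close> 3]
      by simp
  qed (intro cont_ch_intros)+
  have y1: "(pi / H)\<^sup>2 * ?R \<le> rect_int L H (\<lambda>x y. (fy x y - m' y)\<^sup>2)"
    unfolding rect_int_cmult[symmetric]
  proof (rule rect_int_mono_y, goal_cases)
    case (3 x)
    have "((\<lambda>y. f x y - m y) has_real_derivative fy x y - m' y) (at y within {0..H})" if "y \<in> {0..H}" for y
      using p that dm[OF that] by (auto simp: has_partials_def intro!: DERIV_diff)
    moreover have "continuous_on {0..H} (\<lambda>y. fy x y - m' y)"
      by (rule cont_ch_imp_y[of H "\<lambda>x y. fy x y - m' y"]) (auto intro!: cont_ch_intros)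
    ultimately show ?case
      using wirtinger_dirichlet[of 0 H "\<lambda>y. f x y - m y" "\<lambda>y. fy x y - m' y"] LH bd
      by (simp add: m_def)
  qed (intro cont_ch_intros)+
  have "integral {0..H} m = 0"
    using mean LH by (simp add: rect_int_iterated'[OF \<open>cont_ch H f\<close>] m_def)
  then have "(2 * pi / H)\<^sup>2 * integral {0..H} (\<lambda>y. (m y)\<^sup>2) \<le> integral {0..H} (\<lambda>y. (m' y)\<^sup>2)"
    using LH bd by (intro wirtinger_periodic dm mc) (auto simp: m_def)
  then have y2: "(2 * pi / H)\<^sup>2 * ?M \<le> rect_int L H (\<lambda>x y. (m' y)\<^sup>2)"
    using LH mc by (subst (1 2) rm) (auto intro!: continuous_intros simp: mult.left_commute)
  have R0: "?R \<ge> 0" "?M \<ge> 0" by (intro rect_int_nonneg cont_ch_intros; simp)+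
  have "poincare_const L H * rect_int L H (\<lambda>x y. (f x y)\<^sup>2) = poincare_const L H * ?R + poincare_const L H * ?M"
    by (subst dec[OF \<open>cont_ch H f\<close> m_def mc(1)]) (simp add: distrib_left)
  also have "\<dots> \<le> ((2 * pi / L)\<^sup>2 + (pi / H)\<^sup>2) * ?R + (2 * pi / H)\<^sup>2 * ?M"
    using R0 by (intro add_mono mult_right_mono) (auto simp: poincare_const_def)
  also have "\<dots> \<le> rect_int L H (\<lambda>x y. (fx x y)\<^sup>2) + rect_int L H (\<lambda>x y. (fy x y)\<^sup>2)"
    using x1 y1 y2 dec[OF \<open>cont_ch H fy\<close> m'_def mc(2)] by (simp add: distrib_right)
  also have "\<dots> = rect_int L H (\<lambda>x y. (fx x y)\<^sup>2 + (fy x y)\<^sup>2)"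
    by (rule rect_int_add[symmetric]; intro cont_ch_intros)
  finally show ?thesis .
qed

section \<open>Partial derivatives and the first eigenvalue\<close>

lemma Ck_on_imp_continuous_on: "Ck_on k S f \<Longrightarrow> continuous_on S f"
  by (cases k) (auto intro: has_derivative_continuous_on)

lemma Ck_channel_imp_cont_ch: "Ck_channel k L H f \<Longrightarrow> cont_ch H f"
  unfolding Ck_channel_def cont_ch_def by (auto dest: Ck_on_imp_continuous_on simp: case_prod_beta')

lemma has_partials_x_periodic:
  assumes "has_partials H f fx fy" "channel_periodic L H f"
  shows "channel_periodic L H fx"
  unfolding channel_periodic_def
proof (intro allI ballI)
  fix x y assume y: "y \<in> {0..H}"
  have "((\<lambda>s. f s y) has_real_derivative fx (x + L) y) (at (x + L))"
    using assms(1) y by (auto simp: has_partials_def)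
  then have "((\<lambda>s. f (s + L) y) has_real_derivative fx (x + L) y) (at x)"
    by (simp add: DERIV_shift)
  then have "((\<lambda>s. f s y) has_real_derivative fx (x + L) y) (at x)"
    using assms(2) y by (simp add: channel_periodic_def)
  moreover have "((\<lambda>s. f s y) has_real_derivative fx x y) (at x)"
    using assms(1) y by (auto simp: has_partials_def)
  ultimately show "fx (x + L) y = fx x y" by (rule DERIV_unique)
qed

lemma has_partials_y_periodic:
  assumes "has_partials H f fx fy" "channel_periodic L H f" "H > 0"
  shows "channel_periodic L H fy"
  unfolding channel_periodic_def
proof (intro allI ballI)
  fix x y assume y: "y \<in> {0..H}"
  have "((\<lambda>s. f (x + L) s) has_real_derivative fy (x + L) y) (at y within {0..H})"
    using assms(1) y by (auto simp: has_partials_def)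
  then have "((\<lambda>s. f x s) has_real_derivative fy (x + L) y) (at y within {0..H})"
    by (rule has_field_derivative_transform_within[OF _ zero_less_one y])
       (use assms(2) in \<open>auto simp: channel_periodic_def\<close>)
  moreover have "((\<lambda>s. f x s) has_real_derivative fy x y) (at y within {0..H})"
    using assms(1) y by (auto simp: has_partials_def)
  ultimately show "fy (x + L) y = fy x y"
    unfolding has_real_derivative_iff_has_vector_derivative
    by (rule vector_derivative_unique_within_closed_interval[of 0 H y "f x", unfolded cbox_interval, OF \<open>H > 0\<close> y])
qed

text \<open>On horizontal lines and vertical segments of the closed strip the derivative within the
  strip restricts to a one-variable derivative. The partials are its values on the unit vectors, so
  they inherit \<open>Ck_on k\<close>.\<close>

lemma Ck_channel_SucE:
  assumes "Ck_channel (Suc k) L H f" "H > 0"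
  obtains fx fy where "has_partials H f fx fy" "Ck_channel k L H fx" "Ck_channel k L H fy"
proof -
  let ?S = "UNIV \<times> {0..H}"
  obtain f' where f': "\<And>z. z \<in> ?S \<Longrightarrow> ((\<lambda>(x, y). f x y) has_derivative f' z) (at z within ?S)"
    and Ck: "\<And>v. Ck_on k ?S (\<lambda>z. f' z v)"
    using assms(1) unfolding Ck_channel_def by auto
  define fx where "fx = (\<lambda>x y. f' (x, y) (1, 0))"
  define fy where "fy = (\<lambda>x y. f' (x, y) (0, 1))"
  have dx: "((\<lambda>s. f s y) has_real_derivative fx x y) (at x)" if y: "y \<in> {0..H}" for x y
  proof -
    have "((\<lambda>(x, y). f x y) has_derivative f' (x, y)) (at (x, y) within (\<lambda>s. (s, y)) ` UNIV)"
      by (rule has_derivative_subset[OF f']) (use y in auto)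
    then have "((\<lambda>s. (\<lambda>(x, y). f x y) (s, y)) has_derivative (\<lambda>h. f' (x, y) (h, 0))) (at x)"
      by (intro has_derivative_in_compose[of "\<lambda>s. (s, y)" "\<lambda>h. (h, 0)" x UNIV "\<lambda>(x, y). f x y" "f' (x, y)"])
         (intro derivative_intros)
    moreover have "f' (x, y) (h, 0) = fx x y * h" for h
      using linear_scale[OF has_derivative_linear[OF f'[of "(x, y)"]], of h "(1, 0)"] y
      by (simp add: fx_def mult.commute)
    ultimately show ?thesis by (simp add: has_field_derivative_def)
  qed
  have dy: "((\<lambda>s. f x s) has_real_derivative fy x y) (at y within {0..H})" if y: "y \<in> {0..H}" for x y
  proof -
    have "((\<lambda>(x, y). f x y) has_derivative f' (x, y)) (at (x, y) within (\<lambda>s. (x, s)) ` {0..H})"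
      by (rule has_derivative_subset[OF f']) (use y in auto)
    then have "((\<lambda>s. (\<lambda>(x, y). f x y) (x, s)) has_derivative (\<lambda>h. f' (x, y) (0, h))) (at y within {0..H})"
      by (intro has_derivative_in_compose[of "\<lambda>s. (x, s)" "\<lambda>h. (0, h)" y "{0..H}" "\<lambda>(x, y). f x y" "f' (x, y)"])
         (intro derivative_intros)
    moreover have "f' (x, y) (0, h) = fy x y * h" for h
      using linear_scale[OF has_derivative_linear[OF f'[of "(x, y)"]], of h "(0, 1)"] y
      by (simp add: fy_def mult.commute)
    ultimately show ?thesis by (simp add: has_field_derivative_def)
  qed
  have Ck': "Ck_on k ?S (\<lambda>(x, y). fx x y)" "Ck_on k ?S (\<lambda>(x, y). fy x y)"
    using Ck by (simp_all add: fx_def fy_def case_prod_beta')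
  have p: "has_partials H f fx fy"
    unfolding has_partials_def cont_ch_def
    using dx dy Ck'[THEN Ck_on_imp_continuous_on] Ck_channel_imp_cont_ch[OF assms(1)]
    by (simp add: cont_ch_def case_prod_beta')
  show ?thesis
    by (rule that[OF p]; unfold Ck_channel_def)
       (use Ck' has_partials_x_periodic[OF p] has_partials_y_periodic[OF p _ assms(2)] assms(1) in
        \<open>auto simp: Ck_channel_def\<close>)
qed

lemma Ck_channel_2E:
  assumes "Ck_channel 2 L H f" "H > 0"
  obtains fx fy fxx fxy fyx fyy where "has_partials H f fx fy" "has_partials H fx fxx fxy" "has_partials H fy fyx fyy"
    "channel_periodic L H f" "channel_periodic L H fx" "channel_periodic L H fy"
proof -
  from assms(1) have "Ck_channel (Suc (Suc 0)) L H f" by (simp add: numeral_2_eq_2)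
  from Ck_channel_SucE[OF this assms(2)] obtain fx fy where
    1: "has_partials H f fx fy" "Ck_channel (Suc 0) L H fx" "Ck_channel (Suc 0) L H fy" by blast
  from Ck_channel_SucE[OF 1(2) assms(2)] obtain fxx fxy where 2: "has_partials H fx fxx fxy" by blast
  from Ck_channel_SucE[OF 1(3) assms(2)] obtain fyx fyy where 3: "has_partials H fy fyx fyy" by blast
  show ?thesis by (rule that[OF 1(1) 2 3]) (use assms(1) 1 in \<open>auto simp: Ck_channel_def\<close>)
qed

lemma has_partials_interior_y:
  assumes "has_partials H f fx fy" "0 < y" "y < H"
  shows "((\<lambda>s. f x s) has_real_derivative fy x y) (at y)"
proof -
  have "((\<lambda>s. f x s) has_real_derivative fy x y) (at y within {0..H})"
    using assms by (auto simp: has_partials_def)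
  moreover have "at y within {0..H} = at y"
    using assms(2,3) by (intro at_within_interior) (simp add: interior_atLeastAtMost_real)
  ultimately show ?thesis by simp
qed

lemma has_partials_deriv_x:
  assumes "has_partials H f fx fy" "y \<in> {0..H}"
  shows "deriv (\<lambda>s. f s y) x = fx x y"
  using assms by (intro DERIV_imp_deriv) (auto simp: has_partials_def)

lemma has_partials_deriv_y:
  assumes "has_partials H f fx fy" "0 < y" "y < H"
  shows "deriv (\<lambda>s. f x s) y = fy x y"
  by (rule DERIV_imp_deriv[OF has_partials_interior_y[OF assms]])

lemma laplacian_eq:
  assumes "has_partials H f fx fy" "has_partials H fx fxx fxy" "has_partials H fy fyx fyy" "0 < y" "y < H"
  shows "laplacian f x y = fxx x y + fyy x y"
proof -
  have "deriv (\<lambda>s. f s y) = (\<lambda>s. fx s y)"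
    using has_partials_deriv_x[OF assms(1), of y] assms by auto
  then have "deriv (deriv (\<lambda>s. f s y)) x = fxx x y"
    using has_partials_deriv_x[OF assms(2), of y] assms by auto
  \<comment> \<open>The inner \<open>deriv\<close> is known to agree with \<open>fy\<close> only in
    the open channel, so the second derivative is transferred on the open set
    \<open>{0<..<H}\<close>.\<close>
  moreover have "(deriv (\<lambda>s. f x s) has_real_derivative fyy x y) (at y)"
    by (rule has_field_derivative_transform_within_open[OF has_partials_interior_y[OF assms(3-5)], of "{0<..<H}"])
       (use assms has_partials_deriv_y[OF assms(1)] in auto)
  then have "deriv (deriv (\<lambda>s. f x s)) y = fyy x y" by (rule DERIV_imp_deriv)
  ultimately show ?thesis by (simp add: laplacian_def)
qed

section \<open>Divergence theorem and Green's identity\<close>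

lemma rect_int_divergence:
  assumes "L \<ge> 0" "H \<ge> 0"
    and "\<And>x y. y \<in> {0..H} \<Longrightarrow> ((\<lambda>s. f s y) has_real_derivative fx x y) (at x)"
    and "\<And>x y. y \<in> {0..H} \<Longrightarrow> ((\<lambda>s. g x s) has_real_derivative gy x y) (at y within {0..H})"
    and "cont_ch H fx" "cont_ch H gy" "channel_periodic L H f" "\<And>x. g x 0 = 0" "\<And>x. g x H = 0"
  shows "rect_int L H (\<lambda>x y. fx x y + gy x y) = 0"
proof -
  have "rect_int L H fx = 0"
    by (rule rect_int_x_derivative[OF assms(3)]) (use assms in \<open>auto simp: channel_periodic_def dest: spec[of _ 0]\<close>)
  moreover have "rect_int L H gy = integral {0..L} (\<lambda>x. g x H - g x 0)"
    by (rule rect_int_y_derivative[OF assms(4)]) (use assms in auto)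
  ultimately show ?thesis using assms by (simp add: rect_int_add)
qed

lemma channel_periodic_mult: "channel_periodic L H f \<Longrightarrow> channel_periodic L H g \<Longrightarrow> channel_periodic L H (\<lambda>x y. f x y * g x y)"
  by (simp add: channel_periodic_def)

text \<open>The divergence theorem for \<open>h\<close> times the field \<open>(fx, fy)\<close>.
  Stating it for a field instead of a potential lets it take velocity components of an Euler flow
  directly.\<close>

lemma green_identity:
  assumes LH: "L > 0" "H > 0" and h: "has_partials H h hx hy" and f: "has_partials H fx fxx fxy" "has_partials H fy fyx fyy"
    and per: "channel_periodic L H h" "channel_periodic L H fx"
    and bd: "\<And>x. h x 0 = 0" "\<And>x. h x H = 0"
  shows "rect_int L H (\<lambda>x y. h x y * - (fxx x y + fyy x y)) = rect_int L H (\<lambda>x y. hx x y * fx x y + hy x y * fy x y)"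
proof -
  have [cont_ch_intros]: "cont_ch H h" "cont_ch H hx" "cont_ch H hy" "cont_ch H fx" "cont_ch H fy" "cont_ch H fxx" "cont_ch H fyy"
    using h f by (auto simp: has_partials_def)
  have "rect_int L H (\<lambda>x y. (hx x y * fx x y + fxx x y * h x y) + (hy x y * fy x y + fyy x y * h x y)) = 0"
    using LH h f per bd
    by (intro rect_int_divergence[of L H "\<lambda>x y. h x y * fx x y" _ "\<lambda>x y. h x y * fy x y"] cont_ch_intros channel_periodic_mult DERIV_mult)
       (auto simp: has_partials_def intro!: DERIV_mult)
  also have "(\<lambda>x y. (hx x y * fx x y + fxx x y * h x y) + (hy x y * fy x y + fyy x y * h x y))
      = (\<lambda>x y. (hx x y * fx x y + hy x y * fy x y) - h x y * - (fxx x y + fyy x y))"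
    by (simp add: fun_eq_iff algebra_simps)
  finally show ?thesis by (simp add: rect_int_diff cont_ch_intros)
qed

lemma has_partials_add_const:
  assumes "has_partials H f fx fy"
  shows "has_partials H (\<lambda>x y. f x y + c) fx fy"
  using assms unfolding has_partials_def by (auto intro!: cont_ch_intros derivative_eq_intros)

lemma has_partials_diff:
  assumes "has_partials H f fx fy" "has_partials H g gx gy"
  shows "has_partials H (\<lambda>x y. f x y - g x y) (\<lambda>x y. fx x y - gx x y) (\<lambda>x y. fy x y - gy x y)"
  using assms unfolding has_partials_def by (auto intro!: cont_ch_intros DERIV_diff)

lemma has_partials_shift:
  assumes "has_partials H f fx fy"
  shows "has_partials H (\<lambda>x y. f (x + k) y) (\<lambda>x y. fx (x + k) y) (\<lambda>x y. fy (x + k) y)"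
  using assms unfolding has_partials_def by (auto intro!: cont_ch_shift DERIV_shift[THEN iffD1])

text \<open>One representative \<open>x'\<close> serves all periodic functions and all heights at
  once, so bounds on a cell become global.\<close>

lemma channel_periodic_reduce:
  fixes x L :: real
  assumes "L > 0"
  obtains x' where "x' \<in> {0..L}" "\<And>H f y. channel_periodic L H f \<Longrightarrow> y \<in> {0..H} \<Longrightarrow> f x y = f x' y"
proof
  have "of_int \<lfloor>x / L\<rfloor> * L \<le> x" "x < (of_int \<lfloor>x / L\<rfloor> + 1) * L"
    using floor_divide_lower[OF assms] floor_divide_upper[OF assms] by auto
  then show "x + of_int (- \<lfloor>x / L\<rfloor>) * L \<in> {0..L}" by (simp add: algebra_simps)
  fix H y :: real and f :: "real \<Rightarrow> real \<Rightarrow> real" assume per: "channel_periodic L H f" and y: "y \<in> {0..H}"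
  have n: "f (x + of_nat n * L) y = f x y" for x n
  proof (induction n)
    case (Suc n)
    have "f (x + of_nat (Suc n) * L) y = f ((x + of_nat n * L) + L) y" by (simp add: algebra_simps)
    then show ?case using Suc per y by (simp add: channel_periodic_def)
  qed simp
  have i: "f (x + of_int i * L) y = f x y" for x i
  proof (cases "i \<ge> 0")
    case True
    then show ?thesis using n[of x "nat i"] by simp
  next
    case False
    then show ?thesis using n[of "x + of_int i * L" "nat (- i)"] by simp
  qed
  then show "f x y = f (x + of_int (- \<lfloor>x / L\<rfloor>) * L) y" by (rule sym)
qed

lemma cont_ch_periodic_bounded:
  assumes "cont_ch H f" "channel_periodic L H f" "L > 0"
  obtains B where "B > 0" "\<And>x y. y \<in> {0..H} \<Longrightarrow> \<bar>f x y\<bar> \<le> B"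
proof -
  obtain B where B: "B > 0" "\<And>x y. x \<in> {0..L} \<Longrightarrow> y \<in> {0..H} \<Longrightarrow> \<bar>f x y\<bar> \<le> B"
    using cont_ch_bounded[OF assms(1)] by blast
  have "\<bar>f x y\<bar> \<le> B" if "y \<in> {0..H}" for x y
    using channel_periodic_reduce[OF assms(3), of x] B(2) assms(2) that by metis
  then show ?thesis by (rule that[OF B(1)])
qed

lemma C1_differentiable_on_UNIV_deriv:
  fixes g :: "real \<Rightarrow> real"
  assumes "g C1_differentiable_on UNIV"
  shows "(g has_real_derivative deriv g x) (at x)" "continuous_on UNIV (deriv g)"
proof -
  show "(g has_real_derivative deriv g x) (at x)"
    using assms by (auto simp: C1_differentiable_on_eq DERIV_deriv_iff_real_differentiable)
  have "deriv g = (\<lambda>x. vector_derivative g (at x))"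
    by (rule ext) (use assms in \<open>auto simp: C1_differentiable_on_eq intro!: field_derivative_eq_vector_derivative\<close>)
  then show "continuous_on UNIV (deriv g)" using assms by (simp add: C1_differentiable_on_eq)
qed

text \<open>The eigenvalue equation is tested with \<open>u - c\<close>, which vanishes on the
  walls. The extra term \<open>c * \<Lambda> * u\<close> integrates to zero, so the Dirichlet energy
  is \<open>\<Lambda>\<close> times the square integral, and the Poincare inequality
  applies.\<close>

lemma channel_eigenvalue_ge:
  assumes LH: "L > 0" "H > 0" and ev: "channel_eigenvalue L H \<Lambda>"
  shows "poincare_const L H \<le> \<Lambda>"
proof -
  from ev obtain u where u0: "Ck_channel 2 L H u" "\<exists>x. \<exists>y\<in>{0..H}. u x y \<noteq> 0"
    "\<forall>x. \<forall>y\<in>{0<..<H}. - laplacian u x y = \<Lambda> * u x y" "\<exists>c. \<forall>x. u x 0 = c \<and> u x H = c"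
    "channel_integral L H u = 0" unfolding channel_eigenvalue_def by blast
  obtain c where "\<forall>x. u x 0 = c \<and> u x H = c" using u0(4) by blast
  note u = u0(1,2) u0(3) this[THEN spec, THEN conjunct1] this[THEN spec, THEN conjunct2] u0(5)
  have u3: "\<And>x y. 0 < y \<Longrightarrow> y < H \<Longrightarrow> - laplacian u x y = \<Lambda> * u x y" using u0(3) by auto
  from Ck_channel_2E[OF u(1) LH(2)] obtain ux uy uxx uxy uyx uyy where
    p: "has_partials H u ux uy" "has_partials H ux uxx uxy" "has_partials H uy uyx uyy"
    and per: "channel_periodic L H u" "channel_periodic L H ux" by metis
  have c[cont_ch_intros]: "cont_ch H u" "cont_ch H ux" "cont_ch H uy" "cont_ch H uxx" "cont_ch H uyy"
    using p by (auto simp: has_partials_def)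
  have eq: "- (uxx x y + uyy x y) = \<Lambda> * u x y" if "y \<in> {0..H}" for x y
    by (rule cont_ch_eq_closed[where H = H and f = "\<lambda>x y. - (uxx x y + uyy x y)"])
       (use that LH u3 laplacian_eq[OF p] in \<open>auto intro!: cont_ch_intros\<close>)
  have mean: "rect_int L H u = 0" using u(6) channel_integral_eq[OF c(1)] by simp
  have "rect_int L H (\<lambda>x y. (ux x y)\<^sup>2 + (uy x y)\<^sup>2) = rect_int L H (\<lambda>x y. (u x y - c) * - (uxx x y + uyy x y))"
    using green_identity[OF LH has_partials_add_const[OF p(1), of "- c"] p(2,3) _ per(2)] per(1) u(4,5)
    by (simp add: channel_periodic_def power2_eq_square)
  also have "\<dots> = rect_int L H (\<lambda>x y. \<Lambda> * (u x y)\<^sup>2 - c * \<Lambda> * u x y)"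
    by (rule rect_int_cong) (simp only: eq, simp add: power2_eq_square algebra_simps)
  also have "\<dots> = \<Lambda> * rect_int L H (\<lambda>x y. (u x y)\<^sup>2)"
    using mean by (simp add: rect_int_diff rect_int_cmult cont_ch_intros)
  finally have "poincare_const L H * rect_int L H (\<lambda>x y. (u x y)\<^sup>2) \<le> \<Lambda> * rect_int L H (\<lambda>x y. (u x y)\<^sup>2)"
    using poincare_channel[OF LH p(1) per(1) u(4,5) mean] by simp
  \<comment> \<open>\<open>u\<close> is nonzero somewhere on the strip; periodicity moves such a
    point into the cell of integration.\<close>
  moreover have "rect_int L H (\<lambda>x y. (u x y)\<^sup>2) > 0"
  proof (rule ccontr)
    assume "\<not> ?thesis"
    then have "\<And>x y. x \<in> {0..L} \<Longrightarrow> y \<in> {0..H} \<Longrightarrow> (u x y)\<^sup>2 = 0"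
      using rect_int_eq_0D[of H "\<lambda>x y. (u x y)\<^sup>2" L] LH by (auto intro!: cont_ch_intros)
    then have z: "u x y = 0" if "x \<in> {0..L}" "y \<in> {0..H}" for x y using that by simp
    obtain x y where xy: "y \<in> {0..H}" "u x y \<noteq> 0" using u(2) by blast
    obtain x' where x': "x' \<in> {0..L}" "\<And>H f y. channel_periodic L H f \<Longrightarrow> y \<in> {0..H} \<Longrightarrow> f x y = f x' y"
      using channel_periodic_reduce[OF LH(1)] by metis
    show False using z[OF x'(1) xy(1)] x'(2)[OF per(1) xy(1)] xy(2) by simp
  qed
  ultimately show ?thesis by simp
qed

section \<open>Explicit eigenfunctions\<close>

lemma Ck_on_add: "Ck_on k S f \<Longrightarrow> Ck_on k S g \<Longrightarrow> Ck_on k S (\<lambda>x. f x + g x)"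
proof (induction k arbitrary: f g)
  case (Suc k)
  obtain f' g' where "\<forall>x\<in>S. (f has_derivative f' x) (at x within S)" "\<forall>v. Ck_on k S (\<lambda>x. f' x v)"
    "\<forall>x\<in>S. (g has_derivative g' x) (at x within S)" "\<forall>v. Ck_on k S (\<lambda>x. g' x v)"
    using Suc.prems by auto
  then show ?case using Suc.IH
    by (auto intro!: exI[of _ "\<lambda>x h. f' x h + g' x h"] has_derivative_add)
qed (auto intro: continuous_on_add)

lemma Ck_on_cmult: "Ck_on k S f \<Longrightarrow> Ck_on k S (\<lambda>x. c * f x)"
proof (induction k arbitrary: f)
  case (Suc k)
  obtain f' where "\<forall>x\<in>S. (f has_derivative f' x) (at x within S)" "\<forall>v. Ck_on k S (\<lambda>x. f' x v)"
    using Suc.prems by auto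
  then show ?case using Suc.IH
    by (auto intro!: exI[of _ "\<lambda>x h. c * f' x h"] has_derivative_mult_right)
qed (auto intro: continuous_on_mult_left)

text \<open>Differentiation shifts a phase by \<open>pi/2\<close>, so the family with free phases is
  closed under it up to linear combinations; hence the induction over all \<open>b\<close> and
  \<open>d\<close>, and hence cosines written as shifted sines.\<close>

lemma Ck_on_sin_sin: "Ck_on k S (\<lambda>(x, y). sin (a * x + b) * sin (c * y + d))"
proof (induction k arbitrary: b d)
  case 0
  show ?case by (auto simp: case_prod_beta' intro!: continuous_intros)
next
  case (Suc k)
  let ?f' = "\<lambda>z v. (a * fst v) * (\<lambda>(x, y). sin (a * x + (b + pi/2)) * sin (c * y + d)) z
     + (c * snd v) * (\<lambda>(x, y). sin (a * x + b) * sin (c * y + (d + pi/2))) z"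
  have s: "sin (t + (r + pi/2)) = cos (t + r)" for t r :: real
    using sin_cos_eq[of "t + (r + pi/2)"] by (simp add: cos_minus sin_add[of "t + r" "pi/2", simplified] add.assoc[symmetric])
  have "((\<lambda>(x, y). sin (a * x + b) * sin (c * y + d)) has_derivative ?f' z) (at z within S)" for z
    unfolding case_prod_beta' s
    by (auto intro!: derivative_eq_intros simp: algebra_simps)
  then show ?case using Ck_on_add[OF Ck_on_cmult[OF Suc.IH] Ck_on_cmult[OF Suc.IH]]
    by (auto intro!: exI[of _ ?f'])
qed

lemma laplacian_sin_sin:
  "laplacian (\<lambda>x y. sin (a * x + b) * sin (c * y + d)) x y = - (a\<^sup>2 + c\<^sup>2) * (sin (a * x + b) * sin (c * y + d))"
proof -
  have 1: "deriv (\<lambda>s. sin (a * s + b) * k) = (\<lambda>s. a * cos (a * s + b) * k)" for a b k :: real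
    by (rule ext, rule DERIV_imp_deriv) (auto intro!: derivative_eq_intros)
  have 2: "deriv (\<lambda>s. a * cos (a * s + b) * k) s = - a\<^sup>2 * (sin (a * s + b) * k)" for a b k s :: real
    by (rule DERIV_imp_deriv) (auto intro!: derivative_eq_intros simp: power2_eq_square)
  have 3: "deriv (\<lambda>s. k * sin (a * s + b)) = (\<lambda>s. k * (a * cos (a * s + b)))" for a b k :: real
    by (rule ext, rule DERIV_imp_deriv) (auto intro!: derivative_eq_intros)
  have 4: "deriv (\<lambda>s. k * (a * cos (a * s + b))) s = - a\<^sup>2 * (k * sin (a * s + b))" for a b k s :: real
    by (rule DERIV_imp_deriv) (auto intro!: derivative_eq_intros simp: power2_eq_square)
  show ?thesis unfolding laplacian_def 1 2 3 4
    by (simp add: algebra_simps)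
qed

lemma channel_eigenvalue_sin_sin:
  assumes LH: "L > 0" "H > 0" and per: "\<And>x. sin (a * (x + L) + b) = sin (a * x + b)"
    and bd: "\<And>x. sin (a * x + b) * sin d = e" "\<And>x. sin (a * x + b) * sin (c * H + d) = e"
    and mean: "rect_int L H (\<lambda>x y. sin (a * x + b) * sin (c * y + d)) = 0"
    and nz: "\<exists>x. \<exists>y\<in>{0..H}. sin (a * x + b) * sin (c * y + d) \<noteq> 0"
  shows "channel_eigenvalue L H (a\<^sup>2 + c\<^sup>2)"
  unfolding channel_eigenvalue_def
proof (intro exI[of _ "\<lambda>x y. sin (a * x + b) * sin (c * y + d)"] conjI)
  show k: "Ck_channel 2 L H (\<lambda>x y. sin (a * x + b) * sin (c * y + d))"
    using per Ck_on_sin_sin[of 2] by (auto simp: Ck_channel_def channel_periodic_def)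
  show "channel_integral L H (\<lambda>x y. sin (a * x + b) * sin (c * y + d)) = 0"
    using channel_integral_eq[OF Ck_channel_imp_cont_ch[OF k], of "\<lambda>x y. sin (a * x + b) * sin (c * y + d)" L] mean by simp
  show "\<forall>x. \<forall>y\<in>{0<..<H}. - laplacian (\<lambda>x y. sin (a * x + b) * sin (c * y + d)) x y =
      (a\<^sup>2 + c\<^sup>2) * (sin (a * x + b) * sin (c * y + d))"
    by (simp add: laplacian_sin_sin distrib_right left_diff_distrib)
qed (use bd nz in auto)

lemma first_eigenvalue_eq:
  assumes LH: "L > 0" "H > 0"
  shows "first_eigenvalue L H = poincare_const L H"
  unfolding first_eigenvalue_def
proof (rule Least_equality)
  \<comment> \<open>At \<open>y = H\<close> the shifted argument is a full turn past
    \<open>pi/2\<close>; the simplifier normalises it to \<open>5 * pi / 2\<close>.\<close>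
  have "cos (2 * pi + pi / 2) = 0" "sin (2 * pi + pi / 2) = 1"
    by (subst cos_add, simp) (subst sin_add, simp)
  then have c5: "cos (5 * pi / 2) = 0" "sin (5 * pi / 2) = 1" by simp_all
  \<comment> \<open>The product is \<open>cos (2 * pi * y / H)\<close>, with the common wall value
    1.\<close>
  have "channel_eigenvalue L H (0\<^sup>2 + (2 * pi / H)\<^sup>2)"
  proof (rule channel_eigenvalue_sin_sin[OF LH, where b = "pi/2" and d = "pi/2" and e = 1])
    have "((\<lambda>y. sin (2 * pi / H * y + pi/2)) has_integral
        (- cos (2 * pi / H * H + pi/2) / (2 * pi / H) - (- cos (2 * pi / H * 0 + pi/2) / (2 * pi / H)))) {0..H}"
      using LH by (intro fundamental_theorem_of_calculus)
        (auto intro!: derivative_eq_intros simp: has_real_derivative_iff_has_vector_derivative[symmetric])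
    then have "integral {0..H} (\<lambda>y. sin (2 * pi / H * y + pi/2)) = 0"
      using LH c5(1) by (simp add: integral_unique)
    moreover have "cont_ch H (\<lambda>x y. sin (2 * pi / H * y + pi/2))"
      using LH by (intro cont_ch_snd continuous_intros) auto
    ultimately show "rect_int L H (\<lambda>x y. sin (0 * x + pi/2) * sin (2 * pi / H * y + pi/2)) = 0"
      by (simp add: rect_int_iterated)
    show "\<exists>x. \<exists>y\<in>{0..H}. sin (0 * x + pi / 2) * sin (2 * pi / H * y + pi / 2) \<noteq> 0"
      using LH by (auto intro!: bexI[of _ 0])
  qed (use LH c5 in auto)
  \<comment> \<open>The product is \<open>sin (2 * pi * x / L) * sin (pi * y / H)\<close>, with wall
    value 0.\<close>
  moreover have "channel_eigenvalue L H ((2 * pi / L)\<^sup>2 + (pi / H)\<^sup>2)"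
  proof (rule channel_eigenvalue_sin_sin[OF LH, where b = "0" and d = "0" and e = 0])
    have i: "integral {0..L} (\<lambda>x. sin (2 * pi / L * x + 0) * k) = 0" for k
    proof -
      have "((\<lambda>x. sin (2 * pi / L * x + 0) * k) has_integral
          (- cos (2 * pi / L * L) / (2 * pi / L) * k - (- cos (2 * pi / L * 0) / (2 * pi / L) * k))) {0..L}"
        using LH by (intro fundamental_theorem_of_calculus)
          (auto intro!: derivative_eq_intros simp: has_real_derivative_iff_has_vector_derivative[symmetric])
      from integral_unique[OF this] show ?thesis using LH by simp
    qed
    have "cont_ch H (\<lambda>x y. sin (2 * pi / L * x + 0) * sin (pi / H * y + 0))"
      using LH unfolding cont_ch_def by (auto intro!: continuous_intros)
    then show "rect_int L H (\<lambda>x y. sin (2 * pi / L * x + 0) * sin (pi / H * y + 0)) = 0"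
      by (simp only: rect_int_iterated' i) simp
    show "\<exists>x. \<exists>y\<in>{0..H}. sin (2 * pi / L * x + 0) * sin (pi / H * y + 0) \<noteq> 0"
      using LH by (auto intro!: exI[of _ "L/4"] bexI[of _ "H/2"])
  qed (use LH in \<open>auto simp: sin_add distrib_left\<close>)
  ultimately show "channel_eigenvalue L H (poincare_const L H)"
    by (auto simp: poincare_const_def min_def)
next
  fix \<Lambda> assume "channel_eigenvalue L H \<Lambda>"
  then show "poincare_const L H \<le> \<Lambda>" by (rule channel_eigenvalue_ge[OF LH])
qed

section \<open>Rigidity of the semilinear problem\<close>

text \<open>The mean value theorem consults \<open>g'\<close> between \<open>a\<close> and
  \<open>b\<close>; connectedness of \<open>S\<close> supplies the bound there when it is known only
  on the values taken by some function.\<close>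

lemma connected_slope_bound:
  fixes g g' :: "real \<Rightarrow> real"
  assumes "connected S" "\<And>s. s \<in> S \<Longrightarrow> g' s \<le> \<Lambda>" "\<And>s. (g has_real_derivative g' s) (at s)"
    and "a \<in> S" "b \<in> S"
  shows "(a - b) * (g a - g b) \<le> \<Lambda> * (a - b)\<^sup>2"
proof -
  have *: "(a - b) * (g a - g b) \<le> \<Lambda> * (a - b)\<^sup>2" if "b < a" "a \<in> S" "b \<in> S" for a b
  proof -
    obtain z where z: "b < z" "z < a" "g a - g b = (a - b) * g' z"
      using MVT2[OF \<open>b < a\<close>, of g g'] assms(3) by blast
    have "z \<in> S" using connectedD_interval[OF assms(1) that(3,2)] z by simp
    then have "g' z \<le> \<Lambda>" by (rule assms(2))
    then have "g' z * (a - b)\<^sup>2 \<le> \<Lambda> * (a - b)\<^sup>2" by (rule mult_right_mono) simp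
    then show ?thesis by (simp add: z(3) power2_eq_square algebra_simps)
  qed
  show ?thesis
  proof (cases a b rule: linorder_cases)
    case less
    from *[OF less assms(5,4)] show ?thesis by (simp add: power2_eq_square algebra_simps)
  next
    case greater
    from *[OF greater assms(4,5)] show ?thesis .
  qed simp
qed

lemma channel_periodic_shift:
  assumes "channel_periodic L H f"
  shows "channel_periodic L H (\<lambda>x y. f (x + k) y)"
  unfolding channel_periodic_def
proof (intro allI ballI)
  fix x y assume "y \<in> {0..H}"
  then have "f ((x + k) + L) y = f (x + k) y" using assms by (simp add: channel_periodic_def)
  then show "f (x + L + k) y = f (x + k) y" by (simp add: ac_simps)
qed

lemma channel_periodic_diff:
  "channel_periodic L H f \<Longrightarrow> channel_periodic L H g \<Longrightarrow> channel_periodic L H (\<lambda>x y. f x y - g x y)"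
  by (simp add: channel_periodic_def)

text \<open>A shift in \<open>x\<close> leaves \<open>c * y\<close> alone, so at a fixed height the
  two arguments of \<open>g\<close> lie in the range of \<open>\<psi> x y - c * y\<close> over one
  row. This range is connected, which turns the pointwise bound on \<open>g'\<close> into a bound of
  \<open>d * q\<close> by \<open>\<Lambda>\<close> times the square of \<open>d\<close>.\<close>

lemma semilinear_solution_x_independent:
  fixes g g' :: "real \<Rightarrow> real"
  assumes LH: "L > 0" "H > 0"
    and p: "has_partials H \<psi> \<psi>x \<psi>y" "has_partials H \<psi>x \<psi>xx \<psi>xy" "has_partials H \<psi>y \<psi>yx \<psi>yy"
    and per: "channel_periodic L H \<psi>" "channel_periodic L H \<psi>x"
    and eq: "\<And>x y. y \<in> {0..H} \<Longrightarrow> - (\<psi>xx x y + \<psi>yy x y) = g (\<psi> x y - c * y)"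
    and g: "\<And>s. (g has_real_derivative g' s) (at s)"
    and bd: "\<And>x. \<psi> x 0 = a" "\<And>x. \<psi> x H = b"
    and g'le: "\<And>x y. y \<in> {0..H} \<Longrightarrow> g' (\<psi> x y - c * y) \<le> \<Lambda>" and "\<Lambda> < poincare_const L H"
    and y: "y \<in> {0..H}"
  shows "\<psi> x y = \<psi> 0 y"
proof -
  note pd = has_partials_diff[OF has_partials_shift[OF p(1), of x] p(1)]
    has_partials_diff[OF has_partials_shift[OF p(2), of x] p(2)]
    has_partials_diff[OF has_partials_shift[OF p(3), of x] p(3)]
  define d where "d = (\<lambda>s y. \<psi> (s + x) y - \<psi> s y)"
  define q where "q = (\<lambda>s y. - ((\<psi>xx (s + x) y - \<psi>xx s y) + (\<psi>yy (s + x) y - \<psi>yy s y)))"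
  define e where "e = (\<lambda>s y. (\<psi>x (s + x) y - \<psi>x s y)\<^sup>2 + (\<psi>y (s + x) y - \<psi>y s y)\<^sup>2)"
  have perd: "channel_periodic L H d" "channel_periodic L H (\<lambda>s y. \<psi>x (s + x) y - \<psi>x s y)"
    unfolding d_def by (intro channel_periodic_diff channel_periodic_shift per)+
  have pdd: "has_partials H d (\<lambda>s y. \<psi>x (s + x) y - \<psi>x s y) (\<lambda>s y. \<psi>y (s + x) y - \<psi>y s y)"
    unfolding d_def by (rule pd(1))
  have cd: "cont_ch H d" "cont_ch H q"
    using p p[THEN has_partials_shift[where k = x]] unfolding has_partials_def d_def q_def
    by (simp_all add: cont_ch_intros)
  have d0: "d s 0 = 0" "d s H = 0" for s using bd by (auto simp: d_def)
  have mean: "rect_int L H d = 0"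
    using rect_int_shift[of H \<psi> L x] p(1) LH per cd unfolding d_def
    by (simp add: rect_int_diff cont_ch_shift has_partials_def)
  have ct: "continuous_on UNIV (\<lambda>s. \<psi> s y - c * y)" if "y \<in> {0..H}" for y
    using p(1) that by (intro continuous_on_diff continuous_on_const cont_ch_imp_x[of H \<psi>]) (auto simp: has_partials_def)
  have pt: "d s y * q s y \<le> \<Lambda> * (d s y)\<^sup>2" if y: "y \<in> {0..H}" for s y
  proof -
    have "q s y = g (\<psi> (s + x) y - c * y) - g (\<psi> s y - c * y)"
      using eq[OF y, of s] eq[OF y, of "s + x"] by (simp add: q_def)
    moreover have "connected (range (\<lambda>s. \<psi> s y - c * y))"
      by (rule connected_continuous_image[OF ct[OF y] connected_UNIV])
    ultimately show ?thesis
      using connected_slope_bound[of "range (\<lambda>s. \<psi> s y - c * y)" g' \<Lambda> g "\<psi> (s + x) y - c * y" "\<psi> s y - c * y"] g g'le[OF y]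
      by (auto simp: d_def)
  qed
  have "poincare_const L H * rect_int L H (\<lambda>x y. (d x y)\<^sup>2) \<le> rect_int L H e"
    unfolding e_def by (rule poincare_channel[OF LH pdd perd(1) d0 mean])
  also have "rect_int L H e = rect_int L H (\<lambda>x y. d x y * q x y)"
    using green_identity[OF LH pdd pd(2,3) perd d0] by (simp add: e_def q_def power2_eq_square)
  also have "\<dots> \<le> rect_int L H (\<lambda>x y. \<Lambda> * (d x y)\<^sup>2)"
    by (rule rect_int_mono) (use pt cd in \<open>auto intro!: cont_ch_intros\<close>)
  finally have "(poincare_const L H - \<Lambda>) * rect_int L H (\<lambda>x y. (d x y)\<^sup>2) \<le> 0"
    by (simp add: rect_int_cmult algebra_simps)
  then have "rect_int L H (\<lambda>x y. (d x y)\<^sup>2) \<le> 0"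
    using \<open>\<Lambda> < poincare_const L H\<close> by (simp add: mult_le_0_iff)
  \<comment> \<open>The shift is the given \<open>x\<close> itself, so the value at the left edge of
    the cell is already the claim.\<close>
  then have "(d 0 y)\<^sup>2 = 0"
    using LH y cd by (intro rect_int_eq_0D[of H "\<lambda>x y. (d x y)\<^sup>2" L]) (auto intro!: cont_ch_intros)
  then show ?thesis by (simp add: d_def)
qed

section \<open>Conservation laws of Euler flows\<close>

definition cont_tc :: "real \<Rightarrow> (real \<Rightarrow> real \<Rightarrow> real \<Rightarrow> real) \<Rightarrow> bool" where
  "cont_tc H f \<longleftrightarrow> continuous_on (UNIV \<times> UNIV \<times> {0..H}) (\<lambda>z. f (fst z) (fst (snd z)) (snd (snd z)))"

named_theorems cont_tc_intros

lemma cont_tc_add [cont_tc_intros]: "cont_tc H f \<Longrightarrow> cont_tc H g \<Longrightarrow> cont_tc H (\<lambda>t x y. f t x y + g t x y)"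
  and cont_tc_diff [cont_tc_intros]: "cont_tc H f \<Longrightarrow> cont_tc H g \<Longrightarrow> cont_tc H (\<lambda>t x y. f t x y - g t x y)"
  and cont_tc_mult [cont_tc_intros]: "cont_tc H f \<Longrightarrow> cont_tc H g \<Longrightarrow> cont_tc H (\<lambda>t x y. f t x y * g t x y)"
  and cont_tc_const [cont_tc_intros]: "cont_tc H (\<lambda>t x y. k)"
  unfolding cont_tc_def by (auto intro!: continuous_intros)

lemma cont_tc_compose:
  assumes "cont_tc H f" "continuous_on UNIV h"
  shows "cont_tc H (\<lambda>t x y. h (f t x y))"
  using assms unfolding cont_tc_def
  by (auto intro: continuous_on_compose2[of UNIV h])

lemma cont_tc_imp_cont_ch:
  assumes "cont_tc H f"
  shows "cont_ch H (f t)"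
  unfolding cont_ch_def
  by (rule continuous_on_compose2[OF assms[unfolded cont_tc_def], of _ "\<lambda>z. (t, z)", simplified])
     (auto intro!: continuous_intros)

lemma Ck_time_channel_imp_cont_tc: "Ck_time_channel k L H f \<Longrightarrow> cont_tc H f"
  unfolding Ck_time_channel_def cont_tc_def by (auto dest: Ck_on_imp_continuous_on simp: case_prod_beta')

lemma Ck_time_channel_SucE:
  assumes "Ck_time_channel (Suc k) L H f" "H > 0"
  obtains ft fx fy where "\<And>t. has_partials H (f t) (fx t) (fy t)"
    "\<And>t x y. y \<in> {0..H} \<Longrightarrow> ((\<lambda>s. f s x y) has_real_derivative ft t x y) (at t)"
    "Ck_time_channel k L H ft" "Ck_time_channel k L H fx" "Ck_time_channel k L H fy"
proof -
  let ?S = "UNIV \<times> UNIV \<times> {0..H} :: (real \<times> real \<times> real) set"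
  let ?F = "\<lambda>(t, x, y). f t x y"
  obtain f' where f': "\<And>z. z \<in> ?S \<Longrightarrow> (?F has_derivative f' z) (at z within ?S)"
    and Ck: "\<And>v. Ck_on k ?S (\<lambda>z. f' z v)"
    using assms(1) unfolding Ck_time_channel_def Ck_on.simps by blast
  define ft where "ft = (\<lambda>t x y. f' (t, x, y) (1, 0, 0))"
  define fx where "fx = (\<lambda>t x y. f' (t, x, y) (0, 1, 0))"
  define fy where "fy = (\<lambda>t x y. f' (t, x, y) (0, 0, 1))"
  have lin: "f' (t, x, y) (h *\<^sub>R v) = f' (t, x, y) v * h" if "y \<in> {0..H}" for t x y h v
    using linear_scale[OF has_derivative_linear[OF f'[of "(t, x, y)"]], of h v] that by (simp add: mult.commute)
  have dt: "((\<lambda>s. f s x y) has_real_derivative ft t x y) (at t)" if y: "y \<in> {0..H}" for t x y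
  proof -
    have "(?F has_derivative f' (t, x, y)) (at (t, x, y) within (\<lambda>s. (s, x, y)) ` UNIV)"
      by (rule has_derivative_subset[OF f']) (use y in auto)
    then have "((\<lambda>s. ?F (s, x, y)) has_derivative (\<lambda>h. f' (t, x, y) (h, 0, 0))) (at t)"
      by (intro has_derivative_in_compose[of "\<lambda>s. (s, x, y)" "\<lambda>h. (h, 0, 0)" t UNIV ?F "f' (t, x, y)"])
         (intro derivative_intros has_derivative_Pair has_derivative_const, simp add: zero_prod_def[symmetric])
    moreover have "f' (t, x, y) (h, 0, 0) = ft t x y * h" for h
      using lin[OF y, of t x h "(1, 0, 0)"] by (simp add: ft_def)
    ultimately show ?thesis by (simp add: has_field_derivative_def)
  qed
  have dx: "((\<lambda>s. f t s y) has_real_derivative fx t x y) (at x)" if y: "y \<in> {0..H}" for t x y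
  proof -
    have "(?F has_derivative f' (t, x, y)) (at (t, x, y) within (\<lambda>s. (t, s, y)) ` UNIV)"
      by (rule has_derivative_subset[OF f']) (use y in auto)
    then have "((\<lambda>s. ?F (t, s, y)) has_derivative (\<lambda>h. f' (t, x, y) (0, h, 0))) (at x)"
      by (intro has_derivative_in_compose[of "\<lambda>s. (t, s, y)" "\<lambda>h. (0, h, 0)" x UNIV ?F "f' (t, x, y)"])
         (intro derivative_intros)
    moreover have "f' (t, x, y) (0, h, 0) = fx t x y * h" for h
      using lin[OF y, of t x h "(0, 1, 0)"] by (simp add: fx_def)
    ultimately show ?thesis by (simp add: has_field_derivative_def)
  qed
  have dy: "((\<lambda>s. f t x s) has_real_derivative fy t x y) (at y within {0..H})" if y: "y \<in> {0..H}" for t x y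
  proof -
    have "(?F has_derivative f' (t, x, y)) (at (t, x, y) within (\<lambda>s. (t, x, s)) ` {0..H})"
      by (rule has_derivative_subset[OF f']) (use y in auto)
    then have "((\<lambda>s. ?F (t, x, s)) has_derivative (\<lambda>h. f' (t, x, y) (0, 0, h))) (at y within {0..H})"
      by (intro has_derivative_in_compose[of "\<lambda>s. (t, x, s)" "\<lambda>h. (0, 0, h)" y "{0..H}" ?F "f' (t, x, y)"])
         (intro derivative_intros)
    moreover have "f' (t, x, y) (0, 0, h) = fy t x y * h" for h
      using lin[OF y, of t x h "(0, 0, 1)"] by (simp add: fy_def)
    ultimately show ?thesis by (simp add: has_field_derivative_def)
  qed
  have Ck': "Ck_on k ?S (\<lambda>(t, x, y). ft t x y)" "Ck_on k ?S (\<lambda>(t, x, y). fx t x y)" "Ck_on k ?S (\<lambda>(t, x, y). fy t x y)"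
    using Ck by (simp_all add: ft_def fx_def fy_def case_prod_beta')
  then have c3: "cont_tc H fx" "cont_tc H fy"
    by (auto simp: cont_tc_def case_prod_beta' dest!: Ck_on_imp_continuous_on)
  have per: "channel_periodic L H (f t)" for t using assms(1) by (auto simp: Ck_time_channel_def)
  have p: "has_partials H (f t) (fx t) (fy t)" for t
    unfolding has_partials_def using dx dy c3 Ck_time_channel_imp_cont_tc[OF assms(1)]
    by (auto intro: cont_tc_imp_cont_ch)
  have pt: "channel_periodic L H (ft t)" for t
    unfolding channel_periodic_def
  proof (intro allI ballI)
    fix x y assume y: "y \<in> {0..H}"
    have "(\<lambda>s. f s (x + L) y) = (\<lambda>s. f s x y)" using per y by (auto simp: channel_periodic_def)
    then show "ft t (x + L) y = ft t x y" using dt[OF y, of "x + L" t] dt[OF y, of x t] by (auto intro: DERIV_unique)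
  qed
  show ?thesis
  proof (rule that)
    show "has_partials H (f t) (fx t) (fy t)" for t by (rule p)
    show "((\<lambda>s. f s x y) has_real_derivative ft t x y) (at t)" if "y \<in> {0..H}" for t x y by (rule dt[OF that])
  qed (use Ck' pt has_partials_x_periodic[OF p per] has_partials_y_periodic[OF p per assms(2)] in
    \<open>auto simp: Ck_time_channel_def\<close>)
qed

lemma rect_int_time_derivative:
  assumes "cont_tc H f" "cont_tc H ft"
    "\<And>t x y. y \<in> {0..H} \<Longrightarrow> ((\<lambda>s. f s x y) has_real_derivative ft t x y) (at t)"
  shows "((\<lambda>t. rect_int L H (f t)) has_real_derivative rect_int L H (ft t)) (at t)"
  unfolding rect_int_def
proof (rule leibniz_rule_field_derivative[where U = UNIV and f = "\<lambda>t z. f t (fst z) (snd z)" and fx = "\<lambda>t z. ft t (fst z) (snd z)"])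
  show "((\<lambda>t. f t (fst z) (snd z)) has_real_derivative ft t (fst z) (snd z)) (at t)"
    if "z \<in> cbox (0, 0) (L, H)" for t z using assms(3) that by (auto simp: cbox_Pair_eq)
  show "(\<lambda>z. f t (fst z) (snd z)) integrable_on cbox (0, 0) (L, H)" for t
    by (rule cont_ch_integrable[OF cont_tc_imp_cont_ch[OF assms(1)]])
  show "continuous_on (UNIV \<times> cbox (0, 0) (L, H)) (\<lambda>(t, z). ft t (fst z) (snd z))"
    using assms(2) unfolding cont_tc_def case_prod_beta' by (rule continuous_on_subset) (auto simp: cbox_Pair_eq)
qed auto

lemma rect_int_time_constant:
  assumes "cont_tc H f" "cont_tc H ft"
    "\<And>t x y. y \<in> {0..H} \<Longrightarrow> ((\<lambda>s. f s x y) has_real_derivative ft t x y) (at t)"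
    "\<And>t. rect_int L H (ft t) = 0"
  shows "rect_int L H (f t) = rect_int L H (f 0)"
proof -
  have "((\<lambda>t. rect_int L H (f t)) has_real_derivative 0) (at t)" for t
    using rect_int_time_derivative[OF assms(1-3), of L t] assms(4) by simp
  then show ?thesis by (intro DERIV_isconst_all) simp
qed

text \<open>
  The pressure is only \<open>C\<^sup>1\<close> by assumption, so the symmetry of its mixed derivatives, which the vorticity
  equation needs, has to come from the existence and continuity of both of them.
\<close>

lemma clairaut:
  assumes p: "has_partials H f fx fy" and cxy: "cont_ch H fxy" "cont_ch H fyx" and "H > 0"
    and dxy: "\<And>x y. y \<in> {0..H} \<Longrightarrow> ((\<lambda>s. fx x s) has_real_derivative fxy x y) (at y within {0..H})"
    and dyx: "\<And>x y. y \<in> {0..H} \<Longrightarrow> ((\<lambda>s. fy s y) has_real_derivative fyx x y) (at x)"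
    and y: "y \<in> {0..H}"
  shows "fxy x y = fyx x y"
proof -
  have c: "cont_ch H f" "cont_ch H fx" "cont_ch H fy" using p by (auto simp: has_partials_def)
  have f: "f x r = f x 0 + integral {0..r} (fy x)" if "r \<in> {0..H}" for x r
  proof -
    have "(fy x has_integral f x r - f x 0) {0..r}"
      using p that by (intro fundamental_theorem_of_calculus)
        (auto simp: has_partials_def has_real_derivative_iff_has_vector_derivative[symmetric]
          intro: DERIV_subset[of _ _ _ "{0..H}"])
    then show ?thesis by (simp add: integral_unique)
  qed
  \<comment> \<open>Differentiating the integral representation of \<open>f\<close> in
    \<open>x\<close> expresses \<open>fx\<close> as an integral of \<open>fyx\<close> from the wall;
    its \<open>y\<close>-derivative is then both \<open>fxy\<close> and \<open>fyx\<close>.\<close>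
  have fx: "fx x r = fx x 0 + integral {0..r} (fyx x)" if r: "r \<in> {0..H}" for r
  proof -
    have "((\<lambda>x. integral (cbox 0 r) (fy x)) has_real_derivative integral (cbox 0 r) (fyx x)) (at x)"
    proof (rule leibniz_rule_field_derivative[where U = UNIV])
      show "((\<lambda>x. fy x s) has_real_derivative fyx x s) (at x)" if "s \<in> cbox 0 r" for x s
        using dyx r that by auto
      show "fy x integrable_on cbox 0 r" for x
        using r by (auto intro!: integrable_continuous_real cont_ch_imp_y[OF c(3)])
      show "continuous_on (UNIV \<times> cbox 0 r) (\<lambda>(x, s). fyx x s)"
        using cxy(2) unfolding cont_ch_def case_prod_beta' by (rule continuous_on_subset) (use r in auto)
    qed auto
    moreover have "((\<lambda>x. f x 0) has_real_derivative fx x 0) (at x)"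
      using p \<open>H > 0\<close> by (auto simp: has_partials_def)
    ultimately have "((\<lambda>x. f x 0 + integral {0..r} (fy x)) has_real_derivative fx x 0 + integral {0..r} (fyx x)) (at x)"
      by (intro DERIV_add) (auto simp: cbox_interval)
    then have "((\<lambda>x. f x r) has_real_derivative fx x 0 + integral {0..r} (fyx x)) (at x)"
      using f[OF r] by simp
    moreover have "((\<lambda>x. f x r) has_real_derivative fx x r) (at x)"
      using p r by (auto simp: has_partials_def)
    ultimately show ?thesis by (rule DERIV_unique[THEN sym])
  qed
  have "((\<lambda>r. integral {0..r} (fyx x)) has_real_derivative fyx x y) (at y within {0..H})"
    by (rule integral_has_real_derivative[OF cont_ch_imp_y[OF cxy(2)] y]) simp
  then have "((\<lambda>r. fx x 0 + integral {0..r} (fyx x)) has_real_derivative fyx x y) (at y within {0..H})"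
    by (auto intro!: derivative_eq_intros)
  then have "((\<lambda>r. fx x r) has_real_derivative fyx x y) (at y within {0..H})"
    by (rule has_field_derivative_transform_within[OF _ zero_less_one y]) (metis fx)
  with dxy[OF y, of x] show ?thesis
    unfolding has_real_derivative_iff_has_vector_derivative
    by (rule vector_derivative_unique_within_closed_interval[of 0 H y "fx x", unfolded cbox_interval, OF \<open>H > 0\<close> y])
qed

lemma cont_tc_eq_closed:
  assumes "cont_tc H f" "cont_tc H g" "H > 0" "\<And>t x y. 0 < y \<Longrightarrow> y < H \<Longrightarrow> f t x y = g t x y" "y \<in> {0..H}"
  shows "f t x y = g t x y"
  by (rule cont_ch_eq_closed[OF cont_tc_imp_cont_ch[OF assms(1)] cont_tc_imp_cont_ch[OF assms(2)] assms(3)])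
     (use assms in auto)

lemma Ck_time_channel_2E:
  assumes "Ck_time_channel 2 L H f" "H > 0"
  obtains fx fy ft ftx fty fxx fxy fyx fyy fxt fyt where
    "\<And>t. has_partials H (f t) (fx t) (fy t)" "\<And>t. has_partials H (ft t) (ftx t) (fty t)"
    "\<And>t. has_partials H (fx t) (fxx t) (fxy t)" "\<And>t. has_partials H (fy t) (fyx t) (fyy t)"
    "\<And>t x y. y \<in> {0..H} \<Longrightarrow> ((\<lambda>s. f s x y) has_real_derivative ft t x y) (at t)"
    "\<And>t x y. y \<in> {0..H} \<Longrightarrow> ((\<lambda>s. fx s x y) has_real_derivative fxt t x y) (at t)"
    "\<And>t x y. y \<in> {0..H} \<Longrightarrow> ((\<lambda>s. fy s x y) has_real_derivative fyt t x y) (at t)"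
    "cont_tc H f" "cont_tc H ft" "cont_tc H fx" "cont_tc H fy"
    "cont_tc H ftx" "cont_tc H fty" "cont_tc H fxt" "cont_tc H fxx" "cont_tc H fxy" "cont_tc H fyt" "cont_tc H fyx" "cont_tc H fyy"
    "\<And>t. channel_periodic L H (f t)" "\<And>t. channel_periodic L H (fx t)" "\<And>t. channel_periodic L H (fy t)"
proof -
  from assms(1) have 0: "Ck_time_channel (Suc (Suc 0)) L H f" by (simp add: numeral_2_eq_2)
  from Ck_time_channel_SucE[OF 0 assms(2)] obtain ft fx fy where
    1: "\<And>t. has_partials H (f t) (fx t) (fy t)"
    "\<And>t x y. y \<in> {0..H} \<Longrightarrow> ((\<lambda>s. f s x y) has_real_derivative ft t x y) (at t)"
    "Ck_time_channel (Suc 0) L H ft" "Ck_time_channel (Suc 0) L H fx" "Ck_time_channel (Suc 0) L H fy"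
    by metis
  from Ck_time_channel_SucE[OF 1(3) assms(2)] obtain ftt ftx fty where
    2: "\<And>t. has_partials H (ft t) (ftx t) (fty t)" "Ck_time_channel 0 L H ftx" "Ck_time_channel 0 L H fty"
    by metis
  from Ck_time_channel_SucE[OF 1(4) assms(2)] obtain fxt fxx fxy where
    3: "\<And>t. has_partials H (fx t) (fxx t) (fxy t)"
    "\<And>t x y. y \<in> {0..H} \<Longrightarrow> ((\<lambda>s. fx s x y) has_real_derivative fxt t x y) (at t)"
    "Ck_time_channel 0 L H fxt" "Ck_time_channel 0 L H fxx" "Ck_time_channel 0 L H fxy"
    by metis
  from Ck_time_channel_SucE[OF 1(5) assms(2)] obtain fyt fyx fyy where
    4: "\<And>t. has_partials H (fy t) (fyx t) (fyy t)"
    "\<And>t x y. y \<in> {0..H} \<Longrightarrow> ((\<lambda>s. fy s x y) has_real_derivative fyt t x y) (at t)"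
    "Ck_time_channel 0 L H fyt" "Ck_time_channel 0 L H fyx" "Ck_time_channel 0 L H fyy"
    by metis
  note per = 0[unfolded Ck_time_channel_def, THEN conjunct1, THEN spec] 1(4,5)[unfolded Ck_time_channel_def, THEN conjunct1, THEN spec]
  show ?thesis
    by (rule that[where ft = ft and fx = fx and fy = fy and ftx = ftx and fty = fty and fxt = fxt and fxx = fxx
        and fxy = fxy and fyt = fyt and fyx = fyx and fyy = fyy]; (rule 1(1) 2(1) 3(1) 4(1) per | erule 1(2) 3(2) 4(2)
      | rule Ck_time_channel_imp_cont_tc, rule 0 1(3-5) 2(2,3) 3(3-5) 4(3-5)))
qed

text \<open>Reduction to \<open>clairaut\<close> on a strip of height 1: time is the unbounded
  variable, and \<open>s\<close> in \<open>{0..1}\<close> parametrises the points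
  \<open>s + x\<close>. The wanted point is \<open>s = 0\<close>.\<close>

lemma clairaut_time:
  fixes f ft fx :: "real \<Rightarrow> real \<Rightarrow> real \<Rightarrow> real"
  assumes c: "cont_tc H ftx" "cont_tc H fxt" "cont_tc H f" "cont_tc H ft" "cont_tc H fx" and y: "y \<in> {0..H}"
    and dt: "\<And>t x. ((\<lambda>s. f s x y) has_real_derivative ft t x y) (at t)"
    and dx: "\<And>t x. ((\<lambda>s. f t s y) has_real_derivative fx t x y) (at x)"
    and dtx: "\<And>t x. ((\<lambda>s. ft t s y) has_real_derivative ftx t x y) (at x)"
    and dxt: "\<And>t x. ((\<lambda>s. fx s x y) has_real_derivative fxt t x y) (at t)"
  shows "ftx t x y = fxt t x y"
proof -
  have c2: "cont_ch 1 (\<lambda>t s. q t (s + x) y)" if "cont_tc H q" for q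
    unfolding cont_ch_def
    by (rule continuous_on_compose2[OF that[unfolded cont_tc_def], of _ "\<lambda>z. (fst z, snd z + x, y)", simplified])
       (use y in \<open>auto intro!: continuous_intros\<close>)
  have sh: "((\<lambda>s. q t (s + x) y) has_real_derivative q' t (r + x) y) (at r within A)"
    if "\<And>t x. ((\<lambda>s. q t s y) has_real_derivative q' t x y) (at x)" for q q' t r A
    by (rule has_field_derivative_at_within, rule DERIV_shift[THEN iffD1], rule that)
  have p: "has_partials 1 (\<lambda>t s. f t (s + x) y) (\<lambda>t s. ft t (s + x) y) (\<lambda>t s. fx t (s + x) y)"
    unfolding has_partials_def using c2[OF c(3)] c2[OF c(4)] c2[OF c(5)] dt sh[of f fx, OF dx] by blast
  have "ftx t (0 + x) y = fxt t (0 + x) y"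
    by (rule clairaut[OF p c2[OF c(1)] c2[OF c(2)] zero_less_one, where y = 0]) (auto intro: sh[of ft ftx, OF dtx] dxt)
  then show ?thesis by simp
qed

lemma clairaut_time_y:
  fixes f ft fy :: "real \<Rightarrow> real \<Rightarrow> real \<Rightarrow> real"
  assumes c: "cont_tc H fty" "cont_tc H fyt" "cont_tc H f" "cont_tc H ft" "cont_tc H fy" and y: "y \<in> {0..H}" "H > 0"
    and dt: "\<And>t y. y \<in> {0..H} \<Longrightarrow> ((\<lambda>s. f s x y) has_real_derivative ft t x y) (at t)"
    and dy: "\<And>t y. y \<in> {0..H} \<Longrightarrow> ((\<lambda>s. f t x s) has_real_derivative fy t x y) (at y within {0..H})"
    and dty: "\<And>t y. y \<in> {0..H} \<Longrightarrow> ((\<lambda>s. ft t x s) has_real_derivative fty t x y) (at y within {0..H})"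
    and dyt: "\<And>t y. y \<in> {0..H} \<Longrightarrow> ((\<lambda>s. fy s x y) has_real_derivative fyt t x y) (at t)"
  shows "fty t x y = fyt t x y"
proof -
  have c2: "cont_ch H (\<lambda>t s. q t x s)" if "cont_tc H q" for q
    unfolding cont_ch_def
    by (rule continuous_on_compose2[OF that[unfolded cont_tc_def], of _ "\<lambda>z. (fst z, x, snd z)", simplified])
       (auto intro!: continuous_intros)
  have p: "has_partials H (\<lambda>t s. f t x s) (\<lambda>t s. ft t x s) (\<lambda>t s. fy t x s)"
    unfolding has_partials_def using c2[OF c(3)] c2[OF c(4)] c2[OF c(5)] dt dy by blast
  show ?thesis
    by (rule clairaut[OF p c2[OF c(1)] c2[OF c(2)] y(2) dty dyt y(1)])
qed

text \<open>Casimir functions such as \<open>F\<close> composed with the truncation are merely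
  continuous, while differentiating the integral of \<open>h (\<omega> x y)\<close> in time asks for
  a smooth \<open>h\<close>. Uniform polynomial approximation on an interval containing both ranges
  bridges this.\<close>

lemma polynomial_conservation_imp_continuous:
  assumes LH: "L > 0" "H > 0" and c: "cont_ch H u" "cont_ch H v"
    and per: "channel_periodic L H u" "channel_periodic L H v"
    and poly: "\<And>q. real_polynomial_function q \<Longrightarrow> rect_int L H (\<lambda>x y. q (u x y)) = rect_int L H (\<lambda>x y. q (v x y))"
    and h: "continuous_on UNIV h"
  shows "rect_int L H (\<lambda>x y. h (u x y)) = rect_int L H (\<lambda>x y. h (v x y))"
proof (rule ccontr)
  define D where "D = \<bar>rect_int L H (\<lambda>x y. h (u x y)) - rect_int L H (\<lambda>x y. h (v x y))\<bar>"
  assume "\<not> ?thesis"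
  then have "D > 0" by (simp add: D_def)
  obtain A where A: "\<And>x y. y \<in> {0..H} \<Longrightarrow> \<bar>u x y\<bar> \<le> A" using cont_ch_periodic_bounded[OF c(1) per(1) LH(1)] by metis
  obtain B where B: "\<And>x y. y \<in> {0..H} \<Longrightarrow> \<bar>v x y\<bar> \<le> B" using cont_ch_periodic_bounded[OF c(2) per(2) LH(1)] by metis
  define M where "M = max A B"
  \<comment> \<open>Each of the two approximations costs \<open>e * (L * H) = D / 4\<close>, in
    total half of the assumed gap \<open>D\<close>.\<close>
  define e where "e = D / (4 * (L * H))"
  have "e > 0" using \<open>D > 0\<close> LH by (simp add: e_def)
  obtain q where q: "real_polynomial_function q" "\<And>s. s \<in> {- M..M} \<Longrightarrow> \<bar>h s - q s\<bar> < e"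
    using Stone_Weierstrass_real_polynomial_function[of "{- M..M}" h e] continuous_on_subset[OF h] \<open>e > 0\<close> by auto
  have qc: "continuous_on UNIV q"
    using q(1) by (simp add: continuous_on_polymonial_function real_polynomial_function_eq)
  have close: "\<bar>rect_int L H (\<lambda>x y. h (w x y)) - rect_int L H (\<lambda>x y. q (w x y))\<bar> \<le> e * (L * H)"
    if w: "cont_ch H w" "\<And>x y. y \<in> {0..H} \<Longrightarrow> \<bar>w x y\<bar> \<le> M" for w
  proof -
    have cw: "cont_ch H (\<lambda>x y. h (w x y))" "cont_ch H (\<lambda>x y. q (w x y))"
      by (rule cont_ch_compose[OF w(1)]; fact)+
    have "\<bar>rect_int L H (\<lambda>x y. h (w x y)) - rect_int L H (\<lambda>x y. q (w x y))\<bar> = \<bar>rect_int L H (\<lambda>x y. h (w x y) - q (w x y))\<bar>"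
      by (simp add: rect_int_diff cw)
    also have "\<dots> \<le> rect_int L H (\<lambda>x y. \<bar>h (w x y) - q (w x y)\<bar>)"
      by (rule rect_int_abs_le) (intro cont_ch_intros cw)
    also have "\<dots> \<le> rect_int L H (\<lambda>x y. e)"
    proof (intro rect_int_mono cont_ch_intros cw)
      fix x y assume "y \<in> {0..H}"
      from w(2)[OF this, of x] have "w x y \<in> {- M..M}" by (auto simp: abs_le_iff)
      then show "\<bar>h (w x y) - q (w x y)\<bar> \<le> e" by (rule less_imp_le[OF q(2)])
    qed
    also have "\<dots> = e * (L * H)" using LH by (simp add: rect_int_const)
    finally show ?thesis .
  qed
  have "\<bar>rect_int L H (\<lambda>x y. h (u x y)) - rect_int L H (\<lambda>x y. q (u x y))\<bar> \<le> e * (L * H)"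
    using A c(1) by (intro close) (auto simp: M_def le_max_iff_disj)
  moreover have "\<bar>rect_int L H (\<lambda>x y. h (v x y)) - rect_int L H (\<lambda>x y. q (v x y))\<bar> \<le> e * (L * H)"
    using B c(2) by (intro close) (auto simp: M_def le_max_iff_disj)
  ultimately have "D \<le> 2 * (e * (L * H))" using poly[OF q(1)] by (simp add: D_def)
  also have "\<dots> = D / 2" using LH by (simp add: e_def)
  finally show False using \<open>D > 0\<close> by simp
qed

text \<open>The time derivative of each area integral is minus the integral of the divergence of a
  field without normal component on the walls; the wall circulations obey a one-dimensional
  conservation law. Flux and circulations are recorded because they enter
  \<open>shear_energy_identity\<close>, the circulations with the wall values of
  \<open>\<Psi>\<close>.\<close>

lemma euler_conservation:
  assumes LH: "L > 0" "H > 0" and eu: "euler_flow L H v1 v2 P"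
  obtains v1x v1y v2x v2y where
    "\<And>t. has_partials H (v1 t) (v1x t) (v1y t)" "\<And>t. has_partials H (v2 t) (v2x t) (v2y t)"
    "\<And>t. channel_periodic L H (v1 t)" "\<And>t. channel_periodic L H (v2 t)"
    "\<And>t x y. y \<in> {0..H} \<Longrightarrow> v1x t x y + v2y t x y = 0"
    "\<And>t x. v2 t x 0 = 0" "\<And>t x. v2 t x H = 0"
    "\<And>t. rect_int L H (v1 t) = rect_int L H (v1 0)"
    "\<And>t. rect_int L H (\<lambda>x y. (v1 t x y)\<^sup>2 + (v2 t x y)\<^sup>2) = rect_int L H (\<lambda>x y. (v1 0 x y)\<^sup>2 + (v2 0 x y)\<^sup>2)"
    "\<And>t. integral {0..L} (\<lambda>x. v1 t x 0) = integral {0..L} (\<lambda>x. v1 0 x 0)"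
    "\<And>t. integral {0..L} (\<lambda>x. v1 t x H) = integral {0..L} (\<lambda>x. v1 0 x H)"
    "\<And>t h. continuous_on UNIV h \<Longrightarrow>
       rect_int L H (\<lambda>x y. h (v2x t x y - v1y t x y)) = rect_int L H (\<lambda>x y. h (v2x 0 x y - v1y 0 x y))"
proof -
  have Ck: "Ck_time_channel 2 L H v1" "Ck_time_channel 2 L H v2" "Ck_time_channel (Suc 0) L H P"
    and bd: "\<And>t x. v2 t x 0 = 0" "\<And>t x. v2 t x H = 0"
    and pde: "\<And>t x y. 0 < y \<Longrightarrow> y < H \<Longrightarrow>
        deriv (\<lambda>s. v1 s x y) t + v1 t x y * deriv (\<lambda>s. v1 t s y) x + v2 t x y * deriv (\<lambda>s. v1 t x s) y
          = - deriv (\<lambda>s. P t s y) x"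
      "\<And>t x y. 0 < y \<Longrightarrow> y < H \<Longrightarrow>
        deriv (\<lambda>s. v2 s x y) t + v1 t x y * deriv (\<lambda>s. v2 t s y) x + v2 t x y * deriv (\<lambda>s. v2 t x s) y
          = - deriv (\<lambda>s. P t x s) y"
      "\<And>t x y. 0 < y \<Longrightarrow> y < H \<Longrightarrow> deriv (\<lambda>s. v1 t s y) x + deriv (\<lambda>s. v2 t x s) y = 0"
    using eu unfolding euler_flow_def by (auto simp: One_nat_def)
  obtain v1t v1x v1y v1tx v1ty v1xt v1xx v1xy v1yt v1yx v1yy where
    a: "\<And>t. has_partials H (v1 t) (v1x t) (v1y t)" "\<And>t. has_partials H (v1t t) (v1tx t) (v1ty t)"
    "\<And>t. has_partials H (v1x t) (v1xx t) (v1xy t)" "\<And>t. has_partials H (v1y t) (v1yx t) (v1yy t)"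
    and at: "\<And>t x y. y \<in> {0..H} \<Longrightarrow> ((\<lambda>s. v1 s x y) has_real_derivative v1t t x y) (at t)"
    "\<And>t x y. y \<in> {0..H} \<Longrightarrow> ((\<lambda>s. v1x s x y) has_real_derivative v1xt t x y) (at t)"
    "\<And>t x y. y \<in> {0..H} \<Longrightarrow> ((\<lambda>s. v1y s x y) has_real_derivative v1yt t x y) (at t)"
    and ac [cont_tc_intros]: "cont_tc H v1" "cont_tc H v1t" "cont_tc H v1x" "cont_tc H v1y"
    "cont_tc H v1tx" "cont_tc H v1ty" "cont_tc H v1xt" "cont_tc H v1xx" "cont_tc H v1xy" "cont_tc H v1yt" "cont_tc H v1yx" "cont_tc H v1yy"
    and aper: "\<And>t. channel_periodic L H (v1 t)" "\<And>t. channel_periodic L H (v1x t)" "\<And>t. channel_periodic L H (v1y t)"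
    by (fact Ck_time_channel_2E[OF Ck(1) LH(2)])
  obtain v2t v2x v2y v2tx v2ty v2xt v2xx v2xy v2yt v2yx v2yy where
    b: "\<And>t. has_partials H (v2 t) (v2x t) (v2y t)" "\<And>t. has_partials H (v2t t) (v2tx t) (v2ty t)"
    "\<And>t. has_partials H (v2x t) (v2xx t) (v2xy t)" "\<And>t. has_partials H (v2y t) (v2yx t) (v2yy t)"
    and bt: "\<And>t x y. y \<in> {0..H} \<Longrightarrow> ((\<lambda>s. v2 s x y) has_real_derivative v2t t x y) (at t)"
    "\<And>t x y. y \<in> {0..H} \<Longrightarrow> ((\<lambda>s. v2x s x y) has_real_derivative v2xt t x y) (at t)"
    "\<And>t x y. y \<in> {0..H} \<Longrightarrow> ((\<lambda>s. v2y s x y) has_real_derivative v2yt t x y) (at t)"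
    and bc [cont_tc_intros]: "cont_tc H v2" "cont_tc H v2t" "cont_tc H v2x" "cont_tc H v2y"
    "cont_tc H v2tx" "cont_tc H v2ty" "cont_tc H v2xt" "cont_tc H v2xx" "cont_tc H v2xy" "cont_tc H v2yt" "cont_tc H v2yx" "cont_tc H v2yy"
    and bper: "\<And>t. channel_periodic L H (v2 t)" "\<And>t. channel_periodic L H (v2x t)" "\<And>t. channel_periodic L H (v2y t)"
    by (fact Ck_time_channel_2E[OF Ck(2) LH(2)])
  obtain Pt Px Py where p: "\<And>t. has_partials H (P t) (Px t) (Py t)"
    and pc0: "Ck_time_channel 0 L H Px" "Ck_time_channel 0 L H Py"
    using Ck_time_channel_SucE[OF Ck(3) LH(2)] by metis
  have pper: "\<And>t. channel_periodic L H (P t)" using Ck(3) by (simp add: Ck_time_channel_def)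
  have pc [cont_tc_intros]: "cont_tc H P" "cont_tc H Px" "cont_tc H Py"
    using pc0 Ck(3) by (auto intro: Ck_time_channel_imp_cont_tc)
  have E1: "v1t t x y + v1 t x y * v1x t x y + v2 t x y * v1y t x y + Px t x y = 0" if "y \<in> {0..H}" for t x y
    by (rule cont_tc_eq_closed[OF _ _ LH(2) _ that, where f = "\<lambda>t x y. v1t t x y + v1 t x y * v1x t x y + v2 t x y * v1y t x y + Px t x y" and g = "\<lambda>t x y. 0"])
       (use pde(1) DERIV_imp_deriv[OF at(1)] has_partials_deriv_x[OF a(1)] has_partials_deriv_y[OF a(1)] has_partials_deriv_x[OF p]
        in \<open>auto intro!: cont_tc_intros\<close>)
  have E2: "v2t t x y + v1 t x y * v2x t x y + v2 t x y * v2y t x y + Py t x y = 0" if "y \<in> {0..H}" for t x y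
    by (rule cont_tc_eq_closed[OF _ _ LH(2) _ that, where f = "\<lambda>t x y. v2t t x y + v1 t x y * v2x t x y + v2 t x y * v2y t x y + Py t x y" and g = "\<lambda>t x y. 0"])
       (use pde(2) DERIV_imp_deriv[OF bt(1)] has_partials_deriv_x[OF b(1)] has_partials_deriv_y[OF b(1)] has_partials_deriv_y[OF p]
        in \<open>auto intro!: cont_tc_intros\<close>)
  have E3: "v1x t x y + v2y t x y = 0" if "y \<in> {0..H}" for t x y
    by (rule cont_tc_eq_closed[OF _ _ LH(2) _ that, where f = "\<lambda>t x y. v1x t x y + v2y t x y" and g = "\<lambda>t x y. 0"])
       (use pde(3) has_partials_deriv_x[OF a(1)] has_partials_deriv_y[OF b(1)]
        in \<open>auto intro!: cont_tc_intros\<close>)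
  have dX: "((\<lambda>s. f s y) has_real_derivative fx x y) (at x)" if "has_partials H f fx fy" "y \<in> {0..H}" for f fx fy x y
    using that by (auto simp: has_partials_def)
  have dY: "((\<lambda>s. f x s) has_real_derivative fy x y) (at y within {0..H})" if "has_partials H f fx fy" "y \<in> {0..H}" for f fx fy x y
    using that by (auto simp: has_partials_def)
  note d = dX[OF a(1)] dX[OF a(2)] dX[OF a(3)] dX[OF a(4)] dX[OF b(1)] dX[OF b(2)] dX[OF b(3)] dX[OF b(4)] dX[OF p]
    dY[OF a(1)] dY[OF a(2)] dY[OF a(3)] dY[OF a(4)] dY[OF b(1)] dY[OF b(2)] dY[OF b(3)] dY[OF b(4)] dY[OF p]
  have c1: "v1ty t x y = v1yt t x y" if "y \<in> {0..H}" for t x y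
    by (rule clairaut_time_y[OF ac(6,10,1,2,4) that LH(2)]) (auto intro: at d)
  have c2: "v2tx t x y = v2xt t x y" if "y \<in> {0..H}" for t x y
    by (rule clairaut_time[OF bc(5,7,1,2,3) that]) (use that in \<open>auto intro: bt d\<close>)
  have c3: "v1xy t x y = v1yx t x y" if "y \<in> {0..H}" for t x y
    by (rule clairaut[OF a(1) _ _ LH(2) _ _ that]) (auto intro: cont_tc_imp_cont_ch cont_tc_intros d)
  have c4: "v2xy t x y = v2yx t x y" if "y \<in> {0..H}" for t x y
    by (rule clairaut[OF b(1) _ _ LH(2) _ _ that]) (auto intro: cont_tc_imp_cont_ch cont_tc_intros d)
  \<comment> \<open>\<open>A\<close> and \<open>B\<close> are the \<open>y\<close>- and
    \<open>x\<close>-derivatives of the accelerations in the two momentum equations, so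
    \<open>- A\<close> and \<open>- B\<close> are the two mixed derivatives of the pressure.\<close>
  define A where "A = (\<lambda>t x y. v1ty t x y + (v1y t x y * v1x t x y + v1 t x y * v1xy t x y) + (v2y t x y * v1y t x y + v2 t x y * v1yy t x y))"
  define B where "B = (\<lambda>t x y. v2tx t x y + (v1x t x y * v2x t x y + v1 t x y * v2xx t x y) + (v2x t x y * v2y t x y + v2 t x y * v2yx t x y))"
  have curl: "A t x y = B t x y" if y: "y \<in> {0..H}" for t x y
  proof -
    have "- A t x y = - B t x y"
    proof (rule clairaut[OF p _ _ LH(2) _ _ y, where fxy = "\<lambda>x y. - A t x y" and fyx = "\<lambda>x y. - B t x y"])
      show "cont_ch H (\<lambda>x y. - A t x y)" "cont_ch H (\<lambda>x y. - B t x y)"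
        unfolding A_def B_def by (intro cont_ch_intros ac[THEN cont_tc_imp_cont_ch] bc[THEN cont_tc_imp_cont_ch])+
    next
      fix x y assume y: "y \<in> {0..H}"
      have "((\<lambda>s. - (v1t t x s + v1 t x s * v1x t x s + v2 t x s * v1y t x s)) has_real_derivative - A t x y) (at y within {0..H})"
        unfolding A_def by (rule derivative_eq_intros d[OF y] refl)+ (simp add: algebra_simps)
      then show "((\<lambda>s. Px t x s) has_real_derivative - A t x y) (at y within {0..H})"
        by (rule has_field_derivative_transform_within[OF _ zero_less_one y]) (use E1[of _ t x] in \<open>auto simp: algebra_simps add_eq_0_iff2\<close>)
      have "((\<lambda>s. - (v2t t s y + v1 t s y * v2x t s y + v2 t s y * v2y t s y)) has_real_derivative - B t x y) (at x)"
        unfolding B_def by (rule derivative_eq_intros d[OF y] refl)+ (simp add: algebra_simps)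
      moreover have "(\<lambda>s. - (v2t t s y + v1 t s y * v2x t s y + v2 t s y * v2y t s y)) = (\<lambda>s. Py t s y)"
        using E2[OF y, of t] by (auto simp: fun_eq_iff add_eq_0_iff2 algebra_simps)
      ultimately show "((\<lambda>s. Py t s y) has_real_derivative - B t x y) (at x)" by simp
    qed
    then show ?thesis by simp
  qed
  \<comment> \<open>The difference of the two sides of \<open>curl\<close> is the transport of
    vorticity plus vorticity times divergence.\<close>
  have transport: "(v2xt t x y - v1yt t x y) + v1 t x y * (v2xx t x y - v1yx t x y) + v2 t x y * (v2xy t x y - v1yy t x y) = 0"
    if y: "y \<in> {0..H}" for t x y
  proof -
    have "(v2xt t x y - v1yt t x y) + v1 t x y * (v2xx t x y - v1yx t x y) + v2 t x y * (v2xy t x y - v1yy t x y)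
      = - (v1x t x y + v2y t x y) * (v2x t x y - v1y t x y)"
      using curl[OF y, of t x] c1[OF y, of t x] c2[OF y, of t x] c3[OF y, of t x] c4[OF y, of t x]
      unfolding A_def B_def by (simp add: algebra_simps)
    then show ?thesis using E3[OF y] by simp
  qed
  have mom: "rect_int L H (v1 t) = rect_int L H (v1 0)" for t
  proof (rule rect_int_time_constant[where f = v1 and ft = v1t])
    fix t
    \<comment> \<open>\<open>?D\<close> is the divergence of
      \<open>(v1\<^sup>2 + P, v1 * v2)\<close>.\<close>
    have "rect_int L H (\<lambda>x y. (v1x t x y * v1 t x y + v1x t x y * v1 t x y + Px t x y) + (v1y t x y * v2 t x y + v2y t x y * v1 t x y)) = 0"
      (is "rect_int L H ?D = 0")
      using LH
      by (intro rect_int_divergence[where f = "\<lambda>x y. v1 t x y * v1 t x y + P t x y" and g = "\<lambda>x y. v1 t x y * v2 t x y"]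
          DERIV_add DERIV_mult d cont_ch_intros ac[THEN cont_tc_imp_cont_ch] bc[THEN cont_tc_imp_cont_ch] pc[THEN cont_tc_imp_cont_ch])
         (use aper pper bd in \<open>auto simp: channel_periodic_def\<close>)
    moreover have "rect_int L H (v1t t) = rect_int L H (\<lambda>x y. - ?D x y)"
    proof (rule rect_int_cong)
      fix x y assume y: "y \<in> {0..H}"
      have "v2y t x y = - v1x t x y" using E3[OF y, of t x] by simp
      then show "v1t t x y = - ?D x y"
        using E1[OF y, of t x] by (simp add: algebra_simps)
    qed
    ultimately show "rect_int L H (v1t t) = 0" by (simp only: rect_int_minus minus_zero)
  qed (intro cont_tc_intros at; assumption)+
  have energy: "rect_int L H (\<lambda>x y. (v1 t x y)\<^sup>2 + (v2 t x y)\<^sup>2) = rect_int L H (\<lambda>x y. (v1 0 x y)\<^sup>2 + (v2 0 x y)\<^sup>2)" for t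
  proof (rule rect_int_time_constant[where f = "\<lambda>t x y. (v1 t x y)\<^sup>2 + (v2 t x y)\<^sup>2" and ft = "\<lambda>t x y. 2 * (v1 t x y * v1t t x y) + 2 * (v2 t x y * v2t t x y)"])
    fix t
    \<comment> \<open>Twice the Bernoulli function: the flux of
      \<open>v1\<^sup>2 + v2\<^sup>2\<close> is \<open>?q\<close> times the velocity.\<close>
    let ?q = "\<lambda>x y. v1 t x y * v1 t x y + v2 t x y * v2 t x y + 2 * P t x y"
    let ?qx = "\<lambda>x y. (v1x t x y * v1 t x y + v1x t x y * v1 t x y) + (v2x t x y * v2 t x y + v2x t x y * v2 t x y) + 2 * Px t x y"
    let ?qy = "\<lambda>x y. (v1y t x y * v1 t x y + v1y t x y * v1 t x y) + (v2y t x y * v2 t x y + v2y t x y * v2 t x y) + 2 * Py t x y"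
    have "rect_int L H (\<lambda>x y. (v1x t x y * ?q x y + ?qx x y * v1 t x y) + (v2y t x y * ?q x y + ?qy x y * v2 t x y)) = 0"
      (is "rect_int L H ?D = 0")
      using LH
      by (intro rect_int_divergence[where f = "\<lambda>x y. v1 t x y * ?q x y" and g = "\<lambda>x y. v2 t x y * ?q x y"]
          DERIV_add DERIV_mult DERIV_cmult d cont_ch_intros ac[THEN cont_tc_imp_cont_ch] bc[THEN cont_tc_imp_cont_ch] pc[THEN cont_tc_imp_cont_ch])
         (use aper bper pper bd in \<open>auto simp: channel_periodic_def\<close>)
    moreover have "rect_int L H (\<lambda>x y. 2 * (v1 t x y * v1t t x y) + 2 * (v2 t x y * v2t t x y)) =
        rect_int L H (\<lambda>x y. - ?D x y)"
    proof (rule rect_int_cong)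
      fix x y assume y: "y \<in> {0..H}"
      have 3: "v2y t x y = - v1x t x y" using E3[OF y, of t x] by simp
      have 1: "v1t t x y = - (v1 t x y * v1x t x y + v2 t x y * v1y t x y + Px t x y)" using E1[OF y, of t x] by linarith
      have 2: "v2t t x y = - (v1 t x y * v2x t x y + v2 t x y * v2y t x y + Py t x y)" using E2[OF y, of t x] by linarith
      show "2 * (v1 t x y * v1t t x y) + 2 * (v2 t x y * v2t t x y) = - ?D x y"
        unfolding 1 2 3 by (simp add: algebra_simps)
    qed
    ultimately show "rect_int L H (\<lambda>x y. 2 * (v1 t x y * v1t t x y) + 2 * (v2 t x y * v2t t x y)) = 0" by (simp only: rect_int_minus minus_zero)
  next
    show "cont_tc H (\<lambda>t x y. (v1 t x y)\<^sup>2 + (v2 t x y)\<^sup>2)" unfolding power2_eq_square by (intro cont_tc_intros)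
    show "cont_tc H (\<lambda>t x y. 2 * (v1 t x y * v1t t x y) + 2 * (v2 t x y * v2t t x y))" by (intro cont_tc_intros)
    show "((\<lambda>s. (v1 s x y)\<^sup>2 + (v2 s x y)\<^sup>2) has_real_derivative 2 * (v1 t x y * v1t t x y) + 2 * (v2 t x y * v2t t x y)) (at t)"
      if "y \<in> {0..H}" for t x y
      by (rule derivative_eq_intros at[OF that] bt[OF that] refl)+ simp
  qed
  \<comment> \<open>On a wall \<open>v2\<close> vanishes, so \<open>v1t\<close> is minus the
    \<open>x\<close>-derivative of \<open>v1\<^sup>2 / 2 + P\<close>, which integrates to zero over
    a period.\<close>
  have circ: "integral {0..L} (\<lambda>x. v1 t x y) = integral {0..L} (\<lambda>x. v1 0 x y)" if y: "y = 0 \<or> y = H" for t y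
  proof -
    have yH: "y \<in> {0..H}" and v20: "v2 t x y = 0" for t x using y LH bd by auto
    have cc: "continuous_on (UNIV \<times> S) (\<lambda>(t, x). q t x y)" if "cont_tc H q" for q S
      unfolding case_prod_beta'
      by (rule continuous_on_compose2[OF that[unfolded cont_tc_def], of _ "\<lambda>z. (fst z, snd z, y)", simplified])
         (use yH in \<open>auto intro!: continuous_intros\<close>)
    have "integral {0..L} (\<lambda>x. v1t t x y) = 0" for t
    proof -
      have "((\<lambda>x. - (v1x t x y * v1 t x y + Px t x y)) has_integral
          (- ((v1 t L y)\<^sup>2 / 2 + P t L y) - - ((v1 t 0 y)\<^sup>2 / 2 + P t 0 y))) {0..L}"
      proof (rule fundamental_theorem_of_calculus)
        show "((\<lambda>x. - ((v1 t x y)\<^sup>2 / 2 + P t x y)) has_vector_derivative - (v1x t x y * v1 t x y + Px t x y)) (at x within {0..L})" for x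
          unfolding has_real_derivative_iff_has_vector_derivative[symmetric]
          by (rule has_field_derivative_at_within, rule DERIV_minus)
             (use dX[OF a(1) yH, of t x] dX[OF p yH, of t x] in \<open>auto intro!: derivative_eq_intros\<close>)
      qed (use LH in simp)
      moreover have "v1 t L y = v1 t 0 y" "P t L y = P t 0 y"
        using aper(1)[of t] pper[of t] yH by (auto simp: channel_periodic_def dest: spec[of _ 0])
      moreover have "(\<lambda>x. - (v1x t x y * v1 t x y + Px t x y)) = (\<lambda>x. v1t t x y)"
        using E1[OF yH, of t] v20 by (auto simp: fun_eq_iff algebra_simps add_eq_0_iff2)
      ultimately show ?thesis by (simp add: integral_unique)
    qed
    moreover have "((\<lambda>t. integral (cbox 0 L) (\<lambda>x. v1 t x y)) has_real_derivative integral (cbox 0 L) (\<lambda>x. v1t t x y)) (at t)" for t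
    proof (rule leibniz_rule_field_derivative[where U = UNIV])
      show "(\<lambda>x. v1 t x y) integrable_on cbox 0 L" for t
        by (simp add: cbox_interval) (intro integrable_continuous_real cont_ch_imp_x[OF cont_tc_imp_cont_ch[OF ac(1)] yH])
    qed (auto intro: at[OF yH] cc ac)
    ultimately have "((\<lambda>t. integral {0..L} (\<lambda>x. v1 t x y)) has_real_derivative 0) (at t)" for t
      by (simp add: cbox_interval)
    then show ?thesis by (intro DERIV_isconst_all[of "\<lambda>t. integral {0..L} (\<lambda>x. v1 t x y)"]) simp
  qed
  have poly: "rect_int L H (\<lambda>x y. q (v2x t x y - v1y t x y)) = rect_int L H (\<lambda>x y. q (v2x 0 x y - v1y 0 x y))"
    if q: "real_polynomial_function q" for q t
  proof -
    obtain q' where q': "real_polynomial_function q'" "\<And>x. (q has_real_derivative q' x) (at x)"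
      using has_real_derivative_polynomial_function[OF q] by blast
    have qc: "continuous_on UNIV q" "continuous_on UNIV q'"
      using q q'(1) by (simp_all add: continuous_on_polymonial_function real_polynomial_function_eq)
    have cw: "cont_tc H (\<lambda>t x y. v2x t x y - v1y t x y)" by (intro cont_tc_intros)
    note [cont_tc_intros] = cont_tc_compose[OF cw qc(1)] cont_tc_compose[OF cw qc(2)]
    let ?w = "\<lambda>t x y. v2x t x y - v1y t x y"
    note dq = DERIV_chain2[OF q'(2)]
    show ?thesis
    proof (rule rect_int_time_constant[where f = "\<lambda>t x y. q (?w t x y)" and ft = "\<lambda>t x y. q' (?w t x y) * (v2xt t x y - v1yt t x y)"])
      fix t
      \<comment> \<open>\<open>?D\<close> is the divergence of \<open>q (?w t x y)\<close> times the
        velocity.\<close>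
      have "rect_int L H (\<lambda>x y. (q' (?w t x y) * (v2xx t x y - v1yx t x y) * v1 t x y + v1x t x y * q (?w t x y))
          + (q' (?w t x y) * (v2xy t x y - v1yy t x y) * v2 t x y + v2y t x y * q (?w t x y))) = 0"
        (is "rect_int L H ?D = 0")
      proof (rule rect_int_divergence[where f = "\<lambda>x y. q (?w t x y) * v1 t x y" and g = "\<lambda>x y. q (?w t x y) * v2 t x y"])
        show "cont_ch H (\<lambda>x y. q' (?w t x y) * (v2xx t x y - v1yx t x y) * v1 t x y + v1x t x y * q (?w t x y))"
          "cont_ch H (\<lambda>x y. q' (?w t x y) * (v2xy t x y - v1yy t x y) * v2 t x y + v2y t x y * q (?w t x y))"
          by (intro cont_ch_intros cont_tc_compose[OF cw qc(1), THEN cont_tc_imp_cont_ch] cont_tc_compose[OF cw qc(2), THEN cont_tc_imp_cont_ch]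
              ac[THEN cont_tc_imp_cont_ch] bc[THEN cont_tc_imp_cont_ch])+
      qed (use LH aper bper bd in \<open>auto simp: channel_periodic_def intro!: DERIV_mult dq DERIV_diff d\<close>)
      moreover have "rect_int L H (\<lambda>x y. q' (?w t x y) * (v2xt t x y - v1yt t x y)) =
          rect_int L H (\<lambda>x y. - ?D x y)"
      proof (rule rect_int_cong)
        fix x y assume y: "y \<in> {0..H}"
        have 3: "v2y t x y = - v1x t x y" using E3[OF y, of t x] by simp
        have 1: "v2xt t x y - v1yt t x y = - (v1 t x y * (v2xx t x y - v1yx t x y) + v2 t x y * (v2xy t x y - v1yy t x y))"
          using transport[OF y, of t x] by linarith
        show "q' (?w t x y) * (v2xt t x y - v1yt t x y) = - ?D x y"
          unfolding 1 3 by (simp add: algebra_simps)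
      qed
      ultimately show "rect_int L H (\<lambda>x y. q' (?w t x y) * (v2xt t x y - v1yt t x y)) = 0" by (simp only: rect_int_minus minus_zero)
    next
      show "cont_tc H (\<lambda>t x y. q (?w t x y))" "cont_tc H (\<lambda>t x y. q' (?w t x y) * (v2xt t x y - v1yt t x y))"
        by (intro cont_tc_intros)+
      show "((\<lambda>s. q (?w s x y)) has_real_derivative q' (?w t x y) * (v2xt t x y - v1yt t x y)) (at t)" if "y \<in> {0..H}" for t x y
        by (intro dq DERIV_diff at bt that)
    qed
  qed
  have w: "cont_ch H (\<lambda>x y. v2x t x y - v1y t x y)" for t
    by (intro cont_ch_intros ac(4)[THEN cont_tc_imp_cont_ch] bc(3)[THEN cont_tc_imp_cont_ch])
  have wper: "channel_periodic L H (\<lambda>x y. v2x t x y - v1y t x y)" for t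
    by (intro channel_periodic_diff aper bper)
  have casimir: "rect_int L H (\<lambda>x y. h (v2x t x y - v1y t x y)) = rect_int L H (\<lambda>x y. h (v2x 0 x y - v1y 0 x y))"
    if "continuous_on UNIV h" for t h
    by (rule polynomial_conservation_imp_continuous[OF LH w w wper wper poly that])
  show ?thesis
    by (rule that[of v1x v1y v2x v2y];
        (rule a(1) b(1) aper(1) bper(1) bd mom energy | erule E3 | erule casimir | (rule circ, simp)))
qed

section \<open>A Sobolev inequality\<close>

lemma cont_ch_fst:
  assumes "continuous_on UNIV a"
  shows "cont_ch H (\<lambda>x y. a x)"
  unfolding cont_ch_def
  by (rule continuous_on_compose2[OF assms continuous_on_fst[OF continuous_on_id]]) auto

text \<open>The Gagliardo-Nirenberg argument: \<open>g\<close> is bounded by a function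
  \<open>\<alpha>\<close> of \<open>x\<close> alone, integrating up from the wall where it vanishes,
  and by a function \<open>\<beta>\<close> of \<open>y\<close> alone, integrating along a row. The
  integral of the product \<open>\<alpha> x * \<beta> y\<close> factorises.\<close>

lemma rect_int_square_le_W11:
  assumes LH: "L > 0" "H > 0" and p: "has_partials H g gx gy" and bd: "\<And>x. g x 0 = 0"
  shows "rect_int L H (\<lambda>x y. (g x y)\<^sup>2) \<le>
      rect_int L H (\<lambda>x y. \<bar>gy x y\<bar>) * (rect_int L H (\<lambda>x y. \<bar>g x y\<bar>) / L + rect_int L H (\<lambda>x y. \<bar>gx x y\<bar>))"
    and "rect_int L H (\<lambda>x y. \<bar>g x y\<bar>) \<le> H * rect_int L H (\<lambda>x y. \<bar>gy x y\<bar>)"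
proof -
  have [cont_ch_intros]: "cont_ch H g" "cont_ch H gx" "cont_ch H gy" using p by (auto simp: has_partials_def)
  define \<alpha> where "\<alpha> = (\<lambda>x. integral {0..H} (\<lambda>y. \<bar>gy x y\<bar>))"
  define \<beta> where "\<beta> = (\<lambda>y. integral {0..L} (\<lambda>x. \<bar>g x y\<bar>) / L + integral {0..L} (\<lambda>x. \<bar>gx x y\<bar>))"
  have ca: "continuous_on UNIV \<alpha>" unfolding \<alpha>_def by (intro cont_ch_integral_y cont_ch_intros)
  have cb: "continuous_on {0..H} \<beta>" unfolding \<beta>_def
    using LH by (intro continuous_intros cont_ch_integral_x cont_ch_intros) auto
  have ga: "\<bar>g x y\<bar> \<le> \<alpha> x" if y: "y \<in> {0..H}" for x y
  proof -
    have i: "(\<lambda>y. \<bar>gy x y\<bar>) integrable_on {0..r}" if "r \<in> {0..H}" for r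
      using that by (intro integrable_continuous_real continuous_intros cont_ch_imp_y[OF \<open>cont_ch H gy\<close>]) auto
    have hi: "(gy x has_integral g x y - g x 0) {0..y}"
      using p y by (intro fundamental_theorem_of_calculus)
        (auto simp: has_partials_def has_real_derivative_iff_has_vector_derivative[symmetric]
          intro: DERIV_subset[of _ _ _ "{0..H}"])
    have "g x y = integral {0..y} (gy x)" "gy x integrable_on {0..y}"
      using integral_unique[OF hi] has_integral_integrable[OF hi] bd by simp_all
    then have "\<bar>g x y\<bar> \<le> integral {0..y} (\<lambda>y. \<bar>gy x y\<bar>)"
      using integral_norm_bound_integral[of "gy x" "{0..y}" "\<lambda>y. \<bar>gy x y\<bar>"] i[OF y] by simp
    also have "\<dots> \<le> \<alpha> x" unfolding \<alpha>_def
      using y LH by (intro integral_subset_le i) auto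
    finally show ?thesis .
  qed
  have gb: "\<bar>g x y\<bar> \<le> \<beta> y" if x: "x \<in> {0..L}" and y: "y \<in> {0..H}" for x y
  proof -
    have c: "continuous_on A (\<lambda>x. g x y)" "continuous_on A (\<lambda>x. gx x y)" for A
      by (rule cont_ch_imp_x[OF \<open>cont_ch H g\<close> y] cont_ch_imp_x[OF \<open>cont_ch H gx\<close> y])+
    define J where "J = integral {0..L} (\<lambda>x. \<bar>gx x y\<bar>)"
    have ord: "\<bar>g r y - g s y\<bar> \<le> J" if "s \<le> r" "s \<in> {0..L}" "r \<in> {0..L}" for s r
    proof -
      have "((\<lambda>x. gx x y) has_integral g r y - g s y) {s..r}"
        using p y \<open>s \<le> r\<close> by (intro fundamental_theorem_of_calculus)
          (auto simp: has_partials_def has_real_derivative_iff_has_vector_derivative[symmetric]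
            intro: has_field_derivative_at_within)
      then have "g r y - g s y = integral {s..r} (\<lambda>x. gx x y)" by (simp add: integral_unique)
      then have "\<bar>g r y - g s y\<bar> \<le> integral {s..r} (\<lambda>x. \<bar>gx x y\<bar>)"
        using integral_norm_bound_integral[of "\<lambda>x. gx x y" "{s..r}" "\<lambda>x. \<bar>gx x y\<bar>"] c
        by (simp add: integrable_continuous_real continuous_intros)
      also have "\<dots> \<le> J" unfolding J_def
        using that c by (intro integral_subset_le integrable_continuous_real continuous_intros) auto
      finally show ?thesis .
    qed
    \<comment> \<open>No zero of \<open>g\<close> is known within a row, so the comparison point
      \<open>s\<close> is averaged over the row.\<close>
    have "\<bar>g x y\<bar> \<le> \<bar>g s y\<bar> + J" if "s \<in> {0..L}" for s
      using ord[of s x] ord[of x s] that x by (cases "s \<le> x") auto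
    then have "integral {0..L} (\<lambda>s. \<bar>g x y\<bar>) \<le> integral {0..L} (\<lambda>s. \<bar>g s y\<bar> + J)"
      using c by (intro integral_le integrable_continuous_real continuous_intros) auto
    also have "\<dots> = integral {0..L} (\<lambda>s. \<bar>g s y\<bar>) + J * L"
      using LH c by (subst integral_add) (auto intro!: integrable_continuous_real continuous_intros)
    finally have "L * \<bar>g x y\<bar> \<le> integral {0..L} (\<lambda>s. \<bar>g s y\<bar>) + J * L" using LH by simp
    then show ?thesis using LH by (simp add: \<beta>_def J_def field_simps)
  qed
  have "rect_int L H (\<lambda>x y. (g x y)\<^sup>2) \<le> rect_int L H (\<lambda>x y. \<alpha> x * \<beta> y)"
  proof (intro rect_int_mono cont_ch_intros cont_ch_fst cont_ch_snd ca cb)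
    fix x y assume xy: "x \<in> {0..L}" "y \<in> {0..H}"
    have "(g x y)\<^sup>2 = \<bar>g x y\<bar> * \<bar>g x y\<bar>" by (simp add: power2_eq_square)
    also have "\<dots> \<le> \<alpha> x * \<beta> y" using ga[OF xy(2), of x] gb[OF xy] by (intro mult_mono) auto
    finally show "(g x y)\<^sup>2 \<le> \<alpha> x * \<beta> y" .
  qed
  also have "\<dots> = integral {0..L} \<alpha> * integral {0..H} \<beta>"
    by (simp add: rect_int_iterated cont_ch_intros cont_ch_fst cont_ch_snd ca cb)
  also have "integral {0..L} \<alpha> = rect_int L H (\<lambda>x y. \<bar>gy x y\<bar>)"
    unfolding \<alpha>_def by (rule rect_int_iterated[symmetric]) (intro cont_ch_intros)
  also have "integral {0..H} \<beta> = rect_int L H (\<lambda>x y. \<bar>g x y\<bar>) / L + rect_int L H (\<lambda>x y. \<bar>gx x y\<bar>)"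
    unfolding \<beta>_def
    by (subst integral_add; (simp add: rect_int_iterated' cont_ch_intros)?)
       (use LH in \<open>auto intro!: integrable_continuous_real continuous_intros cont_ch_integral_x cont_ch_intros\<close>)
  finally show "rect_int L H (\<lambda>x y. (g x y)\<^sup>2) \<le>
      rect_int L H (\<lambda>x y. \<bar>gy x y\<bar>) * (rect_int L H (\<lambda>x y. \<bar>g x y\<bar>) / L + rect_int L H (\<lambda>x y. \<bar>gx x y\<bar>))" .
  have "rect_int L H (\<lambda>x y. \<bar>g x y\<bar>) \<le> rect_int L H (\<lambda>x y. \<alpha> x)"
    using ga by (intro rect_int_mono cont_ch_intros cont_ch_fst ca)
  also have "\<dots> = H * integral {0..L} \<alpha>"
    using LH by (simp add: rect_int_iterated cont_ch_fst ca)
  also have "integral {0..L} \<alpha> = rect_int L H (\<lambda>x y. \<bar>gy x y\<bar>)"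
    unfolding \<alpha>_def by (rule rect_int_iterated[symmetric]) (intro cont_ch_intros)
  finally show "rect_int L H (\<lambda>x y. \<bar>g x y\<bar>) \<le> H * rect_int L H (\<lambda>x y. \<bar>gy x y\<bar>)" .
qed

text \<open>The W^{1,1} inequality is applied to \<open>f ^ Suc n\<close>, whose gradient carries a
  factor \<open>f ^ n\<close>; Cauchy-Schwarz reduces its L^1 norm to the power \<open>2 * n\<close>
  of the induction hypothesis. Both sides have the same homogeneity in \<open>f\<close>, which the
  later rescaling relies on.\<close>

lemma sobolev_even_power:
  assumes LH: "L > 0" "H > 0"
  shows "\<exists>C\<ge>0. \<forall>f fx fy. has_partials H f fx fy \<longrightarrow> (\<forall>x. f x 0 = 0) \<longrightarrow>
    rect_int L H (\<lambda>x y. f x y ^ (2 * n)) \<le> C * rect_int L H (\<lambda>x y. (fx x y)\<^sup>2 + (fy x y)\<^sup>2) ^ n"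
proof (induction n)
  case 0
  show ?case using LH by (intro exI[of _ "L * H"]) (simp add: rect_int_const)
next
  case (Suc n)
  then obtain C where C: "C \<ge> 0" "\<And>f fx fy. has_partials H f fx fy \<Longrightarrow> (\<And>x. f x 0 = 0) \<Longrightarrow>
    rect_int L H (\<lambda>x y. f x y ^ (2 * n)) \<le> C * rect_int L H (\<lambda>x y. (fx x y)\<^sup>2 + (fy x y)\<^sup>2) ^ n" by blast
  show ?case
  proof (intro exI[of _ "(H / L + 1) * (real (Suc n))\<^sup>2 * C"] conjI allI impI)
    show "(H / L + 1) * (real (Suc n))\<^sup>2 * C \<ge> 0" using LH C by simp
    fix f fx fy assume p: "has_partials H f fx fy" and bd: "\<forall>x. f x 0 = 0"
    have c[cont_ch_intros]: "cont_ch H f" "cont_ch H fx" "cont_ch H fy" using p by (auto simp: has_partials_def)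
    define X where "X = rect_int L H (\<lambda>x y. (fx x y)\<^sup>2 + (fy x y)\<^sup>2)"
    have X0: "X \<ge> 0" unfolding X_def by (intro rect_int_nonneg cont_ch_intros) simp
    let ?g = "\<lambda>x y. f x y ^ Suc n"
    let ?d = "\<lambda>h x y. real (Suc n) * (h x y * f x y ^ n)"
    have pg: "has_partials H ?g (?d fx) (?d fy)"
      unfolding has_partials_def
    proof (intro conjI allI ballI)
      show "cont_ch H ?g" "cont_ch H (?d fx)" "cont_ch H (?d fy)" by (intro cont_ch_intros)+
      fix x y assume "y \<in> {0..H}"
      then have "((\<lambda>s. f s y) has_real_derivative fx x y) (at x)" "((\<lambda>s. f x s) has_real_derivative fy x y) (at y within {0..H})"
        using p by (auto simp: has_partials_def)
      from DERIV_power[OF this(1), of "Suc n"] DERIV_power[OF this(2), of "Suc n"]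
      show "((\<lambda>s. f s y ^ Suc n) has_real_derivative ?d fx x y) (at x)"
        "((\<lambda>s. f x s ^ Suc n) has_real_derivative ?d fy x y) (at y within {0..H})"
        by (simp_all add: algebra_simps)
    qed
    \<comment> \<open>\<open>K\<close> bounds the L^1 norm of both partials of
      \<open>f ^ Suc n\<close>; its square supplies the new constant.\<close>
    define K where "K = real (Suc n) * sqrt (C * X ^ Suc n)"
    have K2: "K\<^sup>2 = (real (Suc n))\<^sup>2 * C * X ^ Suc n" using C X0 by (simp add: K_def power_mult_distrib)
    have K0: "K \<ge> 0" using C X0 by (simp add: K_def)
    have dle: "rect_int L H (\<lambda>x y. \<bar>?d h x y\<bar>) \<le> K" if h: "cont_ch H h" and hX: "rect_int L H (\<lambda>x y. (h x y)\<^sup>2) \<le> X" for h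
    proof -
      note [cont_ch_intros] = h
      have "(rect_int L H (\<lambda>x y. \<bar>h x y\<bar> * \<bar>f x y ^ n\<bar>))\<^sup>2 \<le> rect_int L H (\<lambda>x y. \<bar>h x y\<bar>\<^sup>2) * rect_int L H (\<lambda>x y. \<bar>f x y ^ n\<bar>\<^sup>2)"
        by (rule rect_int_Cauchy_Schwarz) (intro cont_ch_intros)+
      also have "\<dots> = rect_int L H (\<lambda>x y. (h x y)\<^sup>2) * rect_int L H (\<lambda>x y. f x y ^ (2 * n))"
        by (simp add: power_even_eq mult.commute flip: power_mult)
      also have "\<dots> \<le> X * (C * X ^ n)"
      proof (rule mult_mono[OF hX _ X0])
        show "rect_int L H (\<lambda>x y. f x y ^ (2 * n)) \<le> C * X ^ n" unfolding X_def using C(2)[OF p] bd by blast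
        show "0 \<le> rect_int L H (\<lambda>x y. f x y ^ (2 * n))" by (intro rect_int_nonneg cont_ch_intros) simp
      qed
      finally have "rect_int L H (\<lambda>x y. \<bar>h x y\<bar> * \<bar>f x y ^ n\<bar>) \<le> sqrt (C * X ^ Suc n)"
        by (intro real_le_rsqrt) (simp add: algebra_simps)
      then have "real (Suc n) * rect_int L H (\<lambda>x y. \<bar>h x y\<bar> * \<bar>f x y ^ n\<bar>) \<le> K"
        unfolding K_def by (intro mult_left_mono) auto
      then show ?thesis by (simp only: rect_int_cmult[symmetric] abs_mult abs_of_nat)
    qed
    have "rect_int L H (\<lambda>x y. (fx x y)\<^sup>2) \<le> X" "rect_int L H (\<lambda>x y. (fy x y)\<^sup>2) \<le> X"
      unfolding X_def by (intro rect_int_mono cont_ch_intros; simp)+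
    note gx = dle[OF c(2) this(1)] and gy = dle[OF c(3) this(2)]
    have bdg: "?g x 0 = 0" for x using bd by simp
    note w = rect_int_square_le_W11[OF LH pg bdg]
    have g1: "rect_int L H (\<lambda>x y. \<bar>?g x y\<bar>) \<le> H * K"
      using w(2) mult_left_mono[OF gy, of H] LH by linarith
    have "rect_int L H (\<lambda>x y. (?g x y)\<^sup>2) \<le> K * (H * K / L + K)"
    proof (rule order_trans[OF w(1)], rule mult_mono[OF gy _ K0])
      show "rect_int L H (\<lambda>x y. \<bar>?g x y\<bar>) / L + rect_int L H (\<lambda>x y. \<bar>?d fx x y\<bar>) \<le> H * K / L + K"
        using g1 gx LH by (intro add_mono divide_right_mono) auto
      show "0 \<le> rect_int L H (\<lambda>x y. \<bar>?g x y\<bar>) / L + rect_int L H (\<lambda>x y. \<bar>?d fx x y\<bar>)"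
        using LH by (intro add_nonneg_nonneg divide_nonneg_pos rect_int_nonneg cont_ch_intros) auto
    qed
    also have "\<dots> = (H / L + 1) * K\<^sup>2" by (simp add: power2_eq_square algebra_simps)
    also have "\<dots> = (H / L + 1) * (real (Suc n))\<^sup>2 * C * X ^ Suc n" by (simp only: K2 mult.assoc)
    finally show "rect_int L H (\<lambda>x y. f x y ^ (2 * Suc n)) \<le> (H / L + 1) * (real (Suc n))\<^sup>2 * C * rect_int L H (\<lambda>x y. (fx x y)\<^sup>2 + (fy x y)\<^sup>2) ^ Suc n"
      by (simp only: X_def power_mult[symmetric] mult.commute[of 2])
  qed
qed

section \<open>Pairing L^p functions with functions of finite Dirichlet energy\<close>

lemma young_with_even_power:
  fixes a b p :: real
  assumes "1 < p" "a \<ge> 0" "b \<ge> 0" "p / (p - 1) \<le> real (2 * N)"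
  shows "a * b \<le> 1 + a ^ (2 * N) + b powr p"
proof -
  define q where "q = p / (p - 1)"
  have q: "q > 1" "1 / q + 1 / p = 1" using assms(1) by (auto simp: q_def field_simps)
  have "a * b \<le> a powr q / q + b powr p / p"
    using Youngs_inequality[OF q(1) assms(1) q(2) assms(2,3)] .
  also have "a powr q / q \<le> a powr q" using q(1) by (simp add: divide_le_eq mult_le_cancel_left1)
  also have "b powr p / p \<le> b powr p" using assms(1) by (simp add: divide_le_eq mult_le_cancel_left1)
  \<comment> \<open>The conjugate exponent \<open>q\<close> is raised to an even integer, for which
    the Sobolev inequality is available; the summand 1 covers \<open>a \<le> 1\<close>.\<close>
  also have "a powr q \<le> 1 + a ^ (2 * N)"
  proof (cases "a \<le> 1")
    case True
    then have "a powr q \<le> 1" using assms(2) q(1) by (intro powr_le1) auto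
    then show ?thesis using assms(2) zero_le_power[of a "2 * N"] by linarith
  next
    case False
    then have "a powr q \<le> a powr (real (2 * N))" using assms(4) by (intro powr_mono) (auto simp: q_def)
    also have "\<dots> = a ^ (2 * N)" using False by (intro powr_realpow) simp
    finally show ?thesis by simp
  qed
  finally show ?thesis by simp
qed

lemma le_one_plus_powr:
  fixes b p :: real
  assumes "1 < p" "b \<ge> 0"
  shows "b \<le> 1 + b powr p"
proof (cases "b \<le> 1")
  case False
  then have "b powr 1 \<le> b powr p" using assms by (intro powr_mono) auto
  then show ?thesis using False by simp
qed (use powr_ge_zero[of b p] in linarith)

lemma rect_int_powr_scale:
  assumes "cont_ch H e" "0 < \<mu>" "1 < p" "rect_int L H (\<lambda>x y. \<bar>e x y\<bar> powr p) \<le> \<mu> powr p"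
  shows "cont_ch H (\<lambda>x y. (\<bar>e x y\<bar> / \<mu>) powr p)" "rect_int L H (\<lambda>x y. (\<bar>e x y\<bar> / \<mu>) powr p) \<le> 1"
proof -
  have eq: "(\<lambda>x y. (\<bar>e x y\<bar> / \<mu>) powr p) = (\<lambda>x y. \<bar>e x y\<bar> powr p / \<mu> powr p)"
    using assms(2) by (simp add: powr_divide)
  show "cont_ch H (\<lambda>x y. (\<bar>e x y\<bar> / \<mu>) powr p)" unfolding eq using assms by (intro cont_ch_intros) auto
  show "rect_int L H (\<lambda>x y. (\<bar>e x y\<bar> / \<mu>) powr p) \<le> 1"
    unfolding eq rect_int_divide using assms by (simp add: divide_le_eq)
qed

text \<open>A Hoelder-type bound with a crude constant: \<open>b \<le> 1 + b powr p\<close> is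
  integrated after rescaling by \<open>\<mu>\<close>, which makes the result linear in
  \<open>\<mu>\<close>.\<close>

lemma rect_int_abs_le_of_Lp:
  assumes LH: "L > 0" "H > 0" and e: "cont_ch H e" "0 < \<mu>" "1 < p" "rect_int L H (\<lambda>x y. \<bar>e x y\<bar> powr p) \<le> \<mu> powr p"
  shows "rect_int L H (\<lambda>x y. \<bar>e x y\<bar>) \<le> (L * H + 1) * \<mu>"
proof -
  note s = rect_int_powr_scale[OF e]
  have "rect_int L H (\<lambda>x y. \<bar>e x y\<bar>) \<le> rect_int L H (\<lambda>x y. \<mu> * (1 + (\<bar>e x y\<bar> / \<mu>) powr p))"
  proof (intro rect_int_mono cont_ch_intros e s)
    fix x y
    show "\<bar>e x y\<bar> \<le> \<mu> * (1 + (\<bar>e x y\<bar> / \<mu>) powr p)"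
      using mult_left_mono[OF le_one_plus_powr[OF e(3), of "\<bar>e x y\<bar> / \<mu>"], of \<mu>] e(2) by simp
  qed
  also have "\<dots> = \<mu> * (L * H + rect_int L H (\<lambda>x y. (\<bar>e x y\<bar> / \<mu>) powr p))"
    using LH by (simp add: rect_int_cmult rect_int_add rect_int_const cont_ch_intros s)
  also have "\<dots> \<le> \<mu> * (L * H + 1)" using s(2) e(2) by (intro mult_left_mono) auto
  finally show ?thesis by (simp add: mult.commute)
qed

text \<open>Normalising \<open>f\<close> by the root of its Dirichlet energy and \<open>e\<close> by
  \<open>\<mu>\<close> turns the additive Young inequality into a product bound; the three
  integrated terms are then at most \<open>L * H\<close>, \<open>D\<close> and 1.\<close>

lemma rect_int_mult_le_dirichlet_Lp:
  assumes LH: "L > 0" "H > 0" and "1 < p"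
  obtains C where "C > 0" "\<And>f fx fy e \<mu>. has_partials H f fx fy \<Longrightarrow> (\<And>x. f x 0 = 0) \<Longrightarrow> cont_ch H e \<Longrightarrow> 0 < \<mu> \<Longrightarrow>
    rect_int L H (\<lambda>x y. \<bar>e x y\<bar> powr p) \<le> \<mu> powr p \<Longrightarrow>
    rect_int L H (\<lambda>x y. \<bar>f x y * e x y\<bar>) \<le> C * \<mu> * sqrt (rect_int L H (\<lambda>x y. (fx x y)\<^sup>2 + (fy x y)\<^sup>2))"
proof -
  obtain N where N: "p / (p - 1) \<le> real (2 * N)"
    using real_arch_simple[of "p / (p - 1)"] by (metis mult_2 of_nat_add of_nat_0_le_iff add_increasing order_trans)
  obtain D where D: "D \<ge> 0" "\<And>f fx fy. has_partials H f fx fy \<Longrightarrow> (\<And>x. f x 0 = 0) \<Longrightarrow>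
    rect_int L H (\<lambda>x y. f x y ^ (2 * N)) \<le> D * rect_int L H (\<lambda>x y. (fx x y)\<^sup>2 + (fy x y)\<^sup>2) ^ N"
    using sobolev_even_power[OF LH, of N] by blast
  obtain D1 where D1: "\<And>f fx fy. has_partials H f fx fy \<Longrightarrow> (\<And>x. f x 0 = 0) \<Longrightarrow>
    rect_int L H (\<lambda>x y. f x y ^ (2 * 1)) \<le> D1 * rect_int L H (\<lambda>x y. (fx x y)\<^sup>2 + (fy x y)\<^sup>2) ^ 1"
    using sobolev_even_power[OF LH, of 1] by blast
  show ?thesis
  proof (rule that[of "L * H + D + 1"])
    show "L * H + D + 1 > 0" using LH D by (simp add: add_nonneg_pos)
    fix f fx fy e \<mu>
    assume f: "has_partials H f fx fy" and bd: "\<And>x. f x 0 = 0" and e: "cont_ch H e" "0 < \<mu>"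
      "rect_int L H (\<lambda>x y. \<bar>e x y\<bar> powr p) \<le> \<mu> powr p"
    have [cont_ch_intros]: "cont_ch H f" "cont_ch H fx" "cont_ch H fy" "cont_ch H e" using f e by (auto simp: has_partials_def)
    note s = rect_int_powr_scale[OF e(1,2) \<open>1 < p\<close> e(3)]
    define X where "X = rect_int L H (\<lambda>x y. (fx x y)\<^sup>2 + (fy x y)\<^sup>2)"
    have X0: "X \<ge> 0" unfolding X_def by (intro rect_int_nonneg cont_ch_intros) simp
    show "rect_int L H (\<lambda>x y. \<bar>f x y * e x y\<bar>) \<le> (L * H + D + 1) * \<mu> * sqrt X"
    \<comment> \<open>Without energy the normalisation is impossible, but then the Sobolev
      inequality for squares makes \<open>f\<close> vanish on the cell.\<close>
    proof (cases "X = 0")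
      case True
      have "rect_int L H (\<lambda>x y. f x y ^ (2 * 1)) \<le> 0" using D1[OF f bd] True by (simp add: X_def)
      then have "(f x y)\<^sup>2 = 0" if "x \<in> {0..L}" "y \<in> {0..H}" for x y
        using that LH by (intro rect_int_eq_0D[of H "\<lambda>x y. (f x y)\<^sup>2" L x y]) (auto intro!: cont_ch_intros)
      then have "rect_int L H (\<lambda>x y. \<bar>f x y * e x y\<bar>) = rect_int L H (\<lambda>x y. 0)" by (intro rect_int_cong) simp
      then show ?thesis using True LH by (simp add: rect_int_const)
    next
      case False
      then have Xp: "X > 0" "sqrt X > 0" using X0 by auto
      have "rect_int L H (\<lambda>x y. \<bar>f x y * e x y\<bar>) \<le> rect_int L H (\<lambda>x y. (\<mu> * sqrt X) * (1 + f x y ^ (2 * N) / X ^ N + (\<bar>e x y\<bar> / \<mu>) powr p))"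
      proof (intro rect_int_mono cont_ch_intros s)
        fix x y
        have "(\<bar>f x y\<bar> / sqrt X) * (\<bar>e x y\<bar> / \<mu>) \<le> 1 + (\<bar>f x y\<bar> / sqrt X) ^ (2 * N) + (\<bar>e x y\<bar> / \<mu>) powr p"
          using Xp e(2) by (intro young_with_even_power \<open>1 < p\<close> N) auto
        also have "(\<bar>f x y\<bar> / sqrt X) ^ (2 * N) = f x y ^ (2 * N) / X ^ N"
          using Xp by (simp add: power_divide power_mult)
        finally have "(\<mu> * sqrt X) * ((\<bar>f x y\<bar> / sqrt X) * (\<bar>e x y\<bar> / \<mu>)) \<le> (\<mu> * sqrt X) * (1 + f x y ^ (2 * N) / X ^ N + (\<bar>e x y\<bar> / \<mu>) powr p)"
          using Xp e(2) by (intro mult_left_mono) auto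
        moreover have "(\<mu> * sqrt X) * ((\<bar>f x y\<bar> / sqrt X) * (\<bar>e x y\<bar> / \<mu>)) = \<bar>f x y * e x y\<bar>"
          using Xp(2) e(2) by (simp add: abs_mult)
        ultimately show "\<bar>f x y * e x y\<bar> \<le> (\<mu> * sqrt X) * (1 + f x y ^ (2 * N) / X ^ N + (\<bar>e x y\<bar> / \<mu>) powr p)" by simp
      qed
      also have "\<dots> = (\<mu> * sqrt X) * (L * H + rect_int L H (\<lambda>x y. f x y ^ (2 * N)) / X ^ N + rect_int L H (\<lambda>x y. (\<bar>e x y\<bar> / \<mu>) powr p))"
        using LH by (simp only: rect_int_cmult rect_int_add rect_int_divide rect_int_const cont_ch_intros s less_imp_le) simp
      also have "\<dots> \<le> (\<mu> * sqrt X) * (L * H + D + 1)"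
      proof -
        have "rect_int L H (\<lambda>x y. f x y ^ (2 * N)) / X ^ N \<le> D"
          using D(2)[OF f bd] Xp by (simp add: X_def divide_le_eq)
        then show ?thesis using s(2) Xp e(2) by (intro mult_left_mono) auto
      qed
      finally show ?thesis by (simp add: algebra_simps)
    qed
  qed
qed

section \<open>Convex duality and the Arnold estimate\<close>

lemma tangent_below_of_mono_derivative:
  fixes K k :: "real \<Rightarrow> real"
  assumes "\<And>s. (K has_real_derivative k s) (at s)" "mono k"
  shows "K r + k r * (s - r) \<le> K s"
proof (cases r s rule: linorder_cases)
  case less
  then obtain z where z: "r < z" "K s - K r = (s - r) * k z" using MVT2[of r s K k] assms(1) by blast
  have "k r * (s - r) \<le> k z * (s - r)" using z less monoD[OF assms(2), of r z] by (intro mult_right_mono) auto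
  then show ?thesis using z by (simp add: mult.commute)
next
  case greater
  then obtain z where z: "z < r" "K r - K s = (r - s) * k z" using MVT2[of s r K k] assms(1) by blast
  have "k z * (r - s) \<le> k r * (r - s)" using z greater monoD[OF assms(2), of z r] by (intro mult_right_mono) auto
  then show ?thesis using z by (simp add: algebra_simps)
qed simp

text \<open>\<open>g'\<close> is controlled on \<open>{a..b}\<close> only. Outside, \<open>g\<close>
  is replaced by lines of slope \<open>\<Lambda>\<close>, which makes the extension
  \<open>gt\<close> nondecreasing, \<open>\<Lambda>\<close>-Lipschitz and surjective.
  \<open>G\<close> is a primitive of \<open>gt\<close> and \<open>F\<close> its Legendre transform;
  the quadratic upper bound on \<open>G\<close> is the dual form of convexity of \<open>F\<close>
  with modulus \<open>1/\<Lambda>\<close>.\<close>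

lemma convex_conjugate_exists:
  fixes g g' :: "real \<Rightarrow> real"
  assumes "a \<le> b" and "\<Lambda> > 0" and g: "\<And>s. (g has_real_derivative g' s) (at s)"
    and g': "\<And>s. s \<in> {a..b} \<Longrightarrow> 0 \<le> g' s \<and> g' s \<le> \<Lambda>"
  obtains F G :: "real \<Rightarrow> real" where
    "\<And>w s. s * w - G s \<le> F w"
    "\<And>r. r \<in> {a..b} \<Longrightarrow> F (g r) = r * g r - G r"
    "\<And>r s. r \<in> {a..b} \<Longrightarrow> G s \<le> G r + g r * (s - r) + \<Lambda> * (s - r)\<^sup>2 / 2"
    "\<And>M w w'. \<bar>w\<bar> \<le> M \<Longrightarrow>
      \<bar>F w - F w'\<bar> \<le> (\<bar>a\<bar> + \<bar>b\<bar> + (2 * max M \<bar>w'\<bar> + \<bar>g a\<bar> + \<bar>g b\<bar>) / \<Lambda>) * \<bar>w - w'\<bar>"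
proof -
  define cl where "cl = (\<lambda>s. max a (min b s))"
  define gt where "gt = (\<lambda>s. g (cl s) + \<Lambda> * (s - cl s))"
  have cl: "cl s \<in> {a..b}" for s using \<open>a \<le> b\<close> by (simp add: cl_def)
  have gslope: "0 \<le> g s - g r \<and> g s - g r \<le> \<Lambda> * (s - r)" if "r \<le> s" "r \<in> {a..b}" "s \<in> {a..b}" for r s
  proof (cases "r = s")
    case False
    then have "r < s" using that by simp
    then obtain z where z: "r < z" "z < s" "g s - g r = (s - r) * g' z" using MVT2[of r s g g'] g by blast
    then have "0 \<le> g' z" "g' z \<le> \<Lambda>" using g'[of z] that by auto
    then have "0 \<le> (s - r) * g' z" "(s - r) * g' z \<le> (s - r) * \<Lambda>" using \<open>r < s\<close> by (auto intro: mult_left_mono)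
    then show ?thesis using z by (simp add: mult.commute)
  qed simp
  have gtslope: "0 \<le> gt s - gt r \<and> gt s - gt r \<le> \<Lambda> * (s - r)" if "r \<le> s" for r s
  proof -
    have c: "cl r \<le> cl s" "cl s - cl r \<le> s - r" using that by (auto simp: cl_def)
    have "gt s - gt r = (g (cl s) - g (cl r)) + \<Lambda> * ((s - r) - (cl s - cl r))" by (simp add: gt_def algebra_simps)
    moreover have "0 \<le> \<Lambda> * ((s - r) - (cl s - cl r))" using c \<open>\<Lambda> > 0\<close> by simp
    ultimately show ?thesis using gslope[OF c(1) cl cl] by (simp add: algebra_simps)
  qed
  have gc: "continuous_on UNIV g" using g by (auto intro: DERIV_continuous_on)
  have gtc: "continuous_on UNIV gt"
    unfolding gt_def cl_def by (intro continuous_intros continuous_on_compose2[OF gc]) auto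
  have "\<exists>G. \<forall>x::real. - \<infinity> < ereal x \<longrightarrow> ereal x < \<infinity> \<longrightarrow> (G has_vector_derivative gt x) (at x)"
    by (rule einterval_antiderivative) (use gtc in \<open>auto simp: continuous_on_eq_continuous_at\<close>)
  then obtain G where "\<And>x. (G has_vector_derivative gt x) (at x)" by auto
  then have G: "\<And>x. (G has_real_derivative gt x) (at x)" by (simp add: has_real_derivative_iff_has_vector_derivative)
  have lower: "G r + gt r * (s - r) \<le> G s" for r s
    by (rule tangent_below_of_mono_derivative[OF G]) (use gtslope in \<open>auto simp: mono_def\<close>)
  have upper: "G s \<le> G r + gt r * (s - r) + \<Lambda> * (s - r)\<^sup>2 / 2" for r s
  proof -
    \<comment> \<open>As \<open>gt\<close> has slopes at most \<open>\<Lambda>\<close>, the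
      difference \<open>\<Lambda> * s\<^sup>2 / 2 - G s\<close> is convex too.\<close>
    have "(\<Lambda> * r\<^sup>2 / 2 - G r) + (\<Lambda> * r - gt r) * (s - r) \<le> \<Lambda> * s\<^sup>2 / 2 - G s"
    proof (rule tangent_below_of_mono_derivative)
      show "((\<lambda>s. \<Lambda> * s\<^sup>2 / 2 - G s) has_real_derivative \<Lambda> * s - gt s) (at s)" for s
        by (auto intro!: derivative_eq_intros G)
      show "mono (\<lambda>s. \<Lambda> * s - gt s)"
      proof (rule monoI)
        fix x y :: real assume "x \<le> y"
        from gtslope[OF this] show "\<Lambda> * x - gt x \<le> \<Lambda> * y - gt y" by (simp add: algebra_simps)
      qed
    qed
    then show ?thesis by (simp add: field_simps power2_eq_square)
  qed
  have eqg: "gt r = g r" if "r \<in> {a..b}" for r using that by (simp add: gt_def cl_def)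
  let ?R = "\<lambda>w. \<bar>a\<bar> + \<bar>b\<bar> + (2 * \<bar>w\<bar> + \<bar>g a\<bar> + \<bar>g b\<bar>) / \<Lambda>"
  have "\<exists>s. gt s = w \<and> \<bar>s\<bar> \<le> ?R w" for w
  proof -
    \<comment> \<open>Beyond \<open>{a..b}\<close> the slope of \<open>gt\<close> is exactly
      \<open>\<Lambda>\<close>, so these offsets suffice to pass the value \<open>w\<close> and keep
      the solution of linear size in \<open>w\<close>.\<close>
    define s1 where "s1 = a - \<bar>w - g a\<bar> / \<Lambda>"
    define s2 where "s2 = b + \<bar>w - g b\<bar> / \<Lambda>"
    have q: "0 \<le> \<bar>w - g a\<bar> / \<Lambda>" "0 \<le> \<bar>w - g b\<bar> / \<Lambda>" using \<open>\<Lambda> > 0\<close> by auto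
    have "cl s1 = a" "cl s2 = b" using q \<open>a \<le> b\<close> by (auto simp: cl_def s1_def s2_def)
    then have "gt s1 \<le> w" "w \<le> gt s2" using \<open>\<Lambda> > 0\<close> by (auto simp: gt_def s1_def s2_def)
    moreover have "s1 \<le> s2" using q \<open>a \<le> b\<close> by (simp add: s1_def s2_def)
    ultimately obtain s where s: "s1 \<le> s" "s \<le> s2" "gt s = w"
      using IVT'[of gt s1 w s2] continuous_on_subset[OF gtc] by blast
    have "\<bar>w - g a\<bar> / \<Lambda> \<le> (\<bar>w\<bar> + \<bar>g a\<bar>) / \<Lambda>" "\<bar>w - g b\<bar> / \<Lambda> \<le> (\<bar>w\<bar> + \<bar>g b\<bar>) / \<Lambda>"
      using \<open>\<Lambda> > 0\<close> by (auto intro!: divide_right_mono)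
    moreover have "(\<bar>w\<bar> + \<bar>g a\<bar>) / \<Lambda> + (\<bar>w\<bar> + \<bar>g b\<bar>) / \<Lambda> = (2 * \<bar>w\<bar> + \<bar>g a\<bar> + \<bar>g b\<bar>) / \<Lambda>"
      by (simp add: add_divide_distrib)
    ultimately have "\<bar>s\<bar> \<le> ?R w" using s(1,2) q unfolding s1_def s2_def by linarith
    with s(3) show ?thesis by blast
  qed
  \<comment> \<open>\<open>gt\<close> may be constant on intervals, so \<open>\<sigma> w\<close> is
    a choice among the maximisers of \<open>s * w - G s\<close>; the value \<open>F w\<close> does
    not depend on it.\<close>
  then obtain \<sigma> where \<sigma>: "\<And>w. gt (\<sigma> w) = w" "\<And>w. \<bar>\<sigma> w\<bar> \<le> ?R w" by metis
  define F where "F = (\<lambda>w. \<sigma> w * w - G (\<sigma> w))"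
  have F1: "s * w - G s \<le> F w" for w s
    using lower[of "\<sigma> w" s] \<sigma>(1)[of w] by (simp add: F_def algebra_simps)
  have F4: "F w - F w' \<le> ?R w * \<bar>w - w'\<bar>" for w w'
  proof -
    \<comment> \<open>\<open>\<sigma> w\<close> is a subgradient of \<open>F\<close> at
      \<open>w\<close>.\<close>
    have "F w - F w' \<le> \<sigma> w * (w - w')" using F1[of "\<sigma> w" w'] by (simp add: F_def algebra_simps)
    also have "\<dots> \<le> \<bar>\<sigma> w\<bar> * \<bar>w - w'\<bar>" by (simp only: abs_mult[symmetric] abs_ge_self)
    also have "\<dots> \<le> ?R w * \<bar>w - w'\<bar>" by (rule mult_right_mono[OF \<sigma>(2)]) simp
    finally show ?thesis .
  qed
  show ?thesis
  proof (rule that[of G F])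
    show "s * w - G s \<le> F w" for w s by (rule F1)
    show "F (g r) = r * g r - G r" if "r \<in> {a..b}" for r
      using F1[of r "g r"] lower[of r "\<sigma> (g r)"] eqg[OF that] by (simp add: F_def algebra_simps)
    show "G s \<le> G r + g r * (s - r) + \<Lambda> * (s - r)\<^sup>2 / 2" if "r \<in> {a..b}" for r s
      using upper[of s r] eqg[OF that] by simp
    fix M w w' :: real assume M: "\<bar>w\<bar> \<le> M"
    let ?K = "\<bar>a\<bar> + \<bar>b\<bar> + (2 * max M \<bar>w'\<bar> + \<bar>g a\<bar> + \<bar>g b\<bar>) / \<Lambda>"
    have R: "?R w \<le> ?K" "?R w' \<le> ?K" using M \<open>\<Lambda> > 0\<close> by (auto intro!: divide_right_mono)
    have "F w - F w' \<le> ?K * \<bar>w - w'\<bar>"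
      by (rule order_trans[OF F4 mult_right_mono[OF R(1)]]) simp
    moreover have "F w' - F w \<le> ?K * \<bar>w - w'\<bar>"
      unfolding abs_minus_commute[of w w'] by (rule order_trans[OF F4 mult_right_mono[OF R(2)]]) simp
    ultimately show "\<bar>F w - F w'\<bar> \<le> ?K * \<bar>w - w'\<bar>" by linarith
  qed
qed

text \<open>Time has disappeared: \<open>\<omega>\<^sub>0\<close> and \<open>\<omega>\<close> are
  tied by equal Casimirs and one energy inequality. \<open>C\<close> is fixed before the flow data,
  which makes the later \<open>\<delta>\<close> uniform over all Euler flows.\<close>

lemma arnold_estimate:
  fixes \<Psi> g g' :: "real \<Rightarrow> real"
  assumes LH: "L > 0" "H > 0" and "1 < p" and \<Psi>: "continuous_on {0..H} \<Psi>"
    and g: "\<And>s. (g has_real_derivative g' s) (at s)"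
    and g'_bounds: "\<forall>y\<in>{0..H}. 0 \<le> g' (\<Psi> y) \<and> g' (\<Psi> y) \<le> \<Lambda>"
    and \<Lambda>: "0 < \<Lambda>" "\<Lambda> < poincare_const L H"
    and g_bound: "\<forall>y\<in>{0..H}. \<bar>g (\<Psi> y)\<bar> \<le> M"
  obtains C where "C > 0"
    "\<And>\<mu> \<omega>\<^sub>0 \<omega> \<phi> \<phi>x \<phi>y X. 0 < \<mu> \<Longrightarrow> \<mu> \<le> 1 \<Longrightarrow> cont_ch H \<omega>\<^sub>0 \<Longrightarrow> cont_ch H \<omega> \<Longrightarrow>
      has_partials H \<phi> \<phi>x \<phi>y \<Longrightarrow> channel_periodic L H \<phi> \<Longrightarrow> (\<And>x. \<phi> x 0 = 0) \<Longrightarrow> (\<And>x. \<phi> x H = 0) \<Longrightarrow>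
      X = rect_int L H (\<lambda>x y. (\<phi>x x y)\<^sup>2 + (\<phi>y x y)\<^sup>2) \<Longrightarrow>
      X = rect_int L H (\<lambda>x y. \<phi> x y * (\<omega> x y - g (\<Psi> y))) \<Longrightarrow>
      (\<And>h. continuous_on UNIV h \<Longrightarrow> rect_int L H (\<lambda>x y. h (\<omega> x y)) = rect_int L H (\<lambda>x y. h (\<omega>\<^sub>0 x y))) \<Longrightarrow>
      2 * rect_int L H (\<lambda>x y. \<Psi> y * \<omega>\<^sub>0 x y) \<le> X + 2 * rect_int L H (\<lambda>x y. \<Psi> y * \<omega> x y) \<Longrightarrow>
      rect_int L H (\<lambda>x y. \<bar>\<omega>\<^sub>0 x y - g (\<Psi> y)\<bar> powr p) \<le> \<mu> powr p \<Longrightarrow>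
      rect_int L H (\<lambda>x y. \<bar>\<omega> x y - max (- M) (min M (\<omega> x y))\<bar> powr p) \<le> \<mu> powr p \<and>
      rect_int L H (\<lambda>x y. (max (- M) (min M (\<omega> x y)) - g (\<Psi> y))\<^sup>2) \<le> C * \<mu>"
proof -
  let ?T = "\<lambda>w. max (- M) (min M w)"
  note g'le = bspec[OF g'_bounds] and M = bspec[OF g_bound]
  have M0: "M \<ge> 0" using M[of 0] LH by (simp add: order_trans[OF abs_ge_zero])
  obtain ya where ya: "ya \<in> {0..H}" "\<And>y. y \<in> {0..H} \<Longrightarrow> \<Psi> ya \<le> \<Psi> y"
    using continuous_attains_inf[of "{0..H}" \<Psi>] \<Psi> LH by auto
  obtain yb where yb: "yb \<in> {0..H}" "\<And>y. y \<in> {0..H} \<Longrightarrow> \<Psi> y \<le> \<Psi> yb"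
    using continuous_attains_sup[of "{0..H}" \<Psi>] \<Psi> LH by auto
  define a where "a = \<Psi> ya" define b where "b = \<Psi> yb"
  have \<Psi>ab: "\<Psi> y \<in> {a..b}" if "y \<in> {0..H}" for y using ya yb that by (simp add: a_def b_def)
  \<comment> \<open>The range of \<open>\<Psi>\<close> is the whole interval \<open>{a..b}\<close>,
    so the bounds on \<open>g'\<close> hold at every point of it.\<close>
  have "connected (\<Psi> ` {0..H})" by (rule connected_continuous_image[OF \<Psi>]) simp
  then have "{a..b} \<subseteq> \<Psi> ` {0..H}"
    by (rule connected_contains_Icc) (use ya yb in \<open>auto simp: a_def b_def\<close>)
  then have g'ab: "0 \<le> g' s \<and> g' s \<le> \<Lambda>" if "s \<in> {a..b}" for s using that g'le by blast
  have "a \<le> b" using ya yb by (simp add: a_def b_def)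
  obtain F G :: "real \<Rightarrow> real" where
    F1: "\<And>w s. s * w - G s \<le> F w" and
    F2: "\<And>r. r \<in> {a..b} \<Longrightarrow> F (g r) = r * g r - G r" and
    F3: "\<And>r s. r \<in> {a..b} \<Longrightarrow> G s \<le> G r + g r * (s - r) + \<Lambda> * (s - r)\<^sup>2 / 2" and
    F4: "\<And>M w w'. \<bar>w\<bar> \<le> M \<Longrightarrow>
      \<bar>F w - F w'\<bar> \<le> (\<bar>a\<bar> + \<bar>b\<bar> + (2 * max M \<bar>w'\<bar> + \<bar>g a\<bar> + \<bar>g b\<bar>) / \<Lambda>) * \<bar>w - w'\<bar>"
    using convex_conjugate_exists[OF \<open>a \<le> b\<close> \<Lambda>(1) g g'ab] by metis
  define K where "K = \<bar>a\<bar> + \<bar>b\<bar> + (2 * M + \<bar>g a\<bar> + \<bar>g b\<bar>) / \<Lambda>"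
  have K0: "K \<ge> 0" using M0 \<Lambda> by (simp add: K_def)
  have FK: "\<bar>F w - F w'\<bar> \<le> K * \<bar>w - w'\<bar>" if "\<bar>w\<bar> \<le> M" "\<bar>w'\<bar> \<le> M" for w w'
    using F4[OF that(1), of w'] that(2) by (simp add: K_def max_absorb1)
  have Tb: "\<bar>?T w\<bar> \<le> M" for w using M0 by auto
  \<comment> \<open>\<open>?T\<close> projects onto \<open>{- M..M}\<close>, which contains
    \<open>g (\<Psi> y)\<close>: projecting does not increase the distance to that point, and moves
    \<open>w\<close> by at most this distance.\<close>
  have T1: "\<bar>?T w - g (\<Psi> y)\<bar> \<le> \<bar>w - g (\<Psi> y)\<bar>" "\<bar>w - ?T w\<bar> \<le> \<bar>w - g (\<Psi> y)\<bar>" if "y \<in> {0..H}" for w y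
    using M[OF that] by auto
  have FTc: "continuous_on UNIV (\<lambda>w. F (?T w))"
  proof (rule continuous_on_compose2[of "{-M..M}" F])
    have "K-lipschitz_on {-M..M} F"
      using FK K0 by (intro lipschitz_onI) (auto simp: dist_real_def abs_le_iff)
    then show "continuous_on {-M..M} F" by (rule lipschitz_on_continuous_on)
  qed (use M0 in \<open>auto intro!: continuous_intros\<close>)
  have Tc: "continuous_on UNIV (\<lambda>w. \<bar>w - ?T w\<bar> powr p)" "continuous_on UNIV (\<lambda>w. \<bar>w - ?T w\<bar>)"
    "continuous_on UNIV ?T"
    using \<open>1 < p\<close> by (auto intro!: continuous_intros continuous_on_powr')
  have gc: "continuous_on UNIV g" using g by (auto intro: DERIV_continuous_on)
  have wbc: "continuous_on {0..H} (\<lambda>y. g (\<Psi> y))" by (rule continuous_on_compose2[OF gc \<Psi>]) auto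
  have c0[cont_ch_intros]: "cont_ch H (\<lambda>x y. \<Psi> y)" "cont_ch H (\<lambda>x y. g (\<Psi> y))"
    by (rule cont_ch_snd, fact)+
  have Fw: "continuous_on {0..H} (\<lambda>y. F (g (\<Psi> y)))"
  proof (rule continuous_on_eq)
    show "continuous_on {0..H} (\<lambda>y. F (?T (g (\<Psi> y))))"
      by (rule continuous_on_compose2[OF FTc wbc]) auto
    show "F (?T (g (\<Psi> y))) = F (g (\<Psi> y))" if "y \<in> {0..H}" for y using M[OF that] by (auto simp: abs_le_iff)
  qed
  then have cFw[cont_ch_intros]: "cont_ch H (\<lambda>x y. F (g (\<Psi> y)))" by (rule cont_ch_snd)
  define B where "B = \<bar>a\<bar> + \<bar>b\<bar>"
  have \<Psi>B: "\<bar>\<Psi> y\<bar> \<le> B" if "y \<in> {0..H}" for y using \<Psi>ab[OF that] by (auto simp: B_def)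
  have B0: "B \<ge> 0" by (simp add: B_def)
  define pc where "pc = poincare_const L H"
  have pc: "pc > 0" "\<Lambda> < pc" using \<Lambda> by (auto simp: pc_def)
  obtain C3 where C3: "C3 > 0" "\<And>f fx fy e \<mu>. has_partials H f fx fy \<Longrightarrow> (\<And>x. f x 0 = 0) \<Longrightarrow> cont_ch H e \<Longrightarrow> 0 < \<mu> \<Longrightarrow>
    rect_int L H (\<lambda>x y. \<bar>e x y\<bar> powr p) \<le> \<mu> powr p \<Longrightarrow>
    rect_int L H (\<lambda>x y. \<bar>f x y * e x y\<bar>) \<le> C3 * \<mu> * sqrt (rect_int L H (\<lambda>x y. (fx x y)\<^sup>2 + (fy x y)\<^sup>2))"
    by (fact rect_int_mult_le_dirichlet_Lp[OF LH \<open>1 < p\<close>])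
  \<comment> \<open>With \<open>m0\<close> in the role of \<open>\<mu>\<close> the constant function
    1 satisfies the L^p condition of \<open>C3\<close>; this bounds the mean of
    \<open>\<phi>\<close>.\<close>
  define m0 where "m0 = (L * H + 1) powr (1 / p)"
  have "0 < L * H" using LH by simp
  then have m0: "m0 > 0" "m0 powr p = L * H + 1" using \<open>1 < p\<close> by (simp_all add: m0_def powr_powr)
  define C2 where "C2 = C3 * m0 / (L * H)"
  define C1 where "C1 = L * H + 1"
  define C4 where "C4 = (K + 3 * B) * C1"
  define C5 where "C5 = C3 + 2 * C1 * C2"
  \<comment> \<open>The share of \<open>X\<close> that remains after subtracting the kinetic term
    \<open>X / 2\<close> and the Poincare bound \<open>\<Lambda> / (2 * pc) * X\<close>.\<close>
  define \<kappa> where "\<kappa> = (1 - \<Lambda> / pc) / 2"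
  have \<kappa>: "\<kappa> > 0" using pc by (simp add: \<kappa>_def)
  have C10: "C1 > 0" using LH by (simp add: C1_def add_pos_pos)
  have C20: "C2 > 0" using LH C3 m0 by (simp add: C2_def)
  have C40: "C4 \<ge> 0" using K0 B0 C10 by (simp add: C4_def)
  \<comment> \<open>The bound on \<open>X / \<mu>\<close> that follows from
    \<open>\<kappa> * X \<le> C4 * \<mu> + C5 * \<mu> * sqrt X\<close> once the root is absorbed
    into \<open>\<kappa> * X / 2\<close>.\<close>
  define C6 where "C6 = (2 / \<kappa>) * (C4 + C5\<^sup>2 / (2 * \<kappa>))"
  have C60: "C6 \<ge> 0" using \<kappa> C40 by (simp add: C6_def)
  define C where "C = 2 * \<Lambda> * (C6 / 2 + C4) + 1"
  show ?thesis
  proof (rule that[of C])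
    show "C > 0" using \<Lambda> C60 C40 by (simp add: C_def add_nonneg_pos)
    fix \<mu> \<omega>\<^sub>0 \<omega> \<phi> \<phi>x \<phi>y X
    assume \<mu>: "0 < \<mu>" "\<mu> \<le> 1" and c\<omega>: "cont_ch H \<omega>\<^sub>0" "cont_ch H \<omega>" and \<phi>: "has_partials H \<phi> \<phi>x \<phi>y" "channel_periodic L H \<phi>"
      "\<And>x. \<phi> x 0 = 0" "\<And>x. \<phi> x H = 0" and X: "X = rect_int L H (\<lambda>x y. (\<phi>x x y)\<^sup>2 + (\<phi>y x y)\<^sup>2)"
      "X = rect_int L H (\<lambda>x y. \<phi> x y * (\<omega> x y - g (\<Psi> y)))"
      and cas: "\<And>h. continuous_on UNIV h \<Longrightarrow> rect_int L H (\<lambda>x y. h (\<omega> x y)) = rect_int L H (\<lambda>x y. h (\<omega>\<^sub>0 x y))"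
      and en: "2 * rect_int L H (\<lambda>x y. \<Psi> y * \<omega>\<^sub>0 x y) \<le> X + 2 * rect_int L H (\<lambda>x y. \<Psi> y * \<omega> x y)"
      and small: "rect_int L H (\<lambda>x y. \<bar>\<omega>\<^sub>0 x y - g (\<Psi> y)\<bar> powr p) \<le> \<mu> powr p"
    have [cont_ch_intros]: "cont_ch H \<omega>\<^sub>0" "cont_ch H \<omega>" "cont_ch H \<phi>" "cont_ch H \<phi>x" "cont_ch H \<phi>y"
      using c\<omega> \<phi> by (auto simp: has_partials_def)
    have cT[cont_ch_intros]: "cont_ch H (\<lambda>x y. ?T (\<omega> x y))" "cont_ch H (\<lambda>x y. ?T (\<omega>\<^sub>0 x y))"
      by (rule cont_ch_compose[OF _ Tc(3)], fact)+
    have cF[cont_ch_intros]: "cont_ch H (\<lambda>x y. F (?T (\<omega> x y)))" "cont_ch H (\<lambda>x y. F (?T (\<omega>\<^sub>0 x y)))"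
      by (rule cont_ch_compose[OF _ FTc], fact)+
    have X0: "X \<ge> 0" unfolding X(1) by (intro rect_int_nonneg cont_ch_intros) simp
    have p0: "p > 0" using \<open>1 < p\<close> by simp
    have e0: "rect_int L H (\<lambda>x y. \<bar>\<omega>\<^sub>0 x y - g (\<Psi> y)\<bar>) \<le> C1 * \<mu>"
      unfolding C1_def by (rule rect_int_abs_le_of_Lp[OF LH _ \<mu>(1) \<open>1 < p\<close> small]) (intro cont_ch_intros)
    have s0: "rect_int L H (\<lambda>x y. \<bar>\<omega>\<^sub>0 x y - ?T (\<omega>\<^sub>0 x y)\<bar>) \<le> C1 * \<mu>"
      by (rule order_trans[OF rect_int_mono e0]) (intro cont_ch_intros T1(2); assumption)+
    \<comment> \<open>The clipped amount is a continuous function of the vorticity, so its integral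
      is a Casimir and keeps its initial size.\<close>
    have s1: "rect_int L H (\<lambda>x y. \<bar>\<omega> x y - ?T (\<omega> x y)\<bar>) \<le> C1 * \<mu>"
      using s0 cas[OF Tc(2)] by simp
    have sp: "rect_int L H (\<lambda>x y. \<bar>\<omega> x y - ?T (\<omega> x y)\<bar> powr p) \<le> \<mu> powr p"
    proof -
      have "rect_int L H (\<lambda>x y. \<bar>\<omega> x y - ?T (\<omega> x y)\<bar> powr p) = rect_int L H (\<lambda>x y. \<bar>\<omega>\<^sub>0 x y - ?T (\<omega>\<^sub>0 x y)\<bar> powr p)"
        by (rule cas[OF Tc(1)])
      also have "\<dots> \<le> rect_int L H (\<lambda>x y. \<bar>\<omega>\<^sub>0 x y - g (\<Psi> y)\<bar> powr p)"
        by (intro rect_int_mono cont_ch_powr p0 cont_ch_intros powr_mono2 T1(2)) (use p0 in auto)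
      finally show ?thesis using small by simp
    qed
    let ?eb = "\<lambda>x y. ?T (\<omega> x y) - g (\<Psi> y)" and ?es = "\<lambda>x y. \<omega> x y - ?T (\<omega> x y)"
    let ?ebz = "\<lambda>x y. ?T (\<omega>\<^sub>0 x y) - g (\<Psi> y)" and ?esz = "\<lambda>x y. \<omega>\<^sub>0 x y - ?T (\<omega>\<^sub>0 x y)"
    define A where "A = rect_int L H (\<lambda>x y. F (?T (\<omega> x y)) - F (g (\<Psi> y)) - \<Psi> y * ?eb x y)"
    define A0 where "A0 = rect_int L H (\<lambda>x y. F (?T (\<omega>\<^sub>0 x y)) - F (g (\<Psi> y)) - \<Psi> y * ?ebz x y)"
    \<comment> \<open>Sorted into a Casimir, a fixed number, the pairing of \<open>\<Psi>\<close>
      with \<open>\<omega>\<close> that the energy law controls, and a tail.\<close>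
    have Aeq: "A = rect_int L H (\<lambda>x y. F (?T (\<omega> x y))) - rect_int L H (\<lambda>x y. F (g (\<Psi> y)) - \<Psi> y * g (\<Psi> y))
        - rect_int L H (\<lambda>x y. \<Psi> y * \<omega> x y) + rect_int L H (\<lambda>x y. \<Psi> y * ?es x y)"
    proof -
      have "A = rect_int L H (\<lambda>x y. F (?T (\<omega> x y)) - (F (g (\<Psi> y)) - \<Psi> y * g (\<Psi> y)) - \<Psi> y * \<omega> x y + \<Psi> y * ?es x y)"
        unfolding A_def by (rule rect_int_cong) (simp add: algebra_simps)
      then show ?thesis by (simp only: rect_int_add rect_int_diff cont_ch_intros)
    qed
    have A0eq: "A0 = rect_int L H (\<lambda>x y. F (?T (\<omega>\<^sub>0 x y))) - rect_int L H (\<lambda>x y. F (g (\<Psi> y)) - \<Psi> y * g (\<Psi> y))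
        - rect_int L H (\<lambda>x y. \<Psi> y * \<omega>\<^sub>0 x y) + rect_int L H (\<lambda>x y. \<Psi> y * ?esz x y)"
    proof -
      have "A0 = rect_int L H (\<lambda>x y. F (?T (\<omega>\<^sub>0 x y)) - (F (g (\<Psi> y)) - \<Psi> y * g (\<Psi> y)) - \<Psi> y * \<omega>\<^sub>0 x y + \<Psi> y * ?esz x y)"
        unfolding A0_def by (rule rect_int_cong) (simp add: algebra_simps)
      then show ?thesis by (simp only: rect_int_add rect_int_diff cont_ch_intros)
    qed
    have \<Psi>es: "\<bar>rect_int L H (\<lambda>x y. \<Psi> y * e x y)\<bar> \<le> B * (C1 * \<mu>)"
      if "cont_ch H e" "rect_int L H (\<lambda>x y. \<bar>e x y\<bar>) \<le> C1 * \<mu>" for e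
    proof -
      note [cont_ch_intros] = that(1)
      have "\<bar>rect_int L H (\<lambda>x y. \<Psi> y * e x y)\<bar> \<le> rect_int L H (\<lambda>x y. \<bar>\<Psi> y * e x y\<bar>)"
        by (intro rect_int_abs_le cont_ch_intros)
      also have "\<dots> \<le> rect_int L H (\<lambda>x y. B * \<bar>e x y\<bar>)"
        by (intro rect_int_mono cont_ch_intros) (simp add: abs_mult mult_right_mono \<Psi>B)
      also have "\<dots> \<le> B * (C1 * \<mu>)" unfolding rect_int_cmult by (rule mult_left_mono[OF that(2) B0])
      finally show ?thesis .
    qed
    have A0le: "A0 \<le> (K + B) * (C1 * \<mu>)"
    proof -
      have "A0 \<le> rect_int L H (\<lambda>x y. (K + B) * \<bar>\<omega>\<^sub>0 x y - g (\<Psi> y)\<bar>)"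
        unfolding A0_def
      proof (intro rect_int_mono cont_ch_intros)
        fix x y assume y: "y \<in> {0..H}"
        have "F (?T (\<omega>\<^sub>0 x y)) - F (g (\<Psi> y)) \<le> K * \<bar>?ebz x y\<bar>"
          using FK[OF Tb M[OF y], of "\<omega>\<^sub>0 x y"] by linarith
        moreover have "- (\<Psi> y * ?ebz x y) \<le> B * \<bar>?ebz x y\<bar>"
        proof -
          have "- (\<Psi> y * ?ebz x y) \<le> \<bar>\<Psi> y\<bar> * \<bar>?ebz x y\<bar>" by (simp only: abs_mult[symmetric] abs_ge_minus_self)
          also have "\<dots> \<le> B * \<bar>?ebz x y\<bar>" by (rule mult_right_mono[OF \<Psi>B[OF y]]) simp
          finally show ?thesis .
        qed
        ultimately have "F (?T (\<omega>\<^sub>0 x y)) - F (g (\<Psi> y)) - \<Psi> y * ?ebz x y \<le> (K + B) * \<bar>?ebz x y\<bar>"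
          unfolding distrib_right by linarith
        also have "\<dots> \<le> (K + B) * \<bar>\<omega>\<^sub>0 x y - g (\<Psi> y)\<bar>"
          by (rule mult_left_mono[OF T1(1)[OF y]]) (use K0 B0 in simp)
        finally show "F (?T (\<omega>\<^sub>0 x y)) - F (g (\<Psi> y)) - \<Psi> y * ?ebz x y \<le> (K + B) * \<bar>\<omega>\<^sub>0 x y - g (\<Psi> y)\<bar>" .
      qed
      also have "\<dots> \<le> (K + B) * (C1 * \<mu>)" unfolding rect_int_cmult by (rule mult_left_mono[OF e0]) (use K0 B0 in simp)
      finally show ?thesis .
    qed
    \<comment> \<open>\<open>C4\<close> collects \<open>K + B\<close> from \<open>A0\<close> and
      \<open>2 * B\<close> from the tails of \<open>\<omega>\<close> and
      \<open>\<omega>\<^sub>0\<close>.\<close>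
    have Aup: "A \<le> X / 2 + C4 * \<mu>"
    proof -
      have "\<bar>rect_int L H (\<lambda>x y. \<Psi> y * ?es x y)\<bar> \<le> B * (C1 * \<mu>)" by (intro \<Psi>es s1 cont_ch_intros)
      moreover have "\<bar>rect_int L H (\<lambda>x y. \<Psi> y * ?esz x y)\<bar> \<le> B * (C1 * \<mu>)" by (intro \<Psi>es s0 cont_ch_intros)
      moreover have "rect_int L H (\<lambda>x y. F (?T (\<omega> x y))) = rect_int L H (\<lambda>x y. F (?T (\<omega>\<^sub>0 x y)))" by (rule cas[OF FTc])
      ultimately have "A \<le> A0 + X / 2 + 2 * (B * (C1 * \<mu>))" unfolding Aeq A0eq using en by linarith
      moreover have "(K + B) * (C1 * \<mu>) + 2 * (B * (C1 * \<mu>)) = C4 * \<mu>" by (simp add: C4_def algebra_simps)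
      ultimately show ?thesis using A0le by linarith
    qed
    \<comment> \<open>Fenchel-Young at \<open>\<Psi> y + \<sigma>\<close>, combined with the
      equality case at \<open>\<Psi> y\<close> and the quadratic upper bound on
      \<open>G\<close>.\<close>
    have point: "\<sigma> * ?eb x y - \<Lambda> * \<sigma>\<^sup>2 / 2 \<le> F (?T (\<omega> x y)) - F (g (\<Psi> y)) - \<Psi> y * ?eb x y"
      if y: "y \<in> {0..H}" for \<sigma> x y
      using F1[of "\<Psi> y + \<sigma>" "?T (\<omega> x y)"] F2[OF \<Psi>ab[OF y]] F3[OF \<Psi>ab[OF y], of "\<Psi> y + \<sigma>"]
      by (simp add: algebra_simps)
    have XleC6: "X \<le> C6 * \<mu>"
    proof -
      \<comment> \<open>\<open>\<phi> - m\<close> is admissible for \<open>poincare_channel\<close>: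
        it is mean-free and takes the same constant \<open>- m\<close> on both walls.\<close>
      define m where "m = rect_int L H \<phi> / (L * H)"
      have Am: "rect_int L H (\<lambda>x y. (\<phi> x y - m) * ?eb x y - \<Lambda> * (\<phi> x y - m)\<^sup>2 / 2) \<le> A"
        unfolding A_def by (intro rect_int_mono cont_ch_intros point)
      have "rect_int L H (\<lambda>x y. (\<phi> x y - m) * ?eb x y - \<Lambda> * (\<phi> x y - m)\<^sup>2 / 2)
          = rect_int L H (\<lambda>x y. \<phi> x y * (\<omega> x y - g (\<Psi> y)) - \<phi> x y * ?es x y - m * ?eb x y - (\<Lambda> / 2) * (\<phi> x y - m)\<^sup>2)"
        by (rule rect_int_cong) (simp add: algebra_simps)
      also have "\<dots> = X - rect_int L H (\<lambda>x y. \<phi> x y * ?es x y) - m * rect_int L H ?eb - (\<Lambda> / 2) * rect_int L H (\<lambda>x y. (\<phi> x y - m)\<^sup>2)"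
        by (simp only: X(2) rect_int_diff rect_int_cmult cont_ch_intros)
      finally have 1: "X - rect_int L H (\<lambda>x y. \<phi> x y * ?es x y) - m * rect_int L H ?eb - (\<Lambda> / 2) * rect_int L H (\<lambda>x y. (\<phi> x y - m)\<^sup>2) \<le> A"
        using Am by simp
      have 2: "rect_int L H (\<lambda>x y. \<phi> x y * ?es x y) \<le> C3 * \<mu> * sqrt X"
      proof -
        have "rect_int L H (\<lambda>x y. \<phi> x y * ?es x y) \<le> rect_int L H (\<lambda>x y. \<bar>\<phi> x y * ?es x y\<bar>)"
          by (intro rect_int_mono cont_ch_intros) simp
        also have "\<dots> \<le> C3 * \<mu> * sqrt X"
          unfolding X(1) by (rule C3(2)[OF \<phi>(1,3) _ \<mu>(1) sp]) (intro cont_ch_intros)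
        finally show ?thesis .
      qed
      have 3: "\<bar>m\<bar> \<le> C2 * sqrt X"
      proof -
        have "rect_int L H (\<lambda>x y. \<bar>\<phi> x y * 1\<bar>) \<le> C3 * m0 * sqrt X"
          unfolding X(1) by (rule C3(2)[OF \<phi>(1,3) _ m0(1)]) (use LH m0 in \<open>auto intro: cont_ch_intros simp: rect_int_const\<close>)
        then have "\<bar>rect_int L H \<phi>\<bar> \<le> C3 * m0 * sqrt X" using rect_int_abs_le[OF \<open>cont_ch H \<phi>\<close>, of L] by simp
        then show ?thesis using LH by (simp add: m_def C2_def abs_divide abs_mult divide_le_eq field_simps)
      qed
      \<comment> \<open>Total vorticity is the Casimir of the identity, so only the initial
        deviation and the tail contribute.\<close>
      have 4: "\<bar>rect_int L H ?eb\<bar> \<le> 2 * (C1 * \<mu>)"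
      proof -
        have "rect_int L H ?eb = rect_int L H (\<lambda>x y. (\<omega> x y - g (\<Psi> y)) - ?es x y)" by (rule rect_int_cong) simp
        also have "\<dots> = rect_int L H (\<lambda>x y. \<omega> x y - g (\<Psi> y)) - rect_int L H ?es" by (rule rect_int_diff; intro cont_ch_intros)
        also have "rect_int L H (\<lambda>x y. \<omega> x y - g (\<Psi> y)) = rect_int L H (\<lambda>x y. \<omega>\<^sub>0 x y - g (\<Psi> y))"
          using cas[of "\<lambda>w. w"] by (simp add: rect_int_diff cont_ch_intros)
        finally have "\<bar>rect_int L H ?eb\<bar> \<le> \<bar>rect_int L H (\<lambda>x y. \<omega>\<^sub>0 x y - g (\<Psi> y))\<bar> + \<bar>rect_int L H ?es\<bar>" by linarith
        moreover have "\<bar>rect_int L H (\<lambda>x y. \<omega>\<^sub>0 x y - g (\<Psi> y))\<bar> \<le> C1 * \<mu>"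
          by (rule order_trans[OF rect_int_abs_le e0]) (intro cont_ch_intros)
        moreover have "\<bar>rect_int L H ?es\<bar> \<le> C1 * \<mu>"
          by (rule order_trans[OF rect_int_abs_le s1]) (intro cont_ch_intros)
        ultimately show ?thesis by linarith
      qed
      have 5: "m * rect_int L H ?eb \<le> (C2 * sqrt X) * (2 * (C1 * \<mu>))"
      proof -
        have "m * rect_int L H ?eb \<le> \<bar>m\<bar> * \<bar>rect_int L H ?eb\<bar>" by (simp only: abs_mult[symmetric] abs_ge_self)
        also have "\<dots> \<le> (C2 * sqrt X) * (2 * (C1 * \<mu>))" using 3 4 X0 C20 by (intro mult_mono) auto
        finally show ?thesis .
      qed
      have 6: "pc * rect_int L H (\<lambda>x y. (\<phi> x y - m)\<^sup>2) \<le> X"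
      proof -
        have "rect_int L H (\<lambda>x y. \<phi> x y + - m) = 0"
          using LH by (subst rect_int_add) (auto intro: cont_ch_intros simp: rect_int_const m_def)
        then show ?thesis
          unfolding X(1) pc_def
          using poincare_channel[OF LH has_partials_add_const[OF \<phi>(1), of "- m"], of "- m"] \<phi>(2-4)
          by (simp add: channel_periodic_def)
      qed
      have 7: "(\<Lambda> / 2) * rect_int L H (\<lambda>x y. (\<phi> x y - m)\<^sup>2) \<le> (\<Lambda> / (2 * pc)) * X"
      proof -
        have "(\<Lambda> / (2 * pc)) * (pc * rect_int L H (\<lambda>x y. (\<phi> x y - m)\<^sup>2)) \<le> (\<Lambda> / (2 * pc)) * X"
          using 6 pc \<Lambda> by (intro mult_left_mono) auto
        then show ?thesis using pc by simp
      qed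
      have "X - C3 * \<mu> * sqrt X - (C2 * sqrt X) * (2 * (C1 * \<mu>)) - (\<Lambda> / (2 * pc)) * X \<le> X / 2 + C4 * \<mu>"
        using 1 2 5 7 Aup by linarith
      moreover have "X - X / 2 - (\<Lambda> / (2 * pc)) * X = \<kappa> * X" using pc by (simp add: \<kappa>_def field_simps)
      moreover have "C3 * \<mu> * sqrt X + (C2 * sqrt X) * (2 * (C1 * \<mu>)) = C5 * \<mu> * sqrt X" by (simp add: C5_def algebra_simps)
      ultimately have 8: "\<kappa> * X \<le> C4 * \<mu> + C5 * \<mu> * sqrt X" by linarith
      \<comment> \<open>Completing the square; \<open>\<mu> \<le> 1\<close> lets
        \<open>\<mu>\<close> replace its square.\<close>
      have 9: "C5 * \<mu> * sqrt X \<le> \<kappa> * X / 2 + C5\<^sup>2 * \<mu> / (2 * \<kappa>)"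
      proof -
        have "0 \<le> (\<kappa> * sqrt X - C5 * \<mu>)\<^sup>2" by simp
        also have "\<dots> = \<kappa>\<^sup>2 * X + C5\<^sup>2 * \<mu>\<^sup>2 - 2 * \<kappa> * (C5 * \<mu> * sqrt X)"
          using X0 by (simp add: power2_diff power_mult_distrib)
        also have "\<dots> \<le> \<kappa>\<^sup>2 * X + C5\<^sup>2 * \<mu> - 2 * \<kappa> * (C5 * \<mu> * sqrt X)"
          using \<mu> by (simp add: power2_eq_square mult_left_le mult_left_mono)
        finally show ?thesis using \<kappa> by (simp add: field_simps power2_eq_square)
      qed
      have "\<kappa> * X / 2 \<le> (C4 + C5\<^sup>2 / (2 * \<kappa>)) * \<mu>" using 8 9 by (simp add: algebra_simps)
      then show ?thesis using \<kappa> by (simp add: C6_def field_simps)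
    qed
    \<comment> \<open>\<open>e / \<Lambda>\<close> is the maximiser of
      \<open>\<sigma> * e - \<Lambda> * \<sigma>\<^sup>2 / 2\<close> over
      \<open>\<sigma>\<close>.\<close>
    have sq: "e / \<Lambda> * e - \<Lambda> * (e / \<Lambda>)\<^sup>2 / 2 = (1 / (2 * \<Lambda>)) * e\<^sup>2" for e
      using \<Lambda> by (simp add: power2_eq_square field_simps)
    have "rect_int L H (\<lambda>x y. (1 / (2 * \<Lambda>)) * (?eb x y)\<^sup>2) \<le> A"
      unfolding A_def
    proof (intro rect_int_mono cont_ch_intros)
      fix x y assume "y \<in> {0..H}"
      from point[OF this, of "?eb x y / \<Lambda>" x]
      show "(1 / (2 * \<Lambda>)) * (?eb x y)\<^sup>2 \<le> F (?T (\<omega> x y)) - F (g (\<Psi> y)) - \<Psi> y * ?eb x y"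
        by (simp only: sq)
    qed
    then have "rect_int L H (\<lambda>x y. (?eb x y)\<^sup>2) \<le> 2 * \<Lambda> * A"
      unfolding rect_int_cmult using \<Lambda> by (simp add: field_simps)
    also have "\<dots> \<le> 2 * \<Lambda> * ((C6 / 2 + C4) * \<mu>)"
      using Aup XleC6 \<Lambda> by (intro mult_left_mono) (auto simp: algebra_simps)
    also have "\<dots> \<le> C * \<mu>" using \<mu> by (simp add: C_def algebra_simps)
    finally show "rect_int L H (\<lambda>x y. \<bar>?es x y\<bar> powr p) \<le> \<mu> powr p \<and> rect_int L H (\<lambda>x y. (?eb x y)\<^sup>2) \<le> C * \<mu>"
      using sp by simp
  qed
qed

section \<open>Stability of shear flows\<close>

text \<open>Two partials, one of them continuous, give Frechet differentiability on the strip and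
  hence joint continuity. This serves for integrals with a variable upper limit.\<close>

lemma cont_ch_of_partials:
  assumes dx: "\<And>x y. y \<in> {0..H} \<Longrightarrow> ((\<lambda>s. f s y) has_real_derivative fx x y) (at x)"
    and dy: "\<And>x y. y \<in> {0..H} \<Longrightarrow> ((\<lambda>s. f x s) has_real_derivative fy x y) (at y within {0..H})"
    and c: "cont_ch H fy"
  shows "cont_ch H f"
proof -
  have "continuous_on (UNIV \<times> {0..H}) (\<lambda>(x, y). f x y)"
    unfolding continuous_on_eq_continuous_within
  proof clarify
    fix x y :: real assume y: "y \<in> {0..H}"
    have "continuous_on (UNIV \<times> {0..H}) (\<lambda>(x, y). blinfun_mult_right (fy x y))"
      unfolding case_prod_beta'
      by (rule bounded_linear.continuous_on[OF bounded_linear_blinfun_mult_right]) (use c in \<open>simp add: cont_ch_def\<close>)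
    then have fyc: "continuous (at (x, y) within UNIV \<times> {0..H}) (\<lambda>(x, y). blinfun_mult_right (fy x y))"
      using y by (simp add: continuous_on_eq_continuous_within)
    have "((\<lambda>(x, y). f x y) has_derivative (\<lambda>(tx, ty). fx x y * tx + blinfun_mult_right (fy x y) ty))
        (at (x, y) within UNIV \<times> {0..H})"
    proof (rule has_derivative_partialsI[OF _ _ fyc y])
      show "((\<lambda>x. f x y) has_derivative (*) (fx x y)) (at x)"
        using dx[OF y, of x] by (simp add: has_field_derivative_def)
      show "((\<lambda>y. f x y) has_derivative blinfun_apply (blinfun_mult_right (fy x y))) (at y within {0..H})"
        if "y \<in> {0..H}" for x y
        using dy[OF that, of x] by (simp add: has_field_derivative_def)
    qed simp
    then show "continuous (at (x, y) within UNIV \<times> {0..H}) (\<lambda>(x, y). f x y)" by (rule has_derivative_continuous)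
  qed
  then show ?thesis by (simp add: cont_ch_def case_prod_beta')
qed

text \<open>\<open>\<phi>\<close> integrates \<open>w1\<close> upwards from the lower wall.
  Incompressibility turns its \<open>x\<close>-derivative into \<open>- w2\<close>, so
  \<open>\<phi>\<close> is constant along the upper wall, and zero flux makes this constant
  zero.\<close>

lemma stream_function_exists:
  assumes LH: "L > 0" "H > 0" and w1: "has_partials H w1 w1x w1y" and w2: "has_partials H w2 w2x w2y"
    and per: "channel_periodic L H w1"
    and div: "\<And>x y. y \<in> {0..H} \<Longrightarrow> w1x x y + w2y x y = 0"
    and bd: "\<And>x. w2 x 0 = 0" "\<And>x. w2 x H = 0" and flux: "rect_int L H w1 = 0"
  obtains \<phi> where "has_partials H \<phi> (\<lambda>x y. - w2 x y) w1" "channel_periodic L H \<phi>" "\<And>x. \<phi> x 0 = 0" "\<And>x. \<phi> x H = 0"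
proof -
  have c: "cont_ch H w1" "cont_ch H w1x" "cont_ch H w2" "cont_ch H w2y" using w1 w2 by (auto simp: has_partials_def)
  define \<phi> where "\<phi> = (\<lambda>x y. integral {0..y} (w1 x))"
  have dy: "((\<lambda>s. \<phi> x s) has_real_derivative w1 x y) (at y within {0..H})" if "y \<in> {0..H}" for x y
    unfolding \<phi>_def by (rule integral_has_real_derivative[OF cont_ch_imp_y[OF c(1)] that]) simp
  have dx: "((\<lambda>s. \<phi> s y) has_real_derivative - w2 x y) (at x)" if y: "y \<in> {0..H}" for x y
  proof -
    have "((\<lambda>x. integral (cbox 0 y) (w1 x)) has_real_derivative integral (cbox 0 y) (w1x x)) (at x)"
    proof (rule leibniz_rule_field_derivative[where U = UNIV])
      show "((\<lambda>x. w1 x s) has_real_derivative w1x x s) (at x)" if "s \<in> cbox 0 y" for x s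
        using w1 y that by (auto simp: has_partials_def)
      show "w1 x integrable_on cbox 0 y" for x
        using y by (auto intro!: integrable_continuous_real cont_ch_imp_y[OF c(1)])
      show "continuous_on (UNIV \<times> cbox 0 y) (\<lambda>(x, s). w1x x s)"
        using c(2) unfolding cont_ch_def case_prod_beta' by (rule continuous_on_subset) (use y in auto)
    qed auto
    moreover have "integral {0..y} (w1x x) = - w2 x y"
    proof -
      have "((\<lambda>s. - w2y x s) has_integral (- w2 x y - - w2 x 0)) {0..y}"
        using w2 y by (intro fundamental_theorem_of_calculus)
          (auto simp: has_partials_def has_real_derivative_iff_has_vector_derivative[symmetric]
            intro!: DERIV_minus intro: DERIV_subset[of _ _ _ "{0..H}"])
      from integral_unique[OF this] have "integral {0..y} (\<lambda>s. - w2y x s) = - w2 x y" using bd by simp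
      moreover have "integral {0..y} (w1x x) = integral {0..y} (\<lambda>s. - w2y x s)"
        using div[of _ x] y by (intro integral_cong) (simp add: add_eq_0_iff2)
      ultimately show ?thesis by simp
    qed
    ultimately show ?thesis by (simp add: \<phi>_def cbox_interval)
  qed
  have p: "has_partials H \<phi> (\<lambda>x y. - w2 x y) w1"
    unfolding has_partials_def using dx dy cont_ch_of_partials[OF dx dy c(1)] c by (auto intro: cont_ch_intros)
  have "\<phi> x H = \<phi> 0 H" for x
    using dx[of H] LH bd by (intro DERIV_isconst_all[of "\<lambda>x. \<phi> x H"]) auto
  moreover have "rect_int L H w1 = integral {0..L} (\<lambda>x. \<phi> x H)"
    by (simp add: rect_int_iterated[OF c(1)] \<phi>_def)
  ultimately have "L * \<phi> 0 H = 0" using flux LH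
    by (metis (no_types, lifting) integral_cong content_real integral_const_real less_imp_le diff_zero real_scaleR_def)
  then have bdH: "\<phi> x H = 0" for x using LH \<open>\<And>x. \<phi> x H = \<phi> 0 H\<close>[of x] by simp
  show ?thesis
  proof (rule that[OF p _ _ bdH])
    show "channel_periodic L H \<phi>"
      unfolding channel_periodic_def \<phi>_def using per
      by (auto simp: channel_periodic_def intro!: integral_cong)
    show "\<phi> x 0 = 0" for x by (simp add: \<phi>_def)
  qed
qed

text \<open>Passage from L^2 to L^p for bounded \<open>a\<close>, on either side of
  \<open>p = 2\<close>: where \<open>a\<close> is at most \<open>\<nu>\<close> in modulus the first
  term suffices, elsewhere \<open>1 \<le> a\<^sup>2 / \<nu>\<^sup>2\<close> as in Chebyshev's
  inequality.\<close>

lemma powr_split_bound: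
  fixes a b p \<nu> B :: real
  assumes "1 < p" "0 < \<nu>" "\<bar>a\<bar> \<le> B"
  shows "\<bar>a + b\<bar> powr p \<le> 2 powr p * (\<nu> powr p + B powr p / \<nu>\<^sup>2 * a\<^sup>2 + \<bar>b\<bar> powr p)"
proof -
  have a: "\<bar>a\<bar> powr p \<le> \<nu> powr p + B powr p / \<nu>\<^sup>2 * a\<^sup>2"
  proof (cases "\<bar>a\<bar> \<le> \<nu>")
    case True
    then have "\<bar>a\<bar> powr p \<le> \<nu> powr p" using assms by (intro powr_mono2) auto
    then show ?thesis by (simp add: add_increasing2)
  next
    case False
    have "\<bar>a\<bar> powr p \<le> B powr p" using assms by (intro powr_mono2) auto
    moreover have "\<nu>\<^sup>2 \<le> a\<^sup>2" using False assms by (simp add: abs_le_square_iff[symmetric])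
    then have "B powr p * 1 \<le> B powr p * (a\<^sup>2 / \<nu>\<^sup>2)" using assms by (intro mult_left_mono) auto
    moreover have "B powr p * (a\<^sup>2 / \<nu>\<^sup>2) = B powr p / \<nu>\<^sup>2 * a\<^sup>2" by simp
    ultimately show ?thesis using powr_ge_zero[of \<nu> p] by linarith
  qed
  have "\<bar>a + b\<bar> \<le> 2 * max \<bar>a\<bar> \<bar>b\<bar>" by linarith
  then have "\<bar>a + b\<bar> powr p \<le> (2 * max \<bar>a\<bar> \<bar>b\<bar>) powr p" using assms by (intro powr_mono2) auto
  also have "\<dots> = 2 powr p * max \<bar>a\<bar> \<bar>b\<bar> powr p" by (simp add: powr_mult)
  also have "\<dots> \<le> 2 powr p * (\<bar>a\<bar> powr p + \<bar>b\<bar> powr p)"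
    by (intro mult_left_mono) (auto simp: max_def)
  also have "\<dots> \<le> 2 powr p * (\<nu> powr p + B powr p / \<nu>\<^sup>2 * a\<^sup>2 + \<bar>b\<bar> powr p)"
    using a by (intro mult_left_mono) auto
  finally show ?thesis .
qed

text \<open>Every term on the right-hand side is constant along an Euler flow.\<close>

lemma shear_energy_identity:
  assumes LH: "L > 0" "H > 0"
    and v1: "has_partials H v1 v1x v1y" and v2: "has_partials H v2 v2x v2y" and per: "channel_periodic L H v2"
    and \<Psi>: "\<And>y. y \<in> {0..H} \<Longrightarrow> (\<Psi> has_real_derivative U y) (at y within {0..H})" and U: "continuous_on {0..H} U"
  shows "rect_int L H (\<lambda>x y. (- v2 x y)\<^sup>2 + (v1 x y - (U y + k))\<^sup>2) + 2 * rect_int L H (\<lambda>x y. \<Psi> y * (v2x x y - v1y x y)) =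
    rect_int L H (\<lambda>x y. (v1 x y)\<^sup>2 + (v2 x y)\<^sup>2) - 2 * (integral {0..L} (\<lambda>x. v1 x H) * \<Psi> H - integral {0..L} (\<lambda>x. v1 x 0) * \<Psi> 0)
      - 2 * k * rect_int L H v1 + rect_int L H (\<lambda>x y. (U y + k)\<^sup>2)"
proof -
  have [cont_ch_intros]: "cont_ch H v1" "cont_ch H v1y" "cont_ch H v2" "cont_ch H v2x"
    using v1 v2 by (auto simp: has_partials_def)
  have "continuous_on {0..H} \<Psi>" using \<Psi> by (rule DERIV_continuous_on)
  then have [cont_ch_intros]: "cont_ch H (\<lambda>x y. U y)" "cont_ch H (\<lambda>x y. \<Psi> y)" using U by (auto intro: cont_ch_snd)
  have "rect_int L H (\<lambda>x y. \<Psi> y * v2x x y) = 0"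
  proof (rule rect_int_x_derivative[where f = "\<lambda>x y. \<Psi> y * v2 x y"])
    show "((\<lambda>s. \<Psi> y * v2 s y) has_real_derivative \<Psi> y * v2x x y) (at x)" if "y \<in> {0..H}" for x y
      using v2 that by (auto simp: has_partials_def intro: DERIV_cmult)
    show "\<Psi> y * v2 L y = \<Psi> y * v2 0 y" if "y \<in> {0..H}" for y
      using per that by (auto simp: channel_periodic_def dest: spec[of _ 0])
  qed (use LH in \<open>auto intro: cont_ch_intros\<close>)
  \<comment> \<open>Integrated by parts, the pairing of \<open>\<Psi>\<close> with the vorticity
    produces the integral of \<open>U y * v1 x y\<close>, which cancels the cross term of the
    expanded square and leaves circulations at the walls.\<close>
  moreover have "rect_int L H (\<lambda>x y. v1y x y * \<Psi> y + U y * v1 x y) = integral {0..L} (\<lambda>x. v1 x H * \<Psi> H - v1 x 0 * \<Psi> 0)"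
  proof (rule rect_int_y_derivative[where f = "\<lambda>x y. v1 x y * \<Psi> y"])
    show "((\<lambda>s. v1 x s * \<Psi> s) has_real_derivative v1y x y * \<Psi> y + U y * v1 x y) (at y within {0..H})" if "y \<in> {0..H}" for x y
      using v1 \<Psi> that by (auto simp: has_partials_def intro!: DERIV_mult)
  qed (use LH in \<open>auto intro!: cont_ch_intros\<close>)
  moreover have "integral {0..L} (\<lambda>x. v1 x H * \<Psi> H - v1 x 0 * \<Psi> 0) = integral {0..L} (\<lambda>x. v1 x H) * \<Psi> H - integral {0..L} (\<lambda>x. v1 x 0) * \<Psi> 0"
    using LH by (subst integral_diff)
      (auto intro!: integrable_continuous_real continuous_intros cont_ch_imp_x[OF \<open>cont_ch H v1\<close>])
  moreover have "rect_int L H (\<lambda>x y. v1y x y * \<Psi> y + U y * v1 x y) = rect_int L H (\<lambda>x y. v1y x y * \<Psi> y) + rect_int L H (\<lambda>x y. U y * v1 x y)"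
    by (rule rect_int_add; intro cont_ch_intros)
  moreover have "rect_int L H (\<lambda>x y. \<Psi> y * (v2x x y - v1y x y)) = rect_int L H (\<lambda>x y. \<Psi> y * v2x x y) - rect_int L H (\<lambda>x y. v1y x y * \<Psi> y)"
  proof -
    have "rect_int L H (\<lambda>x y. \<Psi> y * (v2x x y - v1y x y)) = rect_int L H (\<lambda>x y. \<Psi> y * v2x x y - v1y x y * \<Psi> y)"
      by (rule rect_int_cong) (simp add: algebra_simps)
    also have "\<dots> = rect_int L H (\<lambda>x y. \<Psi> y * v2x x y) - rect_int L H (\<lambda>x y. v1y x y * \<Psi> y)"
      by (rule rect_int_diff; intro cont_ch_intros)
    finally show ?thesis .
  qed
  moreover have "rect_int L H (\<lambda>x y. (- v2 x y)\<^sup>2 + (v1 x y - (U y + k))\<^sup>2) =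
      rect_int L H (\<lambda>x y. (v1 x y)\<^sup>2 + (v2 x y)\<^sup>2) - 2 * rect_int L H (\<lambda>x y. U y * v1 x y) - 2 * k * rect_int L H v1 + rect_int L H (\<lambda>x y. (U y + k)\<^sup>2)"
  proof -
    have "rect_int L H (\<lambda>x y. (- v2 x y)\<^sup>2 + (v1 x y - (U y + k))\<^sup>2) =
      rect_int L H (\<lambda>x y. ((v1 x y)\<^sup>2 + (v2 x y)\<^sup>2) - 2 * (U y * v1 x y) - (2 * k) * v1 x y + (U y + k)\<^sup>2)"
      by (rule rect_int_cong) (simp add: power2_eq_square algebra_simps)
    also have "\<dots> = rect_int L H (\<lambda>x y. (v1 x y)\<^sup>2 + (v2 x y)\<^sup>2) - 2 * rect_int L H (\<lambda>x y. U y * v1 x y) - (2 * k) * rect_int L H v1 + rect_int L H (\<lambda>x y. (U y + k)\<^sup>2)"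
      by (subst rect_int_add rect_int_diff rect_int_cmult; (intro cont_ch_intros)?)+ simp
    finally show ?thesis .
  qed
  ultimately show ?thesis by simp
qed

text \<open>\<open>\<Psi>\<close> and \<open>U\<close> describe the steady flow in the moving frame
  in which its vorticity is a function of the stream function. A uniform velocity carries no
  vorticity, so the change of frame is swallowed by the flux correction \<open>k\<close>.\<close>

lemma shear_flow_Lp_stable:
  fixes \<Psi> U g g' :: "real \<Rightarrow> real"
  assumes LH: "L > 0" "H > 0" and "1 < p"
    and \<Psi>: "\<And>y. y \<in> {0..H} \<Longrightarrow> (\<Psi> has_real_derivative U y) (at y within {0..H})"
    and U: "\<And>y. y \<in> {0..H} \<Longrightarrow> (U has_real_derivative - g (\<Psi> y)) (at y within {0..H})"
    and g: "\<And>s. (g has_real_derivative g' s) (at s)"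
    and g'le: "\<And>y. y \<in> {0..H} \<Longrightarrow> 0 \<le> g' (\<Psi> y) \<and> g' (\<Psi> y) \<le> \<Lambda>"
    and \<Lambda>: "0 < \<Lambda>" "\<Lambda> < poincare_const L H"
    and \<omega>b: "\<And>x y. 0 < y \<Longrightarrow> y < H \<Longrightarrow> \<omega>b x y = g (\<Psi> y)"
  shows "vorticity_Lp_stable L H p \<omega>b"
proof -
  have \<Psi>c: "continuous_on {0..H} \<Psi>" using \<Psi> by (rule DERIV_continuous_on)
  have Uc: "continuous_on {0..H} U" using U by (rule DERIV_continuous_on)
  have gc: "continuous_on UNIV g" using g by (auto intro: DERIV_continuous_on)
  have wbc: "continuous_on {0..H} (\<lambda>y. g (\<Psi> y))" by (rule continuous_on_compose2[OF gc \<Psi>c]) auto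
  have c0: "cont_ch H (\<lambda>x y. g (\<Psi> y))" "cont_ch H (\<lambda>x y. U y)"
    by (rule cont_ch_snd, fact)+
  obtain M where M: "M > 0" "\<And>y. y \<in> {0..H} \<Longrightarrow> \<bar>g (\<Psi> y)\<bar> \<le> M"
  proof -
    obtain B where B: "B > 0" "\<And>x y. x \<in> {0..L} \<Longrightarrow> y \<in> {0..H} \<Longrightarrow> \<bar>g (\<Psi> y)\<bar> \<le> B"
      by (fact cont_ch_bounded[OF c0(1), of L])
    show ?thesis by (rule that[OF B(1) B(2)[of 0]]) (use LH in auto)
  qed
  let ?T = "\<lambda>w. max (- M) (min M w)"
  have bounds: "\<forall>y\<in>{0..H}. 0 \<le> g' (\<Psi> y) \<and> g' (\<Psi> y) \<le> \<Lambda>" "\<forall>y\<in>{0..H}. \<bar>g (\<Psi> y)\<bar> \<le> M"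
    using g'le M(2) by blast+
  obtain C where C: "C > 0" and est: "\<And>\<mu> \<omega>\<^sub>0 \<omega> \<phi> \<phi>x \<phi>y X. 0 < \<mu> \<Longrightarrow> \<mu> \<le> 1 \<Longrightarrow> cont_ch H \<omega>\<^sub>0 \<Longrightarrow> cont_ch H \<omega> \<Longrightarrow>
      has_partials H \<phi> \<phi>x \<phi>y \<Longrightarrow> channel_periodic L H \<phi> \<Longrightarrow> (\<And>x. \<phi> x 0 = 0) \<Longrightarrow> (\<And>x. \<phi> x H = 0) \<Longrightarrow>
      X = rect_int L H (\<lambda>x y. (\<phi>x x y)\<^sup>2 + (\<phi>y x y)\<^sup>2) \<Longrightarrow>
      X = rect_int L H (\<lambda>x y. \<phi> x y * (\<omega> x y - g (\<Psi> y))) \<Longrightarrow>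
      (\<And>h. continuous_on UNIV h \<Longrightarrow> rect_int L H (\<lambda>x y. h (\<omega> x y)) = rect_int L H (\<lambda>x y. h (\<omega>\<^sub>0 x y))) \<Longrightarrow>
      2 * rect_int L H (\<lambda>x y. \<Psi> y * \<omega>\<^sub>0 x y) \<le> X + 2 * rect_int L H (\<lambda>x y. \<Psi> y * \<omega> x y) \<Longrightarrow>
      rect_int L H (\<lambda>x y. \<bar>\<omega>\<^sub>0 x y - g (\<Psi> y)\<bar> powr p) \<le> \<mu> powr p \<Longrightarrow>
      rect_int L H (\<lambda>x y. \<bar>\<omega> x y - max (- M) (min M (\<omega> x y))\<bar> powr p) \<le> \<mu> powr p \<and>
      rect_int L H (\<lambda>x y. (max (- M) (min M (\<omega> x y)) - g (\<Psi> y))\<^sup>2) \<le> C * \<mu>"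
    by (fact arnold_estimate[OF LH \<open>1 < p\<close> \<Psi>c g bounds(1) \<Lambda> bounds(2)])
  show ?thesis
    unfolding vorticity_Lp_stable_def
  proof (intro allI impI)
    fix \<epsilon> :: real assume "\<epsilon> > 0"
    define E where "E = \<epsilon> powr p"
    define S :: real where "S = 2 powr p"
    have E: "E > 0" and S: "S > 0" using \<open>\<epsilon> > 0\<close> by (simp_all add: E_def S_def)
    \<comment> \<open>Chosen so that the values below \<open>\<nu>\<close> contribute
      \<open>S * \<nu> powr p * (L * H) = E / 4\<close>.\<close>
    define \<nu> where "\<nu> = (E / (4 * S * (L * H))) powr (1 / p)"
    have \<nu>: "\<nu> > 0" "\<nu> powr p = E / (4 * S * (L * H))"
      using E S LH \<open>1 < p\<close> by (simp_all add: \<nu>_def powr_powr)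
    define K where "K = (2 * M) powr p / \<nu>\<^sup>2"
    have K: "K \<ge> 0" by (simp add: K_def)
    \<comment> \<open>This becomes the \<open>\<delta>\<close>: the second entry bounds the other
      two contributions by a further \<open>E / 4\<close>, the first gives
      \<open>\<mu> powr p \<le> \<mu>\<close>.\<close>
    define \<mu> where "\<mu> = min 1 (E / (4 * S * (K * C + 1)))"
    have KC: "K * C + 1 > 0" using K C by (simp add: add_nonneg_pos)
    have \<mu>: "0 < \<mu>" "\<mu> \<le> 1" "\<mu> \<le> E / (4 * S * (K * C + 1))" using E S KC by (simp_all add: \<mu>_def)
    show "\<exists>\<delta>>0. \<forall>v1 v2 P. euler_flow L H v1 v2 P \<longrightarrow>
        channel_Lp_norm L H p (\<lambda>x y. vorticity (v1 0) (v2 0) x y - \<omega>b x y) < \<delta> \<longrightarrow>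
        (\<forall>t. channel_Lp_norm L H p (\<lambda>x y. vorticity (v1 t) (v2 t) x y - \<omega>b x y) < \<epsilon>)"
    proof (intro exI[of _ \<mu>] conjI \<mu>(1) allI impI)
      fix v1 v2 P t
      assume eu: "euler_flow L H v1 v2 P" and
        init: "channel_Lp_norm L H p (\<lambda>x y. vorticity (v1 0) (v2 0) x y - \<omega>b x y) < \<mu>"
      obtain v1x v1y v2x v2y where
        v: "\<And>t. has_partials H (v1 t) (v1x t) (v1y t)" "\<And>t. has_partials H (v2 t) (v2x t) (v2y t)"
        and per: "\<And>t. channel_periodic L H (v1 t)" "\<And>t. channel_periodic L H (v2 t)"
        and div: "\<And>t x y. y \<in> {0..H} \<Longrightarrow> v1x t x y + v2y t x y = 0"
        and bd: "\<And>t x. v2 t x 0 = 0" "\<And>t x. v2 t x H = 0"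
        and mom: "\<And>t. rect_int L H (v1 t) = rect_int L H (v1 0)"
        and energy: "\<And>t. rect_int L H (\<lambda>x y. (v1 t x y)\<^sup>2 + (v2 t x y)\<^sup>2) = rect_int L H (\<lambda>x y. (v1 0 x y)\<^sup>2 + (v2 0 x y)\<^sup>2)"
        and circ: "\<And>t. integral {0..L} (\<lambda>x. v1 t x 0) = integral {0..L} (\<lambda>x. v1 0 x 0)"
          "\<And>t. integral {0..L} (\<lambda>x. v1 t x H) = integral {0..L} (\<lambda>x. v1 0 x H)"
        and casimir: "\<And>t h. continuous_on UNIV h \<Longrightarrow>
           rect_int L H (\<lambda>x y. h (v2x t x y - v1y t x y)) = rect_int L H (\<lambda>x y. h (v2x 0 x y - v1y 0 x y))"
        by (fact euler_conservation[OF LH eu])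
      have c: "cont_ch H (v1 t)" "cont_ch H (v1y t)" "cont_ch H (v2 t)" "cont_ch H (v2x t)" for t
        using v by (auto simp: has_partials_def)
      have c\<omega>: "cont_ch H (\<lambda>x y. v2x t x y - v1y t x y)" for t by (intro cont_ch_intros c)
      have norm: "channel_Lp_norm L H p (\<lambda>x y. vorticity (v1 t) (v2 t) x y - \<omega>b x y)
          = rect_int L H (\<lambda>x y. \<bar>v2x t x y - v1y t x y - g (\<Psi> y)\<bar> powr p) powr (1 / p)" for t
      proof -
        have "channel_integral L H (\<lambda>x y. \<bar>vorticity (v1 t) (v2 t) x y - \<omega>b x y\<bar> powr p)
            = rect_int L H (\<lambda>x y. \<bar>v2x t x y - v1y t x y - g (\<Psi> y)\<bar> powr p)"
        proof (rule channel_integral_eq)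
          show "cont_ch H (\<lambda>x y. \<bar>v2x t x y - v1y t x y - g (\<Psi> y)\<bar> powr p)"
            using \<open>1 < p\<close> by (intro cont_ch_intros c c0) simp
          show "\<bar>vorticity (v1 t) (v2 t) x y - \<omega>b x y\<bar> powr p = \<bar>v2x t x y - v1y t x y - g (\<Psi> y)\<bar> powr p"
            if "0 < y" "y < H" for x y
            using that has_partials_deriv_x[OF v(2)] has_partials_deriv_y[OF v(1)] \<omega>b by (simp add: vorticity_def)
        qed
        then show ?thesis by (simp add: channel_Lp_norm_def)
      qed
      have R0: "0 \<le> rect_int L H (\<lambda>x y. \<bar>v2x t x y - v1y t x y - g (\<Psi> y)\<bar> powr p)" for t
        using \<open>1 < p\<close> by (intro rect_int_nonneg cont_ch_intros c c0) auto
      have small: "rect_int L H (\<lambda>x y. \<bar>v2x 0 x y - v1y 0 x y - g (\<Psi> y)\<bar> powr p) \<le> \<mu> powr p"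
      proof -
        have "(rect_int L H (\<lambda>x y. \<bar>v2x 0 x y - v1y 0 x y - g (\<Psi> y)\<bar> powr p) powr (1 / p)) powr p \<le> \<mu> powr p"
          using init \<open>1 < p\<close> unfolding norm by (intro powr_mono2) auto
        then show ?thesis using R0[of 0] \<open>1 < p\<close> by (simp add: powr_powr)
      qed
      \<comment> \<open>A uniform velocity that removes the flux of the perturbation. Fixed at time
        0, it stays right because the flux is conserved.\<close>
      define k where "k = (rect_int L H (v1 0) - rect_int L H (\<lambda>x y. U y)) / (L * H)"
      define w1 where "w1 = (\<lambda>t x y. v1 t x y - (U y + k))"
      have w1: "has_partials H (w1 t) (v1x t) (\<lambda>x y. v1y t x y + g (\<Psi> y))" for t
        unfolding has_partials_def
      proof (intro conjI allI ballI)
        show "cont_ch H (w1 t)" "cont_ch H (v1x t)" "cont_ch H (\<lambda>x y. v1y t x y + g (\<Psi> y))"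
          using v(1)[of t] c c0 unfolding w1_def by (auto simp: has_partials_def intro!: cont_ch_intros)
        fix x y assume y: "y \<in> {0..H}"
        have "((\<lambda>s. v1 t s y) has_real_derivative v1x t x y) (at x)"
          "((\<lambda>s. v1 t x s) has_real_derivative v1y t x y) (at y within {0..H})"
          using v(1)[of t] y by (auto simp: has_partials_def)
        then show "((\<lambda>s. w1 t s y) has_real_derivative v1x t x y) (at x)"
          "((\<lambda>s. w1 t x s) has_real_derivative v1y t x y + g (\<Psi> y)) (at y within {0..H})"
          using U[OF y] unfolding w1_def by (auto intro!: derivative_eq_intros)
      qed
      have perw: "channel_periodic L H (w1 t)" for t using per(1)[of t] by (simp add: channel_periodic_def w1_def)
      have flux: "rect_int L H (w1 t) = 0" for t
      proof -
        have "rect_int L H (w1 t) = rect_int L H (v1 0) - (rect_int L H (\<lambda>x y. U y) + k * (L * H))"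
          unfolding w1_def using LH mom[of t]
          by (simp add: rect_int_diff rect_int_add rect_int_const cont_ch_intros c c0)
        then show ?thesis using LH by (simp add: k_def)
      qed
      obtain \<phi> where \<phi>: "has_partials H \<phi> (\<lambda>x y. - v2 t x y) (w1 t)" "channel_periodic L H \<phi>" "\<And>x. \<phi> x 0 = 0" "\<And>x. \<phi> x H = 0"
        using stream_function_exists[OF LH w1 v(2) perw div bd flux] by metis
      define X where "X = (\<lambda>t. rect_int L H (\<lambda>x y. (- v2 t x y)\<^sup>2 + (w1 t x y)\<^sup>2))"
      have nv2: "has_partials H (\<lambda>x y. - v2 t x y) (\<lambda>x y. - v2x t x y) (\<lambda>x y. - v2y t x y)"
        using v(2)[of t] unfolding has_partials_def by (auto intro!: cont_ch_intros DERIV_minus)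
      \<comment> \<open>The gradient of \<open>\<phi>\<close> is \<open>(- v2, w1)\<close>, so minus
        its Laplacian is the vorticity perturbation.\<close>
      have X2: "X t = rect_int L H (\<lambda>x y. \<phi> x y * ((v2x t x y - v1y t x y) - g (\<Psi> y)))"
        using green_identity[OF LH \<phi>(1) nv2 w1 \<phi>(2) _ \<phi>(3,4)] per(2)[of t]
        by (simp add: channel_periodic_def X_def power2_eq_square algebra_simps)
      have sid: "X t + 2 * rect_int L H (\<lambda>x y. \<Psi> y * (v2x t x y - v1y t x y)) =
          rect_int L H (\<lambda>x y. (v1 t x y)\<^sup>2 + (v2 t x y)\<^sup>2)
          - 2 * (integral {0..L} (\<lambda>x. v1 t x H) * \<Psi> H - integral {0..L} (\<lambda>x. v1 t x 0) * \<Psi> 0)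
          - 2 * k * rect_int L H (v1 t) + rect_int L H (\<lambda>x y. (U y + k)\<^sup>2)" for t
        unfolding X_def w1_def
        by (rule shear_energy_identity[OF LH v(1)[of t] v(2)[of t] per(2)[of t] _ Uc]) (rule \<Psi>)
      have cons: "X t + 2 * rect_int L H (\<lambda>x y. \<Psi> y * (v2x t x y - v1y t x y)) =
          X 0 + 2 * rect_int L H (\<lambda>x y. \<Psi> y * (v2x 0 x y - v1y 0 x y))"
        by (simp only: sid mom[of t] energy[of t] circ[of t])
      \<comment> \<open>Dropping the initial kinetic energy leaves an inequality in the useful
        direction, so \<open>X 0\<close> never has to be estimated from above.\<close>
      have "X 0 \<ge> 0" unfolding X_def w1_def by (intro rect_int_nonneg cont_ch_intros c c0) simp
      then have en: "2 * rect_int L H (\<lambda>x y. \<Psi> y * (v2x 0 x y - v1y 0 x y)) \<le> X t + 2 * rect_int L H (\<lambda>x y. \<Psi> y * (v2x t x y - v1y t x y))"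
        using cons by linarith
      let ?w = "\<lambda>x y. v2x t x y - v1y t x y"
      have bnd: "rect_int L H (\<lambda>x y. \<bar>?w x y - ?T (?w x y)\<bar> powr p) \<le> \<mu> powr p"
        "rect_int L H (\<lambda>x y. (?T (?w x y) - g (\<Psi> y))\<^sup>2) \<le> C * \<mu>"
        using est[OF \<mu>(1,2) c\<omega> c\<omega> \<phi> X_def[THEN fun_cong, of t] X2 casimir en small] by blast+
      have cT: "cont_ch H (\<lambda>x y. ?T (?w x y))"
        by (rule cont_ch_compose[OF c\<omega>]) (intro continuous_intros)
      have "rect_int L H (\<lambda>x y. \<bar>?w x y - g (\<Psi> y)\<bar> powr p) \<le>
          rect_int L H (\<lambda>x y. S * (\<nu> powr p + K * (?T (?w x y) - g (\<Psi> y))\<^sup>2 + \<bar>?w x y - ?T (?w x y)\<bar> powr p))"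
      proof (intro rect_int_mono cont_ch_intros c c0 cT)
        fix x y assume y: "y \<in> {0..H}"
        have "\<bar>?T (?w x y) - g (\<Psi> y)\<bar> \<le> 2 * M" using M(2)[OF y] M(1) by auto
        from powr_split_bound[OF \<open>1 < p\<close> \<nu>(1) this, of "?w x y - ?T (?w x y)"]
        show "\<bar>?w x y - g (\<Psi> y)\<bar> powr p \<le> S * (\<nu> powr p + K * (?T (?w x y) - g (\<Psi> y))\<^sup>2 + \<bar>?w x y - ?T (?w x y)\<bar> powr p)"
          by (simp add: S_def K_def)
      qed (use \<open>1 < p\<close> in simp_all)
      also have "\<dots> = S * (\<nu> powr p * (L * H) + K * rect_int L H (\<lambda>x y. (?T (?w x y) - g (\<Psi> y))\<^sup>2) + rect_int L H (\<lambda>x y. \<bar>?w x y - ?T (?w x y)\<bar> powr p))"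
      proof -
        have c1: "cont_ch H (\<lambda>x y. (?T (?w x y) - g (\<Psi> y))\<^sup>2)" "cont_ch H (\<lambda>x y. \<bar>?w x y - ?T (?w x y)\<bar> powr p)"
          using \<open>1 < p\<close> by (intro cont_ch_intros c c0 cT; simp)+
        show ?thesis
          using LH by (simp only: rect_int_cmult rect_int_add rect_int_const cont_ch_intros c1 less_imp_le)
      qed
      also have "\<dots> \<le> S * (\<nu> powr p * (L * H) + K * (C * \<mu>) + \<mu>)"
      proof -
        have "\<mu> powr p \<le> \<mu> powr 1" using \<mu> \<open>1 < p\<close> by (intro powr_mono') auto
        then have "rect_int L H (\<lambda>x y. \<bar>?w x y - ?T (?w x y)\<bar> powr p) \<le> \<mu>" using bnd(1) \<mu> by simp
        then show ?thesis using S mult_left_mono[OF bnd(2) K] by (intro mult_left_mono) linarith+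
      qed
      also have "\<dots> = E / 4 + S * (K * C + 1) * \<mu>" using \<nu>(2) S LH by (simp add: field_simps)
      also have "\<dots> \<le> E / 4 + E / 4"
      proof -
        have cancel: "S * Q * (E / (4 * S * Q)) = E / 4" if "S > 0" "Q > 0" for Q
          using that by simp
        have "S * (K * C + 1) * \<mu> \<le> S * (K * C + 1) * (E / (4 * S * (K * C + 1)))"
          using \<mu>(3) S KC by (intro mult_left_mono) auto
        also have "\<dots> = E / 4" using S KC by (rule cancel)
        finally show ?thesis by simp
      qed
      also have "\<dots> < E" using E by simp
      finally have lt: "rect_int L H (\<lambda>x y. \<bar>?w x y - g (\<Psi> y)\<bar> powr p) < E" .
      have "rect_int L H (\<lambda>x y. \<bar>?w x y - g (\<Psi> y)\<bar> powr p) powr (1 / p) < E powr (1 / p)"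
        by (rule powr_less_mono2[OF _ R0[of t] lt]) (use \<open>1 < p\<close> in simp)
      also have "E powr (1 / p) = \<epsilon>" using \<open>\<epsilon> > 0\<close> \<open>1 < p\<close> by (simp add: E_def powr_powr)
      finally show "channel_Lp_norm L H p (\<lambda>x y. vorticity (v1 t) (v2 t) x y - \<omega>b x y) < \<epsilon>" by (simp add: norm)
    qed
  qed
qed

theorem theorem1p2:
  fixes L H c p :: real
    and \<psi> :: "real \<Rightarrow> real \<Rightarrow> real"
    and g :: "real \<Rightarrow> real"
  assumes "L > 0" and "H > 0"
    and "Ck_channel 2 L H \<psi>"
    and "g C1_differentiable_on UNIV"
    and "\<forall>x. \<forall>y\<in>{0<..<H}. - laplacian \<psi> x y = g (\<psi> x y - c * y)"
    and "\<exists>a. \<forall>x. \<psi> x 0 = a"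
    and "\<exists>a. \<forall>x. \<psi> x H = a"
    and "1 < p"
    and "0 \<le> (INF (x, y) \<in> UNIV \<times> {0..H}. deriv g (\<psi> x y - c * y))"
    and "(SUP (x, y) \<in> UNIV \<times> {0..H}. deriv g (\<psi> x y - c * y)) < first_eigenvalue L H"
  shows "(\<exists>\<phi>. \<forall>x. \<forall>y\<in>{0..H}. \<psi> x y = \<phi> y) \<and>
         vorticity_Lp_stable L H p (\<lambda>x y. - laplacian \<psi> x y)"
proof -
  note LH = assms(1,2)
  obtain \<psi>x \<psi>y \<psi>xx \<psi>xy \<psi>yx \<psi>yy where
    pp: "has_partials H \<psi> \<psi>x \<psi>y" "has_partials H \<psi>x \<psi>xx \<psi>xy" "has_partials H \<psi>y \<psi>yx \<psi>yy"
    and per: "channel_periodic L H \<psi>" "channel_periodic L H \<psi>x" "channel_periodic L H \<psi>y"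
    using Ck_channel_2E[OF assms(3) LH(2)] by metis
  note g = C1_differentiable_on_UNIV_deriv[OF assms(4)]
  have gc: "continuous_on UNIV g" using g(1) by (auto intro: DERIV_continuous_on)
  have cl: "cont_ch H (\<lambda>x y. c * y)" by (intro cont_ch_snd continuous_intros)
  have c\<psi>: "cont_ch H \<psi>" "cont_ch H (\<lambda>x y. \<psi> x y - c * y)"
    using pp(1) cl by (auto simp: has_partials_def intro: cont_ch_diff)
  have eq: "- (\<psi>xx x y + \<psi>yy x y) = g (\<psi> x y - c * y)" if "y \<in> {0..H}" for x y
  proof (rule cont_ch_eq_closed[OF _ _ LH(2) _ that, where f = "\<lambda>x y. - (\<psi>xx x y + \<psi>yy x y)" and g = "\<lambda>x y. g (\<psi> x y - c * y)"])
    show "cont_ch H (\<lambda>x y. - (\<psi>xx x y + \<psi>yy x y))" using pp by (auto simp: has_partials_def intro!: cont_ch_intros)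
    show "cont_ch H (\<lambda>x y. g (\<psi> x y - c * y))" by (rule cont_ch_compose[OF c\<psi>(2) gc])
    show "- (\<psi>xx x y + \<psi>yy x y) = g (\<psi> x y - c * y)" if "0 < y" "y < H" for x y
      unfolding laplacian_eq[OF pp that, symmetric] using assms(5) that by auto
  qed
  \<comment> \<open>Periodicity reduces boundedness to a compact cell; the \<open>INF\<close> and
    \<open>SUP\<close> of the hypotheses are then genuine bounds and not the unspecified values of
    an unbounded set.\<close>
  have "channel_periodic L H (\<lambda>x y. deriv g (\<psi> x y - c * y))" using per(1) by (simp add: channel_periodic_def)
  from cont_ch_periodic_bounded[OF cont_ch_compose[OF c\<psi>(2) g(2)] this LH(1)]
  obtain B where B: "\<And>x y. y \<in> {0..H} \<Longrightarrow> \<bar>deriv g (\<psi> x y - c * y)\<bar> \<le> B" by blast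
  have B12: "deriv g (\<psi> x y - c * y) \<le> B" "- B \<le> deriv g (\<psi> x y - c * y)" if "y \<in> {0..H}" for x y
    using B[OF that, of x] by linarith+
  let ?S = "UNIV \<times> {0..H} :: (real \<times> real) set" and ?q = "\<lambda>(x, y). deriv g (\<psi> x y - c * y)"
  have bdd: "bdd_above (?q ` ?S)" "bdd_below (?q ` ?S)"
    by (rule bdd_aboveI2[of _ _ B] bdd_belowI2[of _ "- B"]; use B12 in force)+
  \<comment> \<open>A number strictly below the first eigenvalue that is positive even if
    \<open>deriv g\<close> vanishes on the whole range; the Arnold estimate divides by it.\<close>
  define \<Lambda> where "\<Lambda> = (max 0 (SUP z\<in>?S. ?q z) + poincare_const L H) / 2"
  have pc0: "poincare_const L H > 0" using LH by (simp add: poincare_const_def add_pos_pos)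
  have sup: "(SUP z\<in>?S. ?q z) < poincare_const L H" using assms(10) first_eigenvalue_eq[OF LH] by simp
  have \<Lambda>: "0 < \<Lambda>" "\<Lambda> < poincare_const L H" "(SUP z\<in>?S. ?q z) \<le> \<Lambda>" using sup pc0 by (auto simp: \<Lambda>_def max_def field_simps)
  have g'le: "0 \<le> deriv g (\<psi> x y - c * y) \<and> deriv g (\<psi> x y - c * y) \<le> \<Lambda>" if "y \<in> {0..H}" for x y
    using cINF_lower[OF bdd(2), of "(x, y)"] cSUP_upper[OF _ bdd(1), of "(x, y)"] that assms(9) \<Lambda>(3) by auto
  obtain a b where ab: "\<And>x. \<psi> x 0 = a" "\<And>x. \<psi> x H = b" using assms(6,7) by blast
  have i: "\<psi> x y = \<psi> 0 y" if "y \<in> {0..H}" for x y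
    by (rule semilinear_solution_x_independent[OF LH pp per(1,2) eq g(1) ab _ \<Lambda>(2) that]) (use g'le in auto)
  \<comment> \<open>Without dependence on \<open>x\<close> the equation becomes
    \<open>- \<psi>yy 0 y = g (\<psi> 0 y - c * y)\<close>, which is the profile equation for
    \<open>U\<close>.\<close>
  have xx: "\<psi>xx x y = 0" if y: "y \<in> {0..H}" for x y
  proof -
    have "((\<lambda>s. \<psi> s y) has_real_derivative \<psi>x x y) (at x)" for x using pp(1) y by (auto simp: has_partials_def)
    moreover have "(\<lambda>s. \<psi> s y) = (\<lambda>s. \<psi> 0 y)" using i[OF y] by (simp add: fun_eq_iff)
    ultimately have "\<psi>x x y = 0" for x by (metis DERIV_const DERIV_unique)
    then have "(\<lambda>s. \<psi>x s y) = (\<lambda>s. 0)" by (simp add: fun_eq_iff)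
    moreover have "((\<lambda>s. \<psi>x s y) has_real_derivative \<psi>xx x y) (at x)" using pp(2) y by (auto simp: has_partials_def)
    ultimately show ?thesis by (metis DERIV_const DERIV_unique)
  qed
  have "vorticity_Lp_stable L H p (\<lambda>x y. - laplacian \<psi> x y)"
  proof (rule shear_flow_Lp_stable[OF LH \<open>1 < p\<close>, where \<Psi> = "\<lambda>y. \<psi> 0 y - c * y" and U = "\<lambda>y. \<psi>y 0 y - c" and g = g])
    show "((\<lambda>y. \<psi> 0 y - c * y) has_real_derivative \<psi>y 0 y - c) (at y within {0..H})" if "y \<in> {0..H}" for y
      using pp(1) that by (auto simp: has_partials_def intro!: derivative_eq_intros)
    show "((\<lambda>y. \<psi>y 0 y - c) has_real_derivative - g (\<psi> 0 y - c * y)) (at y within {0..H})" if "y \<in> {0..H}" for y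
    proof -
      have "((\<lambda>y. \<psi>y 0 y) has_real_derivative \<psi>yy 0 y) (at y within {0..H})" using pp(3) that by (auto simp: has_partials_def)
      then show ?thesis using eq[OF that, of 0] xx[OF that, of 0] by (auto intro!: derivative_eq_intros)
    qed
    show "(g has_real_derivative deriv g s) (at s)" for s by (rule g(1))
    show "0 \<le> deriv g (\<psi> 0 y - c * y) \<and> deriv g (\<psi> 0 y - c * y) \<le> \<Lambda>" if "y \<in> {0..H}" for y by (rule g'le[OF that])
    show "- laplacian \<psi> x y = g (\<psi> 0 y - c * y)" if "0 < y" "y < H" for x y
      using assms(5) i[of y x] that by auto
  qed (use \<Lambda> in auto)
  then show ?thesis using i by blast
qed

end
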